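(* Let $\Gamma$ be a countable homomorphism homogeneous weakly connected oriented graph. Then $\Gamma$ is one of the following: (1) $I_1$; (2) $(\mathbb{Q},<)$; (3) a tree with no minimal elements such that no finite subset of vertices has a maximal lower bound; (4) a dual tree with no maximal elements such that no finite subset of vertices has a minimal upper bound; (5) a poset such that every finite subset of vertices is bounded from above and from below, no finite subset of vertices has a maximal lower bound or a minimal upper bound, and no $X_4$-set has a midpoint; (6) any extension of the countable universal homogeneous strict poset; (7) $C_3$; (8) $S(2)[f]$ for a surjective function $f$ with kernel classes of size at most $2$; (9) $T^\infty[f]$ for a surjective function $f$ with a countable domain.
   Context: An oriented graph is a pair $\Gamma=(V,E)$ with $V$ a non-empty set and $E\subseteq V^2$ an asymmetric relation; write $x\to y$ for $(x,y)\in E$, $x\sim y$ if $x\to y$ or $y\to x$. $\Gamma$ is weakly connected if any two vertices are joined by a finite sequence $x=z_0\sim z_1\sim\dots\sim z_k=y$. A homomorphism is an arc-preserving map; $\Gamma$ is homomorphism homogeneous if every homomorphism between finite induced subgraphs extends to an endomorphism. A strict poset $(P,<)$ is regarded as the oriented graph with arcs $x\to y$ iff $x<y$. $I_1$ is the one-vertex graph with no arcs. A poset is a tree if for every $x$ the set of elements below $x$ is a chain; a dual tree if the reverse order is a tree. An $X_4$-set is a 4-element set $\{a_1,a_2,b_1,b_2\}$ with $a_i<b_j$ for all $i,j$ and $a_1,a_2$ incomparable and $b_1,b_2$ incomparable; it has a midpoint if there is a fifth element $m$ with $a_1,a_2<m<b_1,b_2$. The countable universal homogeneous strict poset is the Fraïssé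 limit of the class of all finite strict posets; an extension of a poset $(A,<_1)$ is a poset $(A,<_2)$ with $<_1\subseteq <_2$. $C_3$ is the directed 3-cycle. $S(2)$ is the countable circular tournament: a countable dense subset of the unit circle with no two antipodal points, with $x\to y$ iff the counterclockwise angle from $x$ to $y$ is less than $\pi$. $T^\infty$ is the countable universal homogeneous tournament (Fraïssé limit of all finite tournaments). For a countable oriented graph $\Delta$, a countable set $S$ and a surjective $f\colon S\to\operatorname{V}(\Delta)$, $\Delta[f]$ has vertex set $S$ and arcs $\{(s,t)\mid (f(s),f(t))\in\operatorname{E}(\Delta)\}$; the kernel classes of $f$ are the fibres $f^{-1}(v)$. *)

theory Defs
  imports "HOL-Analysis.Analysis"
begin

section \<open>Oriented graphs\<close>

record 'a graph =
  verts :: "'a set"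
  arcs :: "'a rel"

definition oriented_graph :: "'a graph \<Rightarrow> bool" where
  "oriented_graph G \<longleftrightarrow>
     verts G \<noteq> {} \<and> arcs G \<subseteq> verts G \<times> verts G \<and> asym (arcs G)"

definition weakly_connected :: "'a graph \<Rightarrow> bool" where
  "weakly_connected G \<longleftrightarrow>
     (\<forall>x\<in>verts G. \<forall>y\<in>verts G. (x, y) \<in> (arcs G \<union> (arcs G)\<inverse>)\<^sup>*)"

definition induced :: "'a graph \<Rightarrow> 'a set \<Rightarrow> 'a graph" where
  "induced G A = \<lparr>verts = A, arcs = arcs G \<inter> A \<times> A\<rparr>"

definition is_hom :: "('a \<Rightarrow> 'b) \<Rightarrow> 'a graph \<Rightarrow> 'b graph \<Rightarrow> bool" where
  "is_hom h G H \<longleftrightarrow>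
     h \<in> verts G \<rightarrow> verts H \<and> (\<forall>(x, y)\<in>arcs G. (h x, h y) \<in> arcs H)"

definition is_iso :: "('a \<Rightarrow> 'b) \<Rightarrow> 'a graph \<Rightarrow> 'b graph \<Rightarrow> bool" where
  "is_iso h G H \<longleftrightarrow>
     bij_betw h (verts G) (verts H) \<and>
     (\<forall>x\<in>verts G. \<forall>y\<in>verts G. (x, y) \<in> arcs G \<longleftrightarrow> (h x, h y) \<in> arcs H)"

definition isomorphic :: "'a graph \<Rightarrow> 'b graph \<Rightarrow> bool" where
  "isomorphic G H \<longleftrightarrow> (\<exists>h. is_iso h G H)"

definition hom_homogeneous :: "'a graph \<Rightarrow> bool" where
  "hom_homogeneous G \<longleftrightarrow>
     (\<forall>A B h. A \<subseteq> verts G \<and> finite A \<and> B \<subseteq> verts G \<and> finite B \<and>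
        is_hom h (induced G A) (induced G B) \<longrightarrow>
        (\<exists>g. is_hom g G G \<and> (\<forall>x\<in>A. g x = h x)))"

definition homogeneous :: "'a graph \<Rightarrow> bool" where
  "homogeneous G \<longleftrightarrow>
     (\<forall>A B h. A \<subseteq> verts G \<and> finite A \<and> B \<subseteq> verts G \<and> finite B \<and>
        is_iso h (induced G A) (induced G B) \<longrightarrow>
        (\<exists>g. is_iso g G G \<and> (\<forall>x\<in>A. g x = h x)))"

text \<open>Finite graphs are represented, up to isomorphism, by graphs whose vertices are
  natural numbers, so that classes of finite graphs are sets of such graphs.\<close>

definition age :: "'a graph \<Rightarrow> nat graph set" where
  "age G = {H. oriented_graph H \<and> finite (verts H) \<and>
              (\<exists>A\<subseteq>verts G. isomorphic H (induced G A))}"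

definition fraisse_limit :: "nat graph set \<Rightarrow> 'a graph \<Rightarrow> bool" where
  "fraisse_limit K G \<longleftrightarrow>
     oriented_graph G \<and> countable (verts G) \<and> homogeneous G \<and> age G = K"

definition blowup :: "'b graph \<Rightarrow> 'a set \<Rightarrow> ('a \<Rightarrow> 'b) \<Rightarrow> 'a graph" where
  "blowup D S f = \<lparr>verts = S, arcs = {(s, t). s \<in> S \<and> t \<in> S \<and> (f s, f t) \<in> arcs D}\<rparr>"


section \<open>Posets\<close>

text \<open>Asymmetry and transitivity of the arc relation amount to a strict partial order.\<close>

definition strict_poset :: "'a graph \<Rightarrow> bool" where
  "strict_poset G \<longleftrightarrow> oriented_graph G \<and> trans (arcs G)"

definition dual :: "'a graph \<Rightarrow> 'a graph" where
  "dual G = \<lparr>verts = verts G, arcs = (arcs G)\<inverse>\<rparr>"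

definition tree :: "'a graph \<Rightarrow> bool" where
  "tree G \<longleftrightarrow>
     strict_poset G \<and> (\<forall>x\<in>verts G. total_on {y \<in> verts G. (y, x) \<in> arcs G} (arcs G))"

definition dual_tree :: "'a graph \<Rightarrow> bool" where
  "dual_tree G \<longleftrightarrow> tree (dual G)"

text \<open>Bounds are strict: \<open>z\<close> is a lower bound of \<open>A\<close> if \<open>z < a\<close> for all \<open>a\<close> in \<open>A\<close>. With
  non-strict bounds, every singleton would be its own maximal lower bound.\<close>

definition lower_bounds :: "'a graph \<Rightarrow> 'a set \<Rightarrow> 'a set" where
  "lower_bounds G A = {z \<in> verts G. \<forall>a\<in>A. (z, a) \<in> arcs G}"

definition upper_bounds :: "'a graph \<Rightarrow> 'a set \<Rightarrow> 'a set" where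
  "upper_bounds G A = {z \<in> verts G. \<forall>a\<in>A. (a, z) \<in> arcs G}"

definition maximal_in :: "'a graph \<Rightarrow> 'a set \<Rightarrow> 'a \<Rightarrow> bool" where
  "maximal_in G B m \<longleftrightarrow> m \<in> B \<and> (\<forall>y\<in>B. (m, y) \<notin> arcs G)"

definition minimal_in :: "'a graph \<Rightarrow> 'a set \<Rightarrow> 'a \<Rightarrow> bool" where
  "minimal_in G B m \<longleftrightarrow> m \<in> B \<and> (\<forall>y\<in>B. (y, m) \<notin> arcs G)"

definition no_finite_max_lower_bound :: "'a graph \<Rightarrow> bool" where
  "no_finite_max_lower_bound G \<longleftrightarrow>
     (\<forall>A\<subseteq>verts G. finite A \<longrightarrow> (\<nexists>z. maximal_in G (lower_bounds G A) z))"

definition no_finite_min_upper_bound :: "'a graph \<Rightarrow> bool" where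
  "no_finite_min_upper_bound G \<longleftrightarrow>
     (\<forall>A\<subseteq>verts G. finite A \<longrightarrow> (\<nexists>z. minimal_in G (upper_bounds G A) z))"

definition incomparable :: "'a graph \<Rightarrow> 'a \<Rightarrow> 'a \<Rightarrow> bool" where
  "incomparable G x y \<longleftrightarrow> x \<noteq> y \<and> (x, y) \<notin> arcs G \<and> (y, x) \<notin> arcs G"

definition X4 :: "'a graph \<Rightarrow> 'a \<Rightarrow> 'a \<Rightarrow> 'a \<Rightarrow> 'a \<Rightarrow> bool" where
  "X4 G a1 a2 b1 b2 \<longleftrightarrow>
     {a1, a2, b1, b2} \<subseteq> verts G \<and> {a1, a2} \<times> {b1, b2} \<subseteq> arcs G \<and>
     incomparable G a1 a2 \<and> incomparable G b1 b2"

definition X4_midpoint :: "'a graph \<Rightarrow> 'a \<Rightarrow> 'a \<Rightarrow> 'a \<Rightarrow> 'a \<Rightarrow> 'a \<Rightarrow> bool" where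
  "X4_midpoint G a1 a2 b1 b2 m \<longleftrightarrow>
     m \<in> verts G \<and> {a1, a2} \<times> {m} \<subseteq> arcs G \<and> {m} \<times> {b1, b2} \<subseteq> arcs G"

definition generic_poset :: "'a graph \<Rightarrow> bool" where
  "generic_poset G \<longleftrightarrow> fraisse_limit {H. finite (verts H) \<and> strict_poset H} G"

definition poset_extension :: "'a graph \<Rightarrow> 'a graph \<Rightarrow> bool" where
  "poset_extension P Q \<longleftrightarrow>
     strict_poset P \<and> strict_poset Q \<and> verts Q = verts P \<and> arcs P \<subseteq> arcs Q"

definition Q_order :: "rat graph" where
  "Q_order = \<lparr>verts = UNIV, arcs = {(x, y). x < y}\<rparr>"


section \<open>The remaining graphs of the classification\<close>

definition I1 :: "nat graph" where
  "I1 = \<lparr>verts = {0}, arcs = {}\<rparr>"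

definition C3 :: "nat graph" where
  "C3 = \<lparr>verts = {0, 1, 2}, arcs = {(0, 1), (1, 2), (2, 0)}\<rparr>"

definition tournament :: "'a graph \<Rightarrow> bool" where
  "tournament G \<longleftrightarrow> oriented_graph G \<and> total_on (verts G) (arcs G)"

definition generic_tournament :: "'a graph \<Rightarrow> bool" where
  "generic_tournament G \<longleftrightarrow> fraisse_limit {H. finite (verts H) \<and> tournament H} G"

text \<open>For points of the unit circle, \<open>Arg2pi (y / x)\<close> is the counterclockwise angle in
  \<open>[0, 2 * pi)\<close> from \<open>x\<close> to \<open>y\<close>; the angle \<open>0\<close> is excluded because there are no loops.
  The circular tournament is determined only up to isomorphism, so the predicate holds of
  the graph of every admissible set of points.\<close>

definition circular_tournament :: "complex graph \<Rightarrow> bool" where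
  "circular_tournament G \<longleftrightarrow>
     countable (verts G) \<and> verts G \<subseteq> sphere 0 1 \<and> sphere 0 1 \<subseteq> closure (verts G) \<and>
     (\<forall>x\<in>verts G. - x \<notin> verts G) \<and>
     arcs G = {(x, y). x \<in> verts G \<and> y \<in> verts G \<and>
                 0 < Arg2pi (y / x) \<and> Arg2pi (y / x) < pi}"

end

theory Submission imports Defs begin

text \<open>Homomorphism homogeneity means that finite partial homomorphisms have one-point extensions.

  If the arcs are transitive and neither they nor their converse form a tree, then all finite sets are
  bounded. If moreover some \<open>X\<^sub>4\<close>-set has a midpoint, then all \<open>X\<^sub>4\<close>-sets have one, finite sets
  \<open>S < T\<close> can be interpolated, and a generic suborder is built by meeting countably many dense sets
  of finite conditions.

  Otherwise \<open>a \<rightarrow> b \<rightarrow> c\<close> without \<open>a \<rightarrow> c\<close> gives \<open>c \<rightarrow> a\<close>: if \<open>a\<close> and \<open>c\<close> were not adjacent, then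
  mapping both to \<open>a\<close> would not extend to \<open>b\<close>. Every further vertex is adjacent to an end of each arc, so
  non-adjacency is an equivalence relation and the graph is a blowup of a homogeneous tournament \<open>T\<close>
  that contains a 3-cycle. If no vertex of \<open>T\<close> dominates a 3-cycle, then \<open>T\<close> is the 3-cycle or all its
  in- and out-neighbourhoods are dense chains; reversing the arcs between the two sides of a vertex gives
  a dense order, which is placed on the circle by Cantor's theorem. Three pairwise non-adjacent
  vertices with a common out-neighbour could then be mapped to a 3-cycle, which has none.
  If a vertex of \<open>T\<close> dominates a 3-cycle, then \<open>T\<close> contains all finite tournaments, by the method of
  Lachlan: the tournaments that are realised together with a chain \<open>L\<close> of any length and with any
  prescribed arcs to \<open>L\<close> form an amalgamation class, whose limit again has a vertex dominating a
  3-cycle. By induction on the size this limit contains \<open>F - {x}\<close>, and a chain of length one supplies \<open>x\<close>.\<close>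

section \<open>Generic constructions and Cantor's theorem\<close>

text \<open>A partial homomorphism between tournaments is automatically an embedding, because
  between two distinct vertices one of the two arcs is always present. So in the quotient T
  homomorphism homogeneity is ordinary homogeneity, and a configuration can be copied wherever an
  isomorphic part of it is found. The obstacle in the last case is that adding two vertices over the
  same finite set leaves the arc between them free. The remedy is always the same: requirements are
  written one after the other along one long chain, and whichever way the free arc turns out, some
  segment of the chain carries a solved requirement. This shows that the realisable tournaments
  amalgamate and, with two segments carrying swapped prescriptions, that a 3-cycle and a vertex
  dominating it can be given any four types over a chain. Chains serve as reference sets because a
  Ramsey argument produces them, with arbitrary arcs to a second chain, from a single vertex
  dominating a 3-cycle.\<close>

lemma rasiowa_sikorski:
  fixes le :: "'c \<Rightarrow> 'c \<Rightarrow> bool"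
  assumes refl: "\<And>p. le p p" and trans: "\<And>p q r. le p q \<Longrightarrow> le q r \<Longrightarrow> le p r"
    and "P p0" and "countable I"
    and dense: "\<And>i p. i \<in> I \<Longrightarrow> P p \<Longrightarrow> \<exists>q. P q \<and> le p q \<and> D i q"
  shows "\<exists>f :: nat \<Rightarrow> 'c. f 0 = p0 \<and> (\<forall>n. P (f n)) \<and> (\<forall>m n. m \<le> n \<longrightarrow> le (f m) (f n)) \<and>
           (\<forall>i\<in>I. \<exists>n. D i (f n))"
proof (cases "I = {}")
  case True
  then show ?thesis using assms by (intro exI[of _ "\<lambda>_. p0"]) auto
next
  case False
  \<comment> \<open>Requirement \<open>e n\<close> is met at step \<open>n + 1\<close> and may be
    lost later; callers choose \<open>D\<close> so that meeting it once is enough.\<close>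
  define e where "e = from_nat_into I"
  have e: "e n \<in> I" for n using False by (simp add: e_def from_nat_into)
  have "\<exists>f. \<forall>n. (P (f n) \<and> (n = 0 \<longrightarrow> f n = p0)) \<and> (le (f n) (f (Suc n)) \<and> D (e n) (f (Suc n)))"
    by (rule dependent_nat_choice) (use \<open>P p0\<close> dense e in blast)+
  then obtain f where f: "\<And>n. P (f n)" "f 0 = p0"
    "\<And>n. le (f n) (f (Suc n))" "\<And>n. D (e n) (f (Suc n))" by metis
  have "le (f m) (f n)" if "m \<le> n" for m n
    using that by (induction n rule: dec_induct) (use refl trans f(3) in blast)+
  moreover have "\<exists>n. D i (f n)" if i: "i \<in> I" for i
  proof -
    obtain n where "e n = i"
      unfolding e_def using from_nat_into_surj[OF \<open>countable I\<close> i] by blast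
    then show ?thesis using f(4) by blast
  qed
  ultimately show ?thesis using f by blast
qed

text \<open>\<open>\<Phi>\<close> is meant for finite stages and may fail for their union, so the
  conclusion only places any two pairs in a common stage. This is enough to transfer properties of
  pairs, such as preserving a binary relation.\<close>

lemma back_and_forth:
  fixes \<Phi> :: "('a \<times> 'b) set \<Rightarrow> bool"
  assumes "countable M" "countable N" "\<Phi> r0"
    and forth: "\<And>r x. \<Phi> r \<Longrightarrow> x \<in> M \<Longrightarrow> \<exists>y\<in>N. \<Phi> (insert (x, y) r)"
    and bwd: "\<And>r y. \<Phi> r \<Longrightarrow> y \<in> N \<Longrightarrow> \<exists>x\<in>M. \<Phi> (insert (x, y) r)"
  shows "\<exists>r. r0 \<subseteq> r \<and> (\<forall>x\<in>M. \<exists>y\<in>N. (x, y) \<in> r) \<and> (\<forall>y\<in>N. \<exists>x\<in>M. (x, y) \<in> r) \<and>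
             (\<forall>p\<in>r. \<forall>q\<in>r. \<exists>s. \<Phi> s \<and> p \<in> s \<and> q \<in> s)"
proof -
  define D where "D i s = (case i of Inl x \<Rightarrow> \<exists>y\<in>N. (x, y) \<in> s | Inr y \<Rightarrow> \<exists>x\<in>M. (x, y) \<in> s)"
    for i :: "'a + 'b" and s
  have "\<exists>f :: nat \<Rightarrow> ('a \<times> 'b) set. f 0 = r0 \<and> (\<forall>n. \<Phi> (f n)) \<and> (\<forall>m n. m \<le> n \<longrightarrow> f m \<subseteq> f n) \<and>
           (\<forall>i\<in>M <+> N. \<exists>n. D i (f n))"
  proof (rule rasiowa_sikorski)
    show "countable (M <+> N)" using assms(1,2) by (simp add: Plus_def)
    fix i r assume i: "i \<in> M <+> N" and r: "\<Phi> r"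
    show "\<exists>q. \<Phi> q \<and> r \<subseteq> q \<and> D i q"
    proof (cases i)
      case (Inl x)
      then obtain y where "y \<in> N" "\<Phi> (insert (x, y) r)" using forth r i by blast
      then show ?thesis using Inl by (intro exI[of _ "insert (x, y) r"]) (auto simp: D_def)
    next
      case (Inr y)
      then obtain x where "x \<in> M" "\<Phi> (insert (x, y) r)" using bwd r i by blast
      then show ?thesis using Inr by (intro exI[of _ "insert (x, y) r"]) (auto simp: D_def)
    qed
  qed (use assms in auto)
  then obtain f :: "nat \<Rightarrow> ('a \<times> 'b) set" where f0: "f 0 = r0 \<and> (\<forall>n. \<Phi> (f n)) \<and> (\<forall>m n. m \<le> n \<longrightarrow> f m \<subseteq> f n) \<and>
      (\<forall>i\<in>M <+> N. \<exists>n. D i (f n))" ..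
  then have f: "f 0 = r0" "\<And>n. \<Phi> (f n)" "\<And>m n. m \<le> n \<Longrightarrow> f m \<subseteq> f n"
    "\<And>i. i \<in> M <+> N \<Longrightarrow> \<exists>n. D i (f n)" by simp_all
  define r where "r = (\<Union>n. f n)"
  have "r0 \<subseteq> r" using f(1) unfolding r_def by blast
  moreover have "\<exists>y\<in>N. (x, y) \<in> r" if "x \<in> M" for x
    using f(4)[of "Inl x"] that unfolding r_def D_def by auto
  moreover have "\<exists>x\<in>M. (x, y) \<in> r" if "y \<in> N" for y
    using f(4)[of "Inr y"] that unfolding r_def D_def by auto
  moreover have "\<exists>s. \<Phi> s \<and> p \<in> s \<and> q \<in> s" if pq: "p \<in> r" "q \<in> r" for p q
  proof -
    obtain m n where "p \<in> f m" "q \<in> f n" using pq unfolding r_def by blast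
    then have "p \<in> f (max m n)" "q \<in> f (max m n)" using f(3) by (meson max.cobounded1 max.cobounded2 subsetD)+
    then show ?thesis using f(2) by blast
  qed
  ultimately show ?thesis by blast
qed

section \<open>Cantor's theorem on countable dense orders\<close>

lemma finite_separate:
  fixes A B :: "rat set"
  assumes "finite A" "finite B" "\<And>a b. a \<in> A \<Longrightarrow> b \<in> B \<Longrightarrow> a < b"
  shows "\<exists>q. (\<forall>a\<in>A. a < q) \<and> (\<forall>b\<in>B. q < b)"
proof (cases "A = {}")
  case True
  have "\<exists>q. \<forall>b\<in>B. q < b" using assms(2)
    by (metis Min_le ex_in_conv leD less_le_not_le lt_ex not_less order.strict_trans1)
  then show ?thesis using True by auto
next
  case False
  show ?thesis
  proof (cases "B = {}")
    case True
    have "\<exists>q. \<forall>b\<in>A. b < q" using assms(1)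
      by (metis Max_ge gt_ex order.strict_trans1)
    then show ?thesis using True by auto
  next
    case B: False
    have "Max A < Min B" using assms False B by simp
    then obtain q where "Max A < q" "q < Min B" using dense by blast
    then show ?thesis using assms(1,2) False B
      by (metis Max_ge Min_le order.strict_trans1 order.strict_trans2)
  qed
qed

definition dense_order :: "('a \<Rightarrow> 'a \<Rightarrow> bool) \<Rightarrow> 'a set \<Rightarrow> bool" where
  "dense_order R M \<longleftrightarrow> M \<noteq> {} \<and> (\<forall>x\<in>M. \<not> R x x) \<and> (\<forall>x\<in>M. \<forall>y\<in>M. x \<noteq> y \<longrightarrow> R x y \<or> R y x) \<and>
     (\<forall>x\<in>M. \<forall>y\<in>M. \<forall>z\<in>M. R x y \<longrightarrow> R y z \<longrightarrow> R x z) \<and>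
     (\<forall>x\<in>M. \<forall>y\<in>M. R x y \<longrightarrow> (\<exists>z\<in>M. R x z \<and> R z y)) \<and>
     (\<forall>x\<in>M. (\<exists>y\<in>M. R x y) \<and> (\<exists>y\<in>M. R y x))"

text \<open>Counterpart of \<open>finite_separate\<close> for the abstract order: density separates
  the greatest element of \<open>A\<close> from the least element of \<open>B\<close>, and the
  absence of endpoints handles an empty side.\<close>

lemma dense_order_separate:
  assumes M: "dense_order R M" and "finite A" "finite B" "A \<subseteq> M" "B \<subseteq> M"
    and AB: "\<And>a b. a \<in> A \<Longrightarrow> b \<in> B \<Longrightarrow> R a b"
  shows "\<exists>q\<in>M. (\<forall>a\<in>A. R a q) \<and> (\<forall>b\<in>B. R q b)"
proof -
  have tr: "\<And>x y z. x\<in>M \<Longrightarrow> y\<in>M \<Longrightarrow> z\<in>M \<Longrightarrow> R x y \<Longrightarrow> R y z \<Longrightarrow> R x z"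
    and tot: "\<And>x y. x\<in>M \<Longrightarrow> y\<in>M \<Longrightarrow> x \<noteq> y \<Longrightarrow> R x y \<or> R y x"
    using M unfolding dense_order_def by blast+
  have mx: "\<exists>m\<in>A. \<forall>a\<in>A. a = m \<or> R a m" if "A \<noteq> {}" "finite A" "A \<subseteq> M" for A
    using that(2,1,3)
  proof (induction A rule: finite_ne_induct)
    case (insert x F)
    then obtain m where m: "m \<in> F" "\<forall>a\<in>F. a = m \<or> R a m" by blast
    then consider "x = m" | "R x m" | "R m x" using tot[of x m] insert.prems by blast
    then show ?case
    proof cases
      case 3
      then have "\<forall>a\<in>F. R a x" using m tr insert.prems by (metis insert_subset subsetD)
      then show ?thesis by blast
    qed (use m in blast)+
  qed auto
  have mn: "\<exists>m\<in>A. \<forall>a\<in>A. a = m \<or> R m a" if "A \<noteq> {}" "finite A" "A \<subseteq> M" for A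
    using that(2,1,3)
  proof (induction A rule: finite_ne_induct)
    case (insert x F)
    then obtain m where m: "m \<in> F" "\<forall>a\<in>F. a = m \<or> R m a" by blast
    then consider "x = m" | "R m x" | "R x m" using tot[of x m] insert.prems by blast
    then show ?case
    proof cases
      case 3
      then have "\<forall>a\<in>F. R x a" using m tr insert.prems by (metis insert_subset subsetD)
      then show ?thesis by blast
    qed (use m in blast)+
  qed auto
  have ne: "M \<noteq> {}" and d: "\<And>x y. x\<in>M \<Longrightarrow> y\<in>M \<Longrightarrow> R x y \<Longrightarrow> \<exists>z\<in>M. R x z \<and> R z y"
    and u: "\<And>x. x\<in>M \<Longrightarrow> \<exists>y\<in>M. R x y" "\<And>x. x\<in>M \<Longrightarrow> \<exists>y\<in>M. R y x"
    using M unfolding dense_order_def by blast+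
  consider "A = {}" "B = {}" | "A = {}" "B \<noteq> {}" | "A \<noteq> {}" "B = {}" | "A \<noteq> {}" "B \<noteq> {}" by blast
  then show ?thesis
  proof cases
    case 1 then show ?thesis using ne by auto
  next
    case 2
    then obtain b where b: "b \<in> B" "\<forall>a\<in>B. a = b \<or> R b a" using mn assms by metis
    then obtain q where "q \<in> M" "R q b" using u assms by blast
    then show ?thesis using 2 b tr assms by (metis empty_iff subsetD)
  next
    case 3
    then obtain b where b: "b \<in> A" "\<forall>a\<in>A. a = b \<or> R a b" using mx assms by metis
    then obtain q where "q \<in> M" "R b q" using u assms by blast
    then show ?thesis using 3 b tr assms by (metis empty_iff subsetD)
  next
    case 4
    obtain a where a: "a \<in> A" "\<forall>x\<in>A. x = a \<or> R x a" using 4 mx assms by metis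
    obtain b where b: "b \<in> B" "\<forall>x\<in>B. x = b \<or> R b x" using 4 mn assms by metis
    obtain q where "q \<in> M" "R a q" "R q b" using d AB a b assms by (meson subsetD)
    then show ?thesis using a b tr assms by (metis subsetD)
  qed
qed

lemma ball_insert_pairs:
  "(\<forall>p\<in>insert a r. \<forall>q\<in>insert a r. C p q) \<longleftrightarrow>
   C a a \<and> (\<forall>p\<in>r. C a p \<and> C p a) \<and> (\<forall>p\<in>r. \<forall>q\<in>r. C p q)"
  by auto

theorem cantor_isomorphism:
  assumes M: "dense_order R M" and "countable M"
  shows "\<exists>f :: 'a \<Rightarrow> rat. bij_betw f M UNIV \<and> (\<forall>x\<in>M. \<forall>y\<in>M. R x y \<longleftrightarrow> f x < f y)"
proof -
  define \<Phi> where "\<Phi> r \<longleftrightarrow> finite r \<and> fst ` r \<subseteq> M \<and>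
      (\<forall>p\<in>r. \<forall>q\<in>r. (fst p = fst q \<longleftrightarrow> snd p = snd q) \<and> (R (fst p) (fst q) \<longleftrightarrow> snd p < snd q))"
    for r :: "('a \<times> rat) set"
  have irr: "\<And>x. x\<in>M \<Longrightarrow> \<not> R x x" and
    tr: "\<And>x y z. x\<in>M \<Longrightarrow> y\<in>M \<Longrightarrow> z\<in>M \<Longrightarrow> R x y \<Longrightarrow> R y z \<Longrightarrow> R x z"
    and tot: "\<And>x y. x\<in>M \<Longrightarrow> y\<in>M \<Longrightarrow> x \<noteq> y \<Longrightarrow> R x y \<or> R y x"
    using M unfolding dense_order_def by metis+
  have asy: "\<And>x y. x\<in>M \<Longrightarrow> y\<in>M \<Longrightarrow> R x y \<Longrightarrow> \<not> R y x" using irr tr by blast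
  have forth: "\<exists>y\<in>UNIV. \<Phi> (insert (x, y) r)" if r: "\<Phi> r" and x: "x \<in> M" for r x
  proof (cases "x \<in> fst ` r")
    case True
    then obtain y where "(x, y) \<in> r" by auto
    then have "insert (x, y) r = r" by blast
    then show ?thesis using r by (metis UNIV_I)
  next
    case False
    let ?A = "snd ` {p \<in> r. R (fst p) x}" and ?B = "snd ` {p \<in> r. R x (fst p)}"
    have "\<exists>q. (\<forall>a\<in>?A. a < q) \<and> (\<forall>b\<in>?B. q < b)"
    proof (rule finite_separate)
      fix a b assume "a \<in> ?A" "b \<in> ?B"
      then obtain p q where "p \<in> r" "q \<in> r" "R (fst p) x" "R x (fst q)" "a = snd p" "b = snd q" by auto
      moreover have "R (fst p) (fst q)" using calculation r x tr unfolding \<Phi>_def by (meson image_subset_iff)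
      ultimately show "a < b" using r unfolding \<Phi>_def by blast
    qed (use r in \<open>auto simp: \<Phi>_def\<close>)
    then obtain y where y: "\<And>p. p \<in> r \<Longrightarrow> R (fst p) x \<Longrightarrow> snd p < y"
       "\<And>p. p \<in> r \<Longrightarrow> R x (fst p) \<Longrightarrow> y < snd p" by blast
    have c: "R (fst p) x \<longleftrightarrow> snd p < y" "R x (fst p) \<longleftrightarrow> y < snd p" "snd p \<noteq> y" "fst p \<noteq> x" if "p \<in> r" for p
    proof -
      have m: "fst p \<in> M" "fst p \<noteq> x" using that False r unfolding \<Phi>_def by auto
      then show "R (fst p) x \<longleftrightarrow> snd p < y" "R x (fst p) \<longleftrightarrow> y < snd p" "snd p \<noteq> y" "fst p \<noteq> x"
        using y[OF that] tot[of "fst p" x] x by (metis less_asym' less_irrefl)+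
    qed
    have "finite (insert (x, y) r)" "fst ` insert (x, y) r \<subseteq> M" using r x by (simp_all add: \<Phi>_def)
    moreover have "\<forall>p\<in>insert (x, y) r. \<forall>q\<in>insert (x, y) r.
        (fst p = fst q \<longleftrightarrow> snd p = snd q) \<and> (R (fst p) (fst q) \<longleftrightarrow> snd p < snd q)"
      unfolding ball_insert_pairs using r irr[OF x] c c(3,4)[symmetric] by (simp add: \<Phi>_def)
    ultimately have "\<Phi> (insert (x, y) r)" unfolding \<Phi>_def by blast
    then show ?thesis by blast
  qed
  have bwd: "\<exists>x\<in>M. \<Phi> (insert (x, y) r)" if r: "\<Phi> r" for r y
  proof (cases "y \<in> snd ` r")
    case True
    then obtain x where "(x, y) \<in> r" by auto
    moreover from this have "insert (x, y) r = r" by blast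
    moreover have "x \<in> M" using \<open>(x, y) \<in> r\<close> r unfolding \<Phi>_def by force
    ultimately show ?thesis using r by metis
  next
    case False
    let ?A = "fst ` {p \<in> r. snd p < y}" and ?B = "fst ` {p \<in> r. y < snd p}"
    have "\<exists>q\<in>M. (\<forall>a\<in>?A. R a q) \<and> (\<forall>b\<in>?B. R q b)"
    proof (rule dense_order_separate[OF M])
      fix a b assume "a \<in> ?A" "b \<in> ?B"
      then obtain p q where "p \<in> r" "q \<in> r" "snd p < y" "y < snd q" "a = fst p" "b = fst q" by auto
      then show "R a b" using r unfolding \<Phi>_def by (meson less_trans)
    qed (use r in \<open>auto simp: \<Phi>_def\<close>)
    then obtain x where x: "x \<in> M" "\<And>p. p \<in> r \<Longrightarrow> snd p < y \<Longrightarrow> R (fst p) x"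
       "\<And>p. p \<in> r \<Longrightarrow> y < snd p \<Longrightarrow> R x (fst p)" by blast
    have c: "R (fst p) x \<longleftrightarrow> snd p < y" "R x (fst p) \<longleftrightarrow> y < snd p" "snd p \<noteq> y" "fst p \<noteq> x" if "p \<in> r" for p
    proof -
      have m: "fst p \<in> M" "snd p \<noteq> y" using that False r unfolding \<Phi>_def by auto
      then show "R (fst p) x \<longleftrightarrow> snd p < y" "R x (fst p) \<longleftrightarrow> y < snd p" "snd p \<noteq> y" "fst p \<noteq> x"
        using x(2,3)[OF that] asy x(1) irr by (metis linorder_neqE)+
    qed
    have "finite (insert (x, y) r)" "fst ` insert (x, y) r \<subseteq> M" using r x(1) by (simp_all add: \<Phi>_def)
    moreover have "\<forall>p\<in>insert (x, y) r. \<forall>q\<in>insert (x, y) r.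
        (fst p = fst q \<longleftrightarrow> snd p = snd q) \<and> (R (fst p) (fst q) \<longleftrightarrow> snd p < snd q)"
      unfolding ball_insert_pairs using r irr[OF x(1)] c c(3,4)[symmetric] by (simp add: \<Phi>_def)
    ultimately have "\<Phi> (insert (x, y) r)" unfolding \<Phi>_def by blast
    then show ?thesis using x by blast
  qed
  have "\<exists>r. {} \<subseteq> r \<and> (\<forall>x\<in>M. \<exists>y\<in>UNIV. (x, y) \<in> r) \<and> (\<forall>y\<in>UNIV. \<exists>x\<in>M. (x, y) \<in> r) \<and>
             (\<forall>p\<in>r. \<forall>q\<in>r. \<exists>s. \<Phi> s \<and> p \<in> s \<and> q \<in> s)"
    by (rule back_and_forth) (use assms forth bwd in \<open>auto simp: \<Phi>_def\<close>)
  then obtain r where r0: "(\<forall>x\<in>M. \<exists>y\<in>UNIV. (x, y) \<in> r) \<and> (\<forall>y\<in>UNIV. \<exists>x\<in>M. (x, y) \<in> r) \<and>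
             (\<forall>p\<in>r. \<forall>q\<in>r. \<exists>s. \<Phi> s \<and> p \<in> s \<and> q \<in> s)" by (elim exE conjE) blast
  then have r: "\<And>x. x \<in> M \<Longrightarrow> \<exists>y. (x, y) \<in> r" "\<And>y. \<exists>x\<in>M. (x, y) \<in> r"
    "\<And>p q. p \<in> r \<Longrightarrow> q \<in> r \<Longrightarrow> \<exists>s. \<Phi> s \<and> p \<in> s \<and> q \<in> s" by simp_all
  have rr: "(x = x' \<longleftrightarrow> y = y') \<and> (R x x' \<longleftrightarrow> y < y')" if p: "(x, y) \<in> r" and q: "(x', y') \<in> r" for x y x' y'
  proof -
    obtain s where s: "\<Phi> s" "(x, y) \<in> s" "(x', y') \<in> s" using r(3)[OF p q] by blast
    have "\<forall>p\<in>s. \<forall>q\<in>s. (fst p = fst q \<longleftrightarrow> snd p = snd q) \<and> (R (fst p) (fst q) \<longleftrightarrow> snd p < snd q)"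
      using s(1) by (simp add: \<Phi>_def)
    from this[rule_format, OF s(2,3)] show ?thesis by simp
  qed
  define f where "f x = (SOME y. (x, y) \<in> r)" for x
  have f: "(x, f x) \<in> r" if "x \<in> M" for x using r(1)[OF that] unfolding f_def by (rule someI_ex)
  have "inj_on f M" by (rule inj_onI) (use f rr in metis)
  moreover have "y \<in> f ` M" for y
  proof -
    obtain x where x: "x \<in> M" "(x, y) \<in> r" using r(2) by blast
    then have "y = f x" using rr[OF x(2) f[OF x(1)]] by simp
    then show ?thesis using x by blast
  qed
  ultimately have "bij_betw f M UNIV" unfolding bij_betw_def by blast
  moreover have "R x y \<longleftrightarrow> f x < f y" if "x \<in> M" "y \<in> M" for x y
    using rr[OF f[OF that(1)] f[OF that(2)]] by simp
  ultimately show ?thesis by blast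
qed

section \<open>Homomorphism homogeneous tournaments\<close>

text \<open>A partial map is a set of pairs, so that a one-point extension is an
  \<open>insert\<close> and a restriction is a subset. Non-adjacent points may be
  identified.\<close>

definition phom :: "('a \<Rightarrow> 'a \<Rightarrow> bool) \<Rightarrow> 'a set \<Rightarrow> ('a \<times> 'a) set \<Rightarrow> bool" where
  "phom E V r \<longleftrightarrow> finite r \<and> r \<subseteq> V \<times> V \<and>
     (\<forall>p\<in>r. \<forall>q\<in>r. (fst p = fst q \<longrightarrow> snd p = snd q) \<and> (E (fst p) (fst q) \<longrightarrow> E (snd p) (snd q)))"

definition hh :: "('a \<Rightarrow> 'a \<Rightarrow> bool) \<Rightarrow> 'a set \<Rightarrow> bool" where
  "hh E V \<longleftrightarrow> (\<forall>r v. phom E V r \<longrightarrow> v \<in> V \<longrightarrow> (\<exists>w\<in>V. phom E V (insert (v, w) r)))"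

definition asy :: "('a \<Rightarrow> 'a \<Rightarrow> bool) \<Rightarrow> bool" where
  "asy E \<longleftrightarrow> (\<forall>x y. E x y \<longrightarrow> \<not> E y x)"

text \<open>Asymmetry is demanded on the whole type and totality only on \<open>V\<close>, so every
  subset of \<open>V\<close> inherits the property with the same \<open>E\<close>.\<close>

definition tour :: "('a \<Rightarrow> 'a \<Rightarrow> bool) \<Rightarrow> 'a set \<Rightarrow> bool" where
  "tour E V \<longleftrightarrow> asy E \<and> (\<forall>x\<in>V. \<forall>y\<in>V. x \<noteq> y \<longrightarrow> E x y \<or> E y x)"

definition htour :: "('a \<Rightarrow> 'a \<Rightarrow> bool) \<Rightarrow> 'a set \<Rightarrow> bool" where
  "htour E V \<longleftrightarrow> tour E V \<and> hh E V"

definition c3 :: "('a \<Rightarrow> 'a \<Rightarrow> bool) \<Rightarrow> 'a \<Rightarrow> 'a \<Rightarrow> 'a \<Rightarrow> bool" where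
  "c3 E a b c \<longleftrightarrow> E a b \<and> E b c \<and> E c a"

text \<open>Among the homogeneous tournaments with a 3-cycle this separates T^infinity from C_3 and
  S(2), where no vertex dominates a 3-cycle.\<close>

definition good :: "('a \<Rightarrow> 'a \<Rightarrow> bool) \<Rightarrow> 'a set \<Rightarrow> bool" where
  "good E V \<longleftrightarrow> htour E V \<and>
     (\<exists>i\<in>V. \<exists>a\<in>V. \<exists>b\<in>V. \<exists>c\<in>V. E i a \<and> E i b \<and> E i c \<and> c3 E a b c)"

definition sector :: "('a \<Rightarrow> 'a \<Rightarrow> bool) \<Rightarrow> 'a set \<Rightarrow> 'a set \<Rightarrow> 'a set \<Rightarrow> 'a set" where
  "sector E V s t = {x \<in> V. (\<forall>f\<in>s. E x f) \<and> (\<forall>f\<in>t. E f x)}"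

abbreviation (input) rv :: "('a \<Rightarrow> 'a \<Rightarrow> bool) \<Rightarrow> 'a \<Rightarrow> 'a \<Rightarrow> bool" where
  "rv E \<equiv> (\<lambda>x y. E y x)"

lemma asyD: "asy E \<Longrightarrow> E x y \<Longrightarrow> \<not> E y x"
  unfolding asy_def by blast

lemma asy_irrefl: "asy E \<Longrightarrow> \<not> E x x"
  unfolding asy_def by blast

lemma tour_asy: "tour E V \<Longrightarrow> asy E" and htour_asy: "htour E V \<Longrightarrow> asy E"
  unfolding tour_def htour_def by blast+

lemma tourD: "tour E V \<Longrightarrow> x \<in> V \<Longrightarrow> y \<in> V \<Longrightarrow> x \<noteq> y \<Longrightarrow> E x y \<or> E y x"
  unfolding tour_def by blast

lemma htourD: "htour E V \<Longrightarrow> x \<in> V \<Longrightarrow> y \<in> V \<Longrightarrow> x \<noteq> y \<Longrightarrow> E x y \<or> E y x"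
  unfolding htour_def tour_def by blast

lemma phomD:
  assumes "phom E V r" "(x, x') \<in> r" "(y, y') \<in> r"
  shows "x = y \<Longrightarrow> x' = y'" "E x y \<Longrightarrow> E x' y'" "x \<in> V" "x' \<in> V"
  using assms unfolding phom_def by fastforce+

lemma phom_subset: "phom E V r \<Longrightarrow> s \<subseteq> r \<Longrightarrow> phom E V s"
  unfolding phom_def by (meson finite_subset subset_eq)

lemma phom_restrict: "phom E V r \<Longrightarrow> r \<subseteq> X \<times> X \<Longrightarrow> phom E X r"
  unfolding phom_def by (elim conjE, intro conjI)

lemma phomI:
  assumes "finite r" "\<And>x x'. (x, x') \<in> r \<Longrightarrow> x \<in> V \<and> x' \<in> V"
    "\<And>x x' y y'. (x, x') \<in> r \<Longrightarrow> (y, y') \<in> r \<Longrightarrow> x = y \<Longrightarrow> x' = y'"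
    "\<And>x x' y y'. (x, x') \<in> r \<Longrightarrow> (y, y') \<in> r \<Longrightarrow> E x y \<Longrightarrow> E x' y'"
  shows "phom E V r"
proof -
  have "\<forall>p\<in>r. \<forall>q\<in>r. (fst p = fst q \<longrightarrow> snd p = snd q) \<and> (E (fst p) (fst q) \<longrightarrow> E (snd p) (snd q))"
    using assms(3,4) by (metis prod.collapse)
  moreover have "r \<subseteq> V \<times> V" using assms(2) by auto
  ultimately show ?thesis using assms(1) unfolding phom_def by blast
qed

text \<open>Two distinct vertices of the domain carry an arc one way or the other. Its image is an
  arc, hence not a loop and not reversed.\<close>

lemma phom_iff:
  assumes "tour E V" "phom E V r" "(x, x') \<in> r" "(y, y') \<in> r"
  shows "E x y \<longleftrightarrow> E x' y'" "x = y \<longleftrightarrow> x' = y'"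
proof -
  note xy = phomD[OF assms(2-4)] and yx = phomD[OF assms(2,4,3)]
  have "E x y \<or> E y x \<or> x = y" using assms(1) xy(3) yx(3) unfolding tour_def by blast
  then show "E x y \<longleftrightarrow> E x' y'" "x = y \<longleftrightarrow> x' = y'"
    using xy(1,2) yx(2) asyD[OF tour_asy[OF assms(1)]] by metis+
qed

lemma hh_extend:
  assumes "hh E V" "phom E V r" "finite B" "B \<subseteq> V"
  shows "\<exists>r'. phom E V r' \<and> r \<subseteq> r' \<and> B \<subseteq> fst ` r'"
  using assms(3,4)
proof (induction B rule: finite_induct)
  case empty
  then show ?case using assms(2) by blast
next
  case (insert b B)
  then obtain r' where r': "phom E V r'" "r \<subseteq> r'" "B \<subseteq> fst ` r'" by blast
  then obtain w where "phom E V (insert (b, w) r')"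
    using assms(1) insert.prems unfolding hh_def by blast
  then show ?case using r' by (intro exI[of _ "insert (b, w) r'"]) auto
qed

lemma hh_fun:
  assumes "hh E V" "phom E V r" "finite B" "B \<subseteq> V"
  shows "\<exists>g. (\<forall>(x, x')\<in>r. g x = x') \<and> phom E V ((\<lambda>x. (x, g x)) ` (fst ` r \<union> B))"
proof -
  obtain r' where r': "phom E V r'" "r \<subseteq> r'" "B \<subseteq> fst ` r'" using hh_extend[OF assms] by blast
  define g where "g x = (SOME w. (x, w) \<in> r')" for x
  have g: "(x, g x) \<in> r'" if "x \<in> fst ` r'" for x
  proof -
    have "\<exists>w. (x, w) \<in> r'" using that by force
    then show ?thesis unfolding g_def by (rule someI_ex)
  qed
  have "g x = x'" if "(x, x') \<in> r" for x x'
  proof -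
    have "(x, x') \<in> r'" using that r'(2) by blast
    moreover from this have "(x, g x) \<in> r'" using g by force
    ultimately show ?thesis using phomD(1)[OF r'(1)] by metis
  qed
  moreover have "(\<lambda>x. (x, g x)) ` (fst ` r \<union> B) \<subseteq> r'" using g r'(2,3) by blast
  ultimately show ?thesis using phom_subset[OF r'(1)] by blast
qed

text \<open>\<open>hh\<close> adds the points of \<open>B\<close> one by one, and
  \<open>phom_iff\<close> makes the result an embedding. Most later copying arguments use
  homogeneity in this form.\<close>

lemma htour_move:
  assumes "htour E V" "phom E V r" "finite B" "B \<subseteq> V"
  shows "\<exists>g. (\<forall>(x, x')\<in>r. g x = x') \<and> (\<forall>x\<in>fst ` r \<union> B. g x \<in> V) \<and>
    (\<forall>x\<in>fst ` r \<union> B. \<forall>y\<in>fst ` r \<union> B. (E x y \<longleftrightarrow> E (g x) (g y)) \<and> (g x = g y \<longleftrightarrow> x = y))"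
proof -
  have t: "tour E V" and h: "hh E V" using assms(1) unfolding htour_def by blast+
  obtain g where g: "\<forall>(x, x')\<in>r. g x = x'" "phom E V ((\<lambda>x. (x, g x)) ` (fst ` r \<union> B))"
    using hh_fun[OF h assms(2-4)] by blast
  have m: "(x, g x) \<in> (\<lambda>x. (x, g x)) ` (fst ` r \<union> B)" if "x \<in> fst ` r \<union> B" for x using that by blast
  show ?thesis
    using g(1) phom_iff[OF t g(2) m m] phomD(4)[OF g(2) m m] by (intro exI[of _ g]) auto
qed

lemma htour_hh: "htour E V \<Longrightarrow> phom E V r \<Longrightarrow> v \<in> V \<Longrightarrow> \<exists>w\<in>V. phom E V (insert (v, w) r)"
  unfolding htour_def hh_def by blast

section \<open>Copying explicit configurations\<close>

primrec emb :: "('a \<Rightarrow> 'a \<Rightarrow> bool) \<Rightarrow> 'a list \<Rightarrow> 'b list \<Rightarrow> ('b \<Rightarrow> 'b \<Rightarrow> bool) \<Rightarrow> bool" where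
  "emb E [] ys R \<longleftrightarrow> ys = []"
| "emb E (x # xs) ys R \<longleftrightarrow> ys \<noteq> [] \<and>
     list_all2 (\<lambda>u v. (E x u \<longleftrightarrow> R (hd ys) v) \<and> (E u x \<longleftrightarrow> R v (hd ys)) \<and> (x = u \<longleftrightarrow> hd ys = v)) xs (tl ys) \<and>
     emb E xs (tl ys) R"

text \<open>\<open>emb\<close> and \<open>embw\<close> recurse on lists, so that for explicit lists
  the simplifier turns them into finitely many literals. \<open>embw\<close> is the version to be
  proved: in a tournament forward arcs and distinctness suffice, see \<open>embw_pairs\<close>.
  \<open>emb\<close> is the version to be used, with arcs in both directions.\<close>

primrec embw :: "('a \<Rightarrow> 'a \<Rightarrow> bool) \<Rightarrow> 'a list \<Rightarrow> 'a list \<Rightarrow> bool" where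
  "embw E [] ys \<longleftrightarrow> ys = []"
| "embw E (x # xs) ys \<longleftrightarrow> ys \<noteq> [] \<and>
     list_all2 (\<lambda>u v. (E x u \<longleftrightarrow> E (hd ys) v) \<and> x \<noteq> u \<and> hd ys \<noteq> v) xs (tl ys) \<and>
     embw E xs (tl ys)"

lemma emb_map:
  assumes "\<forall>x\<in>set xs. \<forall>y\<in>set xs. (E x y \<longleftrightarrow> R (g x) (g y)) \<and> (g x = g y \<longleftrightarrow> x = y)"
  shows "emb E xs (map g xs) R"
  using assms by (induction xs) (auto simp: list_all2_conv_all_nth)

lemma embw_pairs:
  assumes "embw E xs ys" and T: "tour E V" and "set xs \<subseteq> V" "set ys \<subseteq> V"
  shows "length xs = length ys \<and> (\<forall>p\<in>set (zip xs ys). \<forall>q\<in>set (zip xs ys).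
     (fst p = fst q \<longleftrightarrow> snd p = snd q) \<and> (E (fst p) (fst q) \<longleftrightarrow> E (snd p) (snd q)))"
  using assms(1,3,4)
proof (induction xs arbitrary: ys)
  case (Cons x xs)
  then obtain y ys' where ys: "ys = y # ys'" by (cases ys) auto
  have IH: "length xs = length ys'" "\<forall>p\<in>set (zip xs ys'). \<forall>q\<in>set (zip xs ys').
     (fst p = fst q \<longleftrightarrow> snd p = snd q) \<and> (E (fst p) (fst q) \<longleftrightarrow> E (snd p) (snd q))"
    using Cons.IH[of ys'] Cons.prems ys by auto
  have new: "E x u \<longleftrightarrow> E y v" "x \<noteq> u" "y \<noteq> v" "E u x \<longleftrightarrow> E v y" if uv: "(u, v) \<in> set (zip xs ys')" for u v
  proof -
    show 1: "E x u \<longleftrightarrow> E y v" "x \<noteq> u" "y \<noteq> v"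
      using Cons.prems(1) uv unfolding ys by (auto simp: list_all2_iff)
    have "u \<in> V" "v \<in> V" "x \<in> V" "y \<in> V" using Cons.prems uv ys by (auto dest: set_zip_leftD set_zip_rightD)
    then show "E u x \<longleftrightarrow> E v y" using 1 tourD[OF T] asyD[OF tour_asy[OF T]] by metis
  qed
  have irr: "\<not> E x x" "\<not> E y y" using asy_irrefl[OF tour_asy[OF T]] by blast+
  have "(fst p = fst q \<longleftrightarrow> snd p = snd q) \<and> (E (fst p) (fst q) \<longleftrightarrow> E (snd p) (snd q))"
    if "p \<in> set (zip (x # xs) ys)" "q \<in> set (zip (x # xs) ys)" for p q
  proof -
    consider "p = (x, y)" "q = (x, y)" | "p = (x, y)" "q \<in> set (zip xs ys')" | "p \<in> set (zip xs ys')" "q = (x, y)"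
      | "p \<in> set (zip xs ys')" "q \<in> set (zip xs ys')" using \<open>p \<in> _\<close> \<open>q \<in> _\<close> ys by auto
    then show ?thesis
    proof cases
      case 2 then show ?thesis using new[of "fst q" "snd q"] by auto
    next
      case 3 then show ?thesis using new[of "fst p" "snd p"] by auto
    next
      case 4 then show ?thesis using IH(2) by blast
    qed (use irr in auto)
  qed
  then show ?case using IH(1) ys by simp
qed simp

lemma move_list:
  assumes T: "htour E V" and e: "embw E xs ys" and V: "set xs \<subseteq> V" "set ys \<subseteq> V" "set vs \<subseteq> V"
  shows "\<exists>ws. length ws = length vs \<and> set ws \<subseteq> V \<and> emb E (xs @ vs) (ys @ ws) E"
proof -
  have t: "tour E V" using T unfolding htour_def by blast
  note P = embw_pairs[OF e t V(1,2)]
  have l: "length xs = length ys" using P by blast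
  have "phom E V (set (zip xs ys))"
  proof -
    have "set (zip xs ys) \<subseteq> V \<times> V" using V by (auto dest: set_zip_leftD set_zip_rightD)
    then show ?thesis unfolding phom_def using P by blast
  qed
  from htour_move[OF T this finite_set V(3)] obtain g where
    g: "\<forall>(x, x')\<in>set (zip xs ys). g x = x'" "\<forall>x\<in>fst ` set (zip xs ys) \<union> set vs. g x \<in> V"
     "\<forall>x\<in>fst ` set (zip xs ys) \<union> set vs. \<forall>y\<in>fst ` set (zip xs ys) \<union> set vs. (E x y \<longleftrightarrow> E (g x) (g y)) \<and> (g x = g y \<longleftrightarrow> x = y)"
    by (elim exE conjE)
  have f: "fst ` set (zip xs ys) = set xs" using l by (metis list.set_map map_fst_zip)
  have "g (xs ! i) = ys ! i" if "i < length xs" for i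
  proof -
    have "(xs ! i, ys ! i) \<in> set (zip xs ys)" using that l by (auto simp: set_zip)
    from bspec[OF g(1) this] show ?thesis by simp
  qed
  then have "map g xs = ys" using l by (intro nth_equalityI) simp_all
  moreover have "emb E (xs @ vs) (map g (xs @ vs)) E" by (rule emb_map) (use g(3) f in simp)
  ultimately show ?thesis using g(2) f by (intro exI[of _ "map g vs"]) auto
qed

lemma move_list1:
  assumes "htour E V" "embw E xs ys" "set xs \<subseteq> V" "set ys \<subseteq> V" "v \<in> V"
  shows "\<exists>w\<in>V. emb E (xs @ [v]) (ys @ [w]) E"
proof -
  obtain ws where ws: "length ws = 1" "set ws \<subseteq> V" "emb E (xs @ [v]) (ys @ ws) E"
    using move_list[OF assms(1-4), of "[v]"] assms(5) by (auto simp del: emb.simps)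
  moreover from ws(1) obtain w where "ws = [w]" by (auto simp: length_Suc_conv)
  ultimately show ?thesis by (intro bexI[of _ w]) simp_all
qed

lemma move_list2:
  assumes "htour E V" "embw E xs ys" "set xs \<subseteq> V" "set ys \<subseteq> V" "v \<in> V" "v' \<in> V"
  shows "\<exists>w\<in>V. \<exists>w'\<in>V. emb E (xs @ [v, v']) (ys @ [w, w']) E"
proof -
  obtain ws where ws: "length ws = Suc (Suc 0)" "set ws \<subseteq> V" "emb E (xs @ [v, v']) (ys @ ws) E"
    using move_list[OF assms(1-4), of "[v, v']"] assms(5,6) by (auto simp del: emb.simps)
  moreover from ws(1) obtain w w' where "ws = [w, w']" by (auto simp: length_Suc_conv)
  ultimately show ?thesis by (intro bexI[of _ w] bexI[of _ w']) simp_all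
qed

section \<open>Reversal of arcs, and sectors\<close>

lemma tour_rv: "tour E V \<Longrightarrow> tour (rv E) V"
  unfolding tour_def asy_def by blast

lemma phom_rv: "phom (rv E) V r \<longleftrightarrow> phom E V r"
  unfolding phom_def by blast

lemma htour_rv: "htour E V \<Longrightarrow> htour (rv E) V"
  by (simp only: htour_def hh_def phom_rv[of E] tour_rv simp_thms) (elim conjE, assumption)

text \<open>A partial map of the sector stays a homomorphism after adding the identity on
  \<open>s\<close> and \<open>t\<close>, because both ends of each pair have the same arcs to these
  vertices. The image of a new point then keeps its arcs to \<open>s\<close> and \<open>t\<close>,
  so it lies in the sector.\<close>

lemma htour_sector:
  assumes T: "htour E V" and st: "finite s" "finite t" "s \<subseteq> V" "t \<subseteq> V"
  shows "htour E (sector E V s t)"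
  unfolding htour_def
proof
  note A = asyD[OF htour_asy[OF T]] asy_irrefl[OF htour_asy[OF T]]
  let ?X = "sector E V s t"
  show "tour E ?X" using T unfolding htour_def tour_def sector_def by blast
  show "hh E ?X" unfolding hh_def
  proof (intro allI impI)
    fix r v assume r: "phom E ?X r" and v: "v \<in> ?X"
    have X: "\<And>x f. x \<in> ?X \<Longrightarrow> f \<in> s \<Longrightarrow> E x f" "\<And>x f. x \<in> ?X \<Longrightarrow> f \<in> t \<Longrightarrow> E f x" "?X \<subseteq> V"
      unfolding sector_def by blast+
    let ?r = "r \<union> (\<lambda>x. (x, x)) ` (s \<union> t)"
    have rX: "x \<in> ?X \<and> x' \<in> ?X" if "(x, x') \<in> r" for x x' using r that unfolding phom_def by blast
    have "phom E V ?r"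
    proof (rule phomI)
      show "finite ?r" using r st unfolding phom_def by blast
      fix x x' assume x: "(x, x') \<in> ?r"
      show "x \<in> V \<and> x' \<in> V" using x rX X st by blast
      fix y y' assume y: "(y, y') \<in> ?r"
      have sX: "f \<notin> ?X" if "f \<in> s \<union> t" for f using that X A by blast
      from x y consider "(x, x') \<in> r" "(y, y') \<in> r" | "(x, x') \<in> r" "y = y'" "y \<in> s \<union> t"
        | "x = x'" "x \<in> s \<union> t" "(y, y') \<in> r" | "x = x'" "y = y'" by blast
      then show "x' = y'" if "x = y"
        by cases (use that phomD(1)[OF r] rX sX in blast)+
      from \<open>(x, x') \<in> ?r\<close> \<open>(y, y') \<in> ?r\<close>
      consider "(x, x') \<in> r" "(y, y') \<in> r" | "(x, x') \<in> r" "y = y'" "y \<in> s \<union> t"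
        | "x = x'" "x \<in> s \<union> t" "(y, y') \<in> r" | "x = x'" "y = y'" by blast
      then show "E x' y'" if "E x y"
        by cases (use that phomD(2)[OF r] rX X A in blast)+
    qed
    then obtain w where w: "w \<in> V" "phom E V (insert (v, w) ?r)" using htour_hh[OF T] v X by blast
    have "E w f" if "f \<in> s" for f
      using phomD(2)[OF w(2), of v w f f] that X(1)[OF v that] by auto
    moreover have "E f w" if "f \<in> t" for f
      using phomD(2)[OF w(2), of f f v w] that X(2)[OF v that] by auto
    ultimately have wX: "w \<in> ?X" using w unfolding sector_def by blast
    have "phom E V (insert (v, w) r)" by (rule phom_subset[OF w(2)]) blast
    moreover have "insert (v, w) r \<subseteq> ?X \<times> ?X" using wX v rX by auto
    ultimately have "phom E ?X (insert (v, w) r)" by (rule phom_restrict)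
    then show "\<exists>w\<in>?X. phom E ?X (insert (v, w) r)" using wX by blast
  qed
qed

lemma sector_rv: "sector (rv E) V s t = sector E V t s"
  unfolding sector_def by blast

lemma sector_sector: "sector E (sector E V s t) s' t' = sector E V (s \<union> s') (t \<union> t')"
  unfolding sector_def by blast

section \<open>3-cycles and the vertices above and below them\<close>

lemma arc_c3:
  assumes T: "htour E V" and "a \<in> V" "b \<in> V" "c \<in> V" "c3 E a b c" "x \<in> V" "y \<in> V" "E x y"
  shows "\<exists>z\<in>V. E y z \<and> E z x"
proof -
  have "E a b" "E b c" "E c a" using assms unfolding c3_def by blast+
  moreover have "a \<noteq> b" "x \<noteq> y" using calculation assms(8) asy_irrefl[OF htour_asy[OF T]] by blast+
  moreover have "embw E [a, b] [x, y]" using calculation assms(8) by simp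
  ultimately show ?thesis using move_list1[OF T _ _ _ assms(4), of "[a, b]" "[x, y]"] assms(2,3,6,7) by auto
qed

text \<open>Suppose the cycle dominates \<open>v\<close>. By \<open>arc_c3\<close> there is
  \<open>w\<close> with \<open>v -> w -> a\<close>. If \<open>c -> w\<close>, then \<open>c\<close>
  dominates the 3-cycle \<open>a v w\<close>; hence \<open>w -> c\<close>. In the same way
  \<open>w -> b\<close>, so \<open>w\<close> itself dominates the cycle.\<close>

lemma not_dominating_c3:
  assumes T: "htour E V" and V: "a \<in> V" "b \<in> V" "c \<in> V" and C: "c3 E a b c"
    and no: "\<And>i a b c. i \<in> V \<Longrightarrow> a \<in> V \<Longrightarrow> b \<in> V \<Longrightarrow> c \<in> V \<Longrightarrow> c3 E a b c \<Longrightarrow> E i a \<Longrightarrow> E i b \<Longrightarrow> \<not> E i c"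
    and v: "v \<in> V" "E a v" "E b v" "E c v"
  shows False
proof -
  note A = asyD[OF htour_asy[OF T]] asy_irrefl[OF htour_asy[OF T]]
  have key: "\<not> E w x" if xyz: "x \<in> V" "y \<in> V" "z \<in> V" "c3 E x y z" and v: "v \<in> V" "E x v" "E y v" "E z v"
    and w: "w \<in> V" "E v w" for x y z v w
  proof
    assume wx: "E w x"
    have e: "E x y" "E y z" "E z x" using xyz unfolding c3_def by blast+
    have "\<not> E z w" using no[of z x v w] xyz v w wx e unfolding c3_def by blast
    moreover have "w \<noteq> z" using v w A by blast
    ultimately have wz: "E w z" using htourD[OF T] xyz w by blast
    have "\<not> E y w" using no[of y z v w] xyz v w wz e unfolding c3_def by blast
    moreover have "w \<noteq> y" using v w A by blast
    ultimately have wy: "E w y" using htourD[OF T] xyz w by blast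
    show False using no[of w x y z] xyz w wx wy wz by blast
  qed
  obtain w where w: "w \<in> V" "E v w" "E w a" using arc_c3[OF T V C V(1) v(1,2)] by blast
  show False using key[OF V C v w(1,2)] w(3) by blast
qed

lemma good_htour: "good E V \<Longrightarrow> htour E V"
  unfolding good_def by blast

lemma goodE:
  assumes "good E V"
  obtains i a b c where "i \<in> V" "a \<in> V" "b \<in> V" "c \<in> V" "c3 E a b c" "E i a" "E i b" "E i c"
  using assms unfolding good_def by blast

lemma goodI:
  assumes "htour E V" "i \<in> V" "a \<in> V" "b \<in> V" "c \<in> V" "c3 E a b c" "E i a" "E i b" "E i c"
  shows "good E V"
  using assms unfolding good_def by blast

lemma c3_rv: "c3 (rv E) a b c \<longleftrightarrow> c3 E c b a"
  unfolding c3_def by blast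

text \<open>\<open>not_dominating_c3\<close> for the reversed arcs: if no vertex were dominated by a
  3-cycle, none could dominate one.\<close>

lemma good_rv:
  assumes "good E V"
  shows "good (rv E) V"
proof (rule ccontr)
  assume n: "\<not> good (rv E) V"
  obtain i a b c where g: "i \<in> V" "a \<in> V" "b \<in> V" "c \<in> V" "c3 E a b c" "E i a" "E i b" "E i c"
    using assms by (rule goodE)
  have T: "htour (rv E) V" using assms htour_rv good_htour by blast
  have no: "\<not> E c' i'" if "i' \<in> V" "a' \<in> V" "b' \<in> V" "c' \<in> V" "c3 E c' b' a'" "E a' i'" "E b' i'" for i' a' b' c'
    using n that goodI[OF T, of i' a' b' c'] c3_rv[of E a' b' c'] by metis
  have "c3 (rv E) c b a" using g(5) c3_rv[of E c b a] by simp
  from not_dominating_c3[OF T g(4,3,2) this _ g(1,8,7,6)] show False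
    using no c3_rv[of E] by metis
qed

lemma goodE':
  assumes "good E V"
  obtains i a b c where "i \<in> V" "a \<in> V" "b \<in> V" "c \<in> V" "c3 E a b c" "E a i" "E b i" "E c i"
proof -
  obtain i a b c where "i \<in> V" "a \<in> V" "b \<in> V" "c \<in> V" "c3 (rv E) a b c" "rv E i a" "rv E i b" "rv E i c"
    using good_rv[OF assms] by (rule goodE)
  then show thesis using that[of i c b a] c3_rv[of E a b c] by metis
qed

text \<open>If the third vertex of a 3-cycle over one arc were unique, it would be unique over every
  arc, all arcs being conjugate. Take \<open>d -> f -> a\<close>: the arc \<open>b -> f\<close>
  gives \<open>a -> b\<close> the third vertices \<open>c\<close> and \<open>f\<close>, and
  \<open>f -> b\<close> gives \<open>d -> f\<close> the third vertices \<open>a\<close> and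
  \<open>b\<close>.\<close>

lemma two_c3_over_arc:
  assumes T: "htour E V" and V: "a \<in> V" "b \<in> V" "c \<in> V" "d \<in> V" and C: "c3 E a b c"
    and d: "E a d" "E b d" "E c d" and xy: "x \<in> V" "y \<in> V" "E x y"
  shows "\<exists>z1\<in>V. \<exists>z2\<in>V. E z1 z2 \<and> E y z1 \<and> E z1 x \<and> E y z2 \<and> E z2 x"
proof (rule ccontr)
  assume n0: "\<not> ?thesis"
  note A = asyD[OF htour_asy[OF T]] asy_irrefl[OF htour_asy[OF T]]
  have n: "z1 = z2" if "z1 \<in> V" "z2 \<in> V" "E y z1" "E z1 x" "E y z2" "E z2 x" for z1 z2
    using n0 that htourD[OF T] by blast
  have u: "z1 = z2" if uv: "u \<in> V" "v \<in> V" "E u v" and z: "z1 \<in> V" "z2 \<in> V" "E v z1" "E z1 u" "E v z2" "E z2 u" for u v z1 z2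
  proof -
    have "u \<noteq> v" "x \<noteq> y" using A uv xy by blast+
    then have "embw E [u, v] [x, y]" using uv xy by simp
    from move_list2[OF T this _ _ z(1,2)] have "\<exists>w1\<in>V. \<exists>w2\<in>V. emb E [u, v, z1, z2] [x, y, w1, w2] E"
      using uv xy by (simp del: emb.simps)
    then obtain w1 w2 where w: "w1 \<in> V" "w2 \<in> V" "emb E [u, v, z1, z2] [x, y, w1, w2] E" by blast
    then have "w1 = w2" using z by (intro n) auto
    then show ?thesis using w(3) by simp
  qed
  have e: "E a b" "E b c" "E c a" using C unfolding c3_def by blast+
  obtain f where f: "f \<in> V" "E d f" "E f a" using arc_c3[OF T V(1-3) C V(1) V(4) d(1)] by blast
  have "\<not> E b f" using u[of a b c f] V f e d A by blast
  then have fb: "E f b" using htourD[OF T, of f b] f V A d by blast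
  show False using u[of d f a b] V f e d fb A by blast
qed

text \<open>Otherwise each 3-cycle has exactly one dominating vertex. The proof splits on whether
  two 3-cycles over a common arc can have different ones. If not, uniqueness passes from cycles down
  to arcs; if so, the out-neighbourhood of such a vertex shrinks to a single cycle. Both are too
  rigid.\<close>

lemma iic3_exists:
  assumes G: "good E V"
  shows "\<exists>x\<in>V. \<exists>y\<in>V. \<exists>a\<in>V. \<exists>b\<in>V. \<exists>c\<in>V. E x y \<and> c3 E a b c \<and>
     E x a \<and> E x b \<and> E x c \<and> E y a \<and> E y b \<and> E y c"
proof (rule ccontr)
  assume n: "\<not> ?thesis"
  have T: "htour E V" using G by (rule good_htour)
  note A = asyD[OF htour_asy[OF T]] and I = asy_irrefl[OF htour_asy[OF T]] and tot = htourD[OF T]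
  have uniq: "x = y" if "x \<in> V" "y \<in> V" "a \<in> V" "b \<in> V" "c \<in> V" "c3 E a b c"
    "E x a" "E x b" "E x c" "E y a" "E y b" "E y c" for x y a b c
    using n that tot by blast
  obtain i0 a0 b0 c0 where z: "i0 \<in> V" "a0 \<in> V" "b0 \<in> V" "c0 \<in> V" "c3 E a0 b0 c0" "E i0 a0" "E i0 b0" "E i0 c0"
    using G by (rule goodE)
  obtain d1 a1 b1 c1 where y: "d1 \<in> V" "a1 \<in> V" "b1 \<in> V" "c1 \<in> V" "c3 E a1 b1 c1" "E a1 d1" "E b1 d1" "E c1 d1"
    using G by (rule goodE')
  have c3d: "a \<noteq> b" "b \<noteq> c" "a \<noteq> c" "E a b" "E b c" "E c a" "\<not> E a c" "\<not> E b a" "\<not> E c b" if "c3 E a b c" for a b c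
    using that A I unfolding c3_def by blast+
  have dom: "\<exists>x\<in>V. E x a \<and> E x b \<and> E x c" if V: "a \<in> V" "b \<in> V" "c \<in> V" and c: "c3 E a b c" for a b c
  proof -
    have "embw E [a0, b0, c0] [a, b, c]" using c3d[OF c] c3d[OF z(5)] by simp
    from move_list1[OF T this _ _ z(1)] have "\<exists>w\<in>V. emb E [a0, b0, c0, i0] [a, b, c, w] E"
      using z V by (simp del: emb.simps)
    then obtain w where "w \<in> V" "emb E [a0, b0, c0, i0] [a, b, c, w] E" by blast
    moreover from this(2) have "E w a" "E w b" "E w c" using z by simp_all
    ultimately show ?thesis by blast
  qed
  have dmd: "\<exists>x\<in>V. E a x \<and> E b x \<and> E c x" if V: "a \<in> V" "b \<in> V" "c \<in> V" and c: "c3 E a b c" for a b c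
  proof -
    have "embw E [a1, b1, c1] [a, b, c]" using c3d[OF c] c3d[OF y(5)] by simp
    from move_list1[OF T this _ _ y(1)] have "\<exists>w\<in>V. emb E [a1, b1, c1, d1] [a, b, c, w] E"
      using y V by (simp del: emb.simps)
    then obtain w where "w \<in> V" "emb E [a1, b1, c1, d1] [a, b, c, w] E" by blast
    moreover from this(2) have "E a w" "E b w" "E c w" using y by simp_all
    ultimately show ?thesis by blast
  qed
  have two: "\<exists>z1\<in>V. \<exists>z2\<in>V. E z1 z2 \<and> E y z1 \<and> E z1 x \<and> E y z2 \<and> E z2 x" if "x \<in> V" "y \<in> V" "E x y" for x y
    by (rule two_c3_over_arc[OF T y(2-4,1,5-8) that])
  show False
  proof (cases "\<exists>a\<in>V. \<exists>b\<in>V. \<exists>e\<in>V. \<exists>f\<in>V. \<exists>x\<in>V. \<exists>y\<in>V. E a b \<and> E e f \<and> c3 E a b e \<and> c3 E a b f \<and> x \<noteq> y \<and>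
      E x a \<and> E x b \<and> E x e \<and> E y a \<and> E y b \<and> E y f")
    case False
    then have same: "x = y" if "a \<in> V" "b \<in> V" "e \<in> V" "f \<in> V" "x \<in> V" "y \<in> V" "E a b" "E e f" "c3 E a b e" "c3 E a b f"
      "E x a" "E x b" "E x e" "E y a" "E y b" "E y f" for a b e f x y
      using that by blast
    \<comment> \<open>Each vertex dominating both ends of \<open>a -> b\<close> dominates a cycle
      over this arc, and in the present case cycles over the same arc have the same dominating
      vertex. So no arc has two dominating vertices.\<close>
    have cn: "x = y" if V: "a \<in> V" "b \<in> V" "x \<in> V" "y \<in> V" and ab: "E a b" and x: "E x a" "E x b" and y: "E y a" "E y b" for a b x y
    proof -
      have ex: "\<exists>e\<in>V. c3 E a b e \<and> E x e" if x: "x \<in> V" "E x a" "E x b" for x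
      proof -
        have "embw E [i0, a0, b0] [x, a, b]" using x ab z c3d[OF z(5)] I by auto
        from move_list1[OF T this _ _ z(4)] have "\<exists>w\<in>V. emb E [i0, a0, b0, c0] [x, a, b, w] E"
          using z V x by (simp del: emb.simps)
        then obtain w where "w \<in> V" "emb E [i0, a0, b0, c0] [x, a, b, w] E" by blast
        moreover from this(2) have "E b w" "E w a" "E x w" using z c3d[OF z(5)] by simp_all
        ultimately show ?thesis using ab unfolding c3_def by blast
      qed
      obtain e where e: "e \<in> V" "c3 E a b e" "E x e" using ex V x by blast
      obtain f where f: "f \<in> V" "c3 E a b f" "E y f" using ex V y by blast
      consider "e = f" | "E e f" | "E f e" using tot e f by blast
      then show ?thesis
      proof cases
        case 1 then show ?thesis using uniq[of x y a b e] V x y e f by blast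
      next
        case 2 then show ?thesis using same[of a b e f x y] V ab x y e f by blast
      next
        case 3 then show ?thesis using same[of a b f e y x] V ab x y e f by blast
      qed
    qed
    have ab: "E a0 b0" using c3d[OF z(5)] by blast
    \<comment> \<open>Both \<open>e\<close> and \<open>f\<close> close a cycle over
      \<open>a0 -> b0\<close>. If \<open>d = d'\<close>, the arc \<open>a0 -> d\<close> is dominated
      by \<open>e\<close> and \<open>f\<close>; otherwise the arc between \<open>d\<close> and
      \<open>d'\<close> is dominated by \<open>a0\<close> and \<open>b0\<close>.\<close>
    obtain e f where ef: "e \<in> V" "f \<in> V" "E e f" "E b0 e" "E e a0" "E b0 f" "E f a0" using two[OF z(2,3) ab] by blast
    have C: "c3 E a0 b0 e" "c3 E a0 b0 f" using ef ab unfolding c3_def by blast+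
    obtain d where d: "d \<in> V" "E a0 d" "E b0 d" "E e d" using dmd[OF z(2,3) ef(1) C(1)] by blast
    obtain d' where d': "d' \<in> V" "E a0 d'" "E b0 d'" "E f d'" using dmd[OF z(2,3) ef(2) C(2)] by blast
    have ne: "a0 \<noteq> b0" "e \<noteq> f" using ab ef I by blast+
    consider "d = d'" | "E d d'" | "E d' d" using tot d d' by blast
    then show False
      by cases (use cn[of a0 d e f] cn[of d d' a0 b0] cn[of d' d a0 b0] ne z ef d d' in blast)+
  next
    case True
    then obtain a b e f x y where q: "a \<in> V" "b \<in> V" "e \<in> V" "f \<in> V" "x \<in> V" "y \<in> V" "E a b" "E e f"
      "c3 E a b e" "c3 E a b f" "x \<noteq> y" "E x a" "E x b" "E x e" "E y a" "E y b" "E y f" by blast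
    have q': "E b e" "E e a" "E b f" "E f a" using q(9,10) unfolding c3_def by blast+
    have qd: "a \<noteq> b" "a \<noteq> e" "a \<noteq> f" "b \<noteq> e" "b \<noteq> f" "e \<noteq> f" using q q' I by blast+
    \<comment> \<open>A vertex dominating two such cycles at once could be copied over
      \<open>a b e f\<close>, where it would equal both \<open>x\<close> and
      \<open>y\<close>.\<close>
    have diff: False if V: "a' \<in> V" "b' \<in> V" "e' \<in> V" "f' \<in> V" "x' \<in> V" and ef: "E e' f'" and C: "c3 E a' b' e'" "c3 E a' b' f'"
      and x: "E x' a'" "E x' b'" "E x' e'" "E x' f'" for a' b' e' f' x'
    proof -
      have "embw E [a', b', e', f'] [a, b, e, f]" using c3d[OF C(1)] c3d[OF C(2)] c3d[OF q(9)] c3d[OF q(10)] qd ef q I by auto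
      from move_list1[OF T this _ _ V(5)] have "\<exists>w\<in>V. emb E [a', b', e', f', x'] [a, b, e, f, w] E"
        using V q by (simp del: emb.simps)
      then obtain w where w0: "w \<in> V" "emb E [a', b', e', f', x'] [a, b, e, f, w] E" by blast
      then have w: "w \<in> V" "E w a" "E w b" "E w e" "E w f" using x by simp_all
      show False using uniq[of w x a b e] uniq[of w y a b f] w q by blast
    qed
    have uq: "e' = f'" if "a' \<in> V" "b' \<in> V" "e' \<in> V" "f' \<in> V" "x' \<in> V" "c3 E a' b' e'" "c3 E a' b' f'"
      "E x' a'" "E x' b'" "E x' e'" "E x' f'" for a' b' e' f' x'
      using diff[of a' b' e' f' x'] diff[of a' b' f' e' x'] tot[of e' f'] that by blast
    \<comment> \<open>A further out-neighbour \<open>d\<close> of \<open>x\<close> cannot replace a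
      vertex of the cycle, by \<open>uq\<close>, and cannot dominate it, by \<open>uniq\<close>; so
      the cycle dominates \<open>d\<close>. But in the out-neighbourhood of \<open>x\<close> no
      vertex dominates a 3-cycle, and \<open>not_dominating_c3\<close> applies there.\<close>
    have only: "d \<in> {a, b, c}" if V: "a \<in> V" "b \<in> V" "c \<in> V" "x \<in> V" "d \<in> V" and C: "c3 E a b c"
      and x: "E x a" "E x b" "E x c" "E x d" for a b c x d
    proof (rule ccontr)
      assume d: "d \<notin> {a, b, c}"
      note cc = c3d[OF C]
      have mix: False if V: "u \<in> V" "v \<in> V" "w \<in> V" "c3 E u v w" "E x u" "E x v" "E x w" and "d \<noteq> w" "E v d" "E d u" for u v w
      proof -
        have "c3 E u v d" using that unfolding c3_def by blast
        then show False using uq[of u v w d x] that \<open>x \<in> V\<close> \<open>d \<in> V\<close> x by blast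
      qed
      have C': "c3 E b c a" "c3 E c a b" using C unfolding c3_def by blast+
      have m: "\<not> (E b d \<and> E d a)" "\<not> (E c d \<and> E d b)" "\<not> (E a d \<and> E d c)"
        using mix[of a b c] mix[of b c a] mix[of c a b] C C' V x d by blast+
      have t: "E a d \<or> E d a" "E b d \<or> E d b" "E c d \<or> E d c" using tot V d by blast+
      have "\<not> (E d a \<and> E d b \<and> E d c)" using uniq[of d x a b c] V C x I by blast
      then have dd: "E a d" "E b d" "E c d" using m t by blast+
      have Tx: "htour E (sector E V {} {x})" by (rule htour_sector[OF T]) (use V in auto)
      have s: "u \<in> sector E V {} {x} \<longleftrightarrow> u \<in> V \<and> E x u" for u unfolding sector_def by blast
      show False
        by (rule not_dominating_c3[OF Tx, of a b c d]) (use uniq V C x dd s I in \<open>metis\<close>)+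
    qed
    have x': "\<And>d. d \<in> V \<Longrightarrow> E x d \<Longrightarrow> d \<in> {a, b, e}" using only[of a b e x] q by blast
    have y': "\<And>d. d \<in> V \<Longrightarrow> E y d \<Longrightarrow> d \<in> {a, b, f}" using only[of a b f y] q by blast
    show False using x'[of y] y'[of x] tot[of x y] q q' A by (metis insertE singletonD)
  qed
qed

text \<open>Copy the first of two vertices dominating a common cycle to \<open>x\<close>; the second
  then dominates the cycle inside the out-neighbourhood of \<open>x\<close>. This makes inductions
  over shrinking sectors possible.\<close>

lemma good_sector_one:
  assumes G: "good E V" and x: "x \<in> V"
  shows "good E (sector E V {} {x})"
proof -
  have T: "htour E V" using G by (rule good_htour)
  note A = asyD[OF htour_asy[OF T]] and I = asy_irrefl[OF htour_asy[OF T]] and tot = htourD[OF T]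
  obtain u y a b c where u: "u \<in> V" "y \<in> V" "a \<in> V" "b \<in> V" "c \<in> V" "E u y" "c3 E a b c"
     "E u a" "E u b" "E u c" "E y a" "E y b" "E y c" using iic3_exists[OF G] by blast
  have "embw E [u] [x]" by simp
  from move_list[OF T this, of "[y, a, b, c]"] obtain ws where
    ws: "length ws = Suc (Suc (Suc (Suc 0)))" "set ws \<subseteq> V" "emb E (u # [y, a, b, c]) (x # ws) E"
    using x u by (auto simp del: emb.simps)
  from ws(1) obtain y' a' b' c' where ws': "ws = [y', a', b', c']" by (auto simp: length_Suc_conv)
  have *: "E x y'" "E x a'" "E x b'" "E x c'" "E y' a'" "E y' b'" "E y' c'" "c3 E a' b' c'"
    using ws(3) u unfolding ws' c3_def by simp_all
  show ?thesis
  proof (rule goodI[of _ _ y' a' b' c'])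
    show "htour E (sector E V {} {x})" by (rule htour_sector[OF T]) (use x in auto)
  qed (use * ws(2) ws' in \<open>auto simp: sector_def\<close>)
qed

lemma good_sector_one':
  assumes G: "good E V" and x: "x \<in> V"
  shows "good E (sector E V {x} {})"
  using good_rv[OF good_sector_one[OF good_rv[OF G] x]] by (simp add: sector_rv[of E])

section \<open>Transitive chains and their Ramsey theorem\<close>

definition chain :: "('a \<Rightarrow> 'a \<Rightarrow> bool) \<Rightarrow> 'a set \<Rightarrow> nat \<Rightarrow> (nat \<Rightarrow> 'a) \<Rightarrow> bool" where
  "chain E V n c \<longleftrightarrow> (\<forall>i<n. c i \<in> V) \<and> (\<forall>i j. i < j \<longrightarrow> j < n \<longrightarrow> E (c i) (c j))"

lemma chainD: "chain E V n c \<Longrightarrow> i < n \<Longrightarrow> c i \<in> V" "chain E V n c \<Longrightarrow> i < j \<Longrightarrow> j < n \<Longrightarrow> E (c i) (c j)"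
  unfolding chain_def by blast+

lemma chain_iff:
  assumes "asy E" "chain E V n c" "i < n" "j < n"
  shows "E (c i) (c j) \<longleftrightarrow> i < j" "c i = c j \<longleftrightarrow> i = j"
proof -
  show 1: "E (c i) (c j) \<longleftrightarrow> i < j"
    using assms(2-4) chainD(2)[OF assms(2)] asyD[OF assms(1)] asy_irrefl[OF assms(1)] by (metis linorder_neqE_nat)
  show "c i = c j \<longleftrightarrow> i = j"
    using assms(2-4) chainD(2)[OF assms(2)] asy_irrefl[OF assms(1)] by (metis linorder_neqE_nat)
qed

lemma chain_subset: "chain E V n c \<Longrightarrow> V \<subseteq> W \<Longrightarrow> chain E W n c"
  unfolding chain_def by blast

lemma chain_compose: "chain E V n c \<Longrightarrow> (\<And>i. i < m \<Longrightarrow> f i < n) \<Longrightarrow> (\<And>i j. i < j \<Longrightarrow> j < m \<Longrightarrow> f i < f j) \<Longrightarrow> chain E V m (c \<circ> f)"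
  unfolding chain_def by auto

lemma chain_Cons:
  assumes "x \<in> V" "chain E (sector E V {} {x}) n c"
  shows "chain E V (Suc n) (case_nat x c)"
  using assms unfolding chain_def sector_def by (auto split: nat.splits)

text \<open>Beside a vertex \<open>x\<close> at least \<open>2 * 2 ^ k - 1\<close> others remain, so
  \<open>2 ^ k\<close> of them lie on one side of \<open>x\<close>, which is then put at the front
  or at the end of a chain found there.\<close>

lemma tour_chain:
  assumes "tour E V" "finite A" "A \<subseteq> V" "2 ^ k \<le> card A"
  shows "\<exists>d. chain E A k d"
  using assms(2-4)
proof (induction k arbitrary: A)
  case 0
  then show ?case unfolding chain_def by auto
next
  case (Suc k)
  have "A \<noteq> {}" using Suc.prems by auto
  then obtain x where x: "x \<in> A" by blast
  define B C where "B = {y\<in>A. E x y}" and "C = {y\<in>A. E y x}"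
  have U: "A - {x} = B \<union> C" unfolding B_def C_def
    using assms(1) x Suc.prems tourD[OF assms(1), of x] asy_irrefl[OF tour_asy[OF assms(1)]] by blast
  have "card (A - {x}) \<le> card B + card C" unfolding U by (rule card_Un_le)
  moreover have "card (A - {x}) = card A - 1" using x Suc.prems by simp
  ultimately have "2 * 2 ^ k \<le> card B + card C + 1" using Suc.prems(3) by simp
  then have "2 ^ k \<le> card B \<or> 2 ^ k \<le> card C" by linarith
  then show ?case
  proof
    assume *: "2 ^ k \<le> card B"
    have "finite B" "B \<subseteq> V" unfolding B_def using Suc.prems by auto
    then obtain d where d: "chain E B k d" using Suc.IH * by blast
    have "chain E A (Suc k) (case_nat x d)"
      using d x unfolding chain_def B_def by (auto split: nat.splits)
    then show ?thesis by blast
  next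
    assume *: "2 ^ k \<le> card C"
    have "finite C" "C \<subseteq> V" unfolding C_def using Suc.prems by auto
    then obtain d where d: "chain E C k d" using Suc.IH * by blast
    have "chain E A (Suc k) (\<lambda>i. if i < k then d i else x)"
      using d x unfolding chain_def C_def by (auto simp: less_Suc_eq)
    then show ?thesis by blast
  qed
qed

section \<open>Chains with prescribed arcs between them\<close>

lemma sectorD: "x \<in> sector E V s t \<Longrightarrow> x \<in> V" "x \<in> sector E V s t \<Longrightarrow> f \<in> s \<Longrightarrow> E x f"
  "x \<in> sector E V s t \<Longrightarrow> f \<in> t \<Longrightarrow> E f x"
  unfolding sector_def by blast+

lemma sectorI: "x \<in> V \<Longrightarrow> (\<And>f. f \<in> s \<Longrightarrow> E x f) \<Longrightarrow> (\<And>f. f \<in> t \<Longrightarrow> E f x) \<Longrightarrow> x \<in> sector E V s t"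
  unfolding sector_def by blast

text \<open>\<open>v\<close> colours \<open>M\<close> by the direction of its arcs. If no arc led
  from one colour to the other in the required direction, a colour would propagate along arcs; since
  every arc lies in a 3-cycle, it would reach a vertex of the other colour.\<close>

lemma mixed_arcs:
  assumes T: "htour E M" and M: "a \<in> M" "b \<in> M" "c \<in> M" "c3 E a b c"
    and v: "\<And>x. x \<in> M \<Longrightarrow> E v x \<or> E x v" and x: "x \<in> M" "E v x" and y: "y \<in> M" "E y v"
  shows "\<exists>p\<in>M. \<exists>q\<in>M. E p q \<and> E v p \<and> E q v" "\<exists>p\<in>M. \<exists>q\<in>M. E p q \<and> E p v \<and> E v q"
proof -
  note A = asyD[OF htour_asy[OF T]]
  have ne: "x \<noteq> y" using x y A by blast
  show "\<exists>p\<in>M. \<exists>q\<in>M. E p q \<and> E v p \<and> E q v"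
  proof (rule ccontr)
    assume "\<not> ?thesis"
    then have n: "\<And>p q. p \<in> M \<Longrightarrow> q \<in> M \<Longrightarrow> E p q \<Longrightarrow> E v p \<Longrightarrow> E v q" using v by blast
    then have "E y x" using htourD[OF T x(1) y(1) ne] x y A by blast
    then obtain z where z: "z \<in> M" "E x z" "E z y" using arc_c3[OF T M y(1) x(1)] by blast
    then have "E v z" using n x by blast
    then have "E v y" using n z y by blast
    then show False using y A by blast
  qed
  show "\<exists>p\<in>M. \<exists>q\<in>M. E p q \<and> E p v \<and> E v q"
  proof (rule ccontr)
    assume "\<not> ?thesis"
    then have n: "\<And>p q. p \<in> M \<Longrightarrow> q \<in> M \<Longrightarrow> E p q \<Longrightarrow> E p v \<Longrightarrow> E q v" using v by blast
    then have "E x y" using htourD[OF T x(1) y(1) ne] x y A by blast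
    then obtain z where z: "z \<in> M" "E y z" "E z x" using arc_c3[OF T M x(1) y(1)] by blast
    then have "E z v" using n y by blast
    then have "E x v" using n z x by blast
    then show False using x A by blast
  qed
qed

lemma phom_one:
  assumes "asy E" "finite F" "F \<subseteq> V" "p \<in> V" "m \<in> V" "p \<notin> F" "m \<notin> F"
    "\<And>f. f \<in> F \<Longrightarrow> E p f \<Longrightarrow> E m f" "\<And>f. f \<in> F \<Longrightarrow> E f p \<Longrightarrow> E f m"
  shows "phom E V (insert (p, m) ((\<lambda>x. (x, x)) ` F))"
proof (rule phomI)
  show "finite (insert (p, m) ((\<lambda>x. (x, x)) ` F))" using assms(2) by simp
  fix x x' assume x: "(x, x') \<in> insert (p, m) ((\<lambda>x. (x, x)) ` F)"
  show "x \<in> V \<and> x' \<in> V" using x assms(3-5) by blast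
  fix y y' assume y: "(y, y') \<in> insert (p, m) ((\<lambda>x. (x, x)) ` F)"
  have x: "x = p \<and> x' = m \<or> x \<in> F \<and> x' = x" and y: "y = p \<and> y' = m \<or> y \<in> F \<and> y' = y" using x y by blast+
  show "x' = y'" if "x = y" using that x y assms(6,7) by blast
  show "E x' y'" if "E x y" using that x y assms(8,9) asy_irrefl[OF assms(1)] by blast
qed

lemma one_move:
  assumes T: "htour E V" and F: "finite F" "F \<subseteq> V" "p \<in> V" "m \<in> V" "p \<notin> F" "m \<notin> F"
    "\<And>f. f \<in> F \<Longrightarrow> E p f \<Longrightarrow> E m f" "\<And>f. f \<in> F \<Longrightarrow> E f p \<Longrightarrow> E f m" and q: "q \<in> V"
  shows "\<exists>q'\<in>V. (E p q \<longrightarrow> E m q') \<and> (E q p \<longrightarrow> E q' m) \<and> (\<forall>f\<in>F. (E f q \<longrightarrow> E f q') \<and> (E q f \<longrightarrow> E q' f))"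
proof -
  have "phom E V (insert (p, m) ((\<lambda>x. (x, x)) ` F))" by (rule phom_one[OF htour_asy[OF T]]) (use F in blast)+
  then obtain w where w: "w \<in> V" "phom E V (insert (q, w) (insert (p, m) ((\<lambda>x. (x, x)) ` F)))"
    using htour_hh[OF T] q by blast
  note D = phomD(2)[OF w(2)]
  have "E p q \<longrightarrow> E m w" using D[of p m q w] by blast
  moreover have "E q p \<longrightarrow> E w m" using D[of q w p m] by blast
  moreover have "E f q \<longrightarrow> E f w" "E q f \<longrightarrow> E w f" if "f \<in> F" for f using D[of f f q w] D[of q w f f] that by blast+
  ultimately show ?thesis using w(1) by blast
qed

text \<open>Induction on the length: choose \<open>m\<close> of the colour \<open>w 0\<close> and
  continue in its out-neighbourhood inside the sector, so \<open>t\<close> grows while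
  \<open>s\<close> stays. This is again \<open>good\<close>; the work lies in finding both colours
  there.\<close>

lemma coloured_words:
  assumes T: "htour E V" and v: "v \<in> V" and s: "finite s" "s \<subseteq> V"
  shows "finite t \<Longrightarrow> t \<subseteq> V \<Longrightarrow> v \<notin> sector E V s t \<Longrightarrow> good E (sector E V s t) \<Longrightarrow>
    \<exists>x\<in>sector E V s t. E v x \<Longrightarrow> \<exists>x\<in>sector E V s t. E x v \<Longrightarrow>
    \<exists>c. chain E (sector E V s t) n c \<and> (\<forall>i<n. E v (c i) \<longleftrightarrow> w i)"
proof (induction n arbitrary: t w)
  case 0
  then show ?case unfolding chain_def by auto
next
  case (Suc n)
  note A = asyD[OF htour_asy[OF T]] and I = asy_irrefl[OF htour_asy[OF T]]
  let ?M = "sector E V s t"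
  have M: "htour E ?M" using Suc.prems(4) by (rule good_htour)
  obtain a b c where C: "a \<in> ?M" "b \<in> ?M" "c \<in> ?M" "c3 E a b c" using Suc.prems(4) by (rule goodE)
  have cv: "E v x \<or> E x v" "x \<noteq> v" if "x \<in> ?M" for x
    using that Suc.prems(3) htourD[OF T v sectorD(1)[OF that]] by blast+
  let ?F = "insert v (s \<union> t)"
  have F: "finite ?F" "?F \<subseteq> V" using s v Suc.prems by auto
  have notF: "x \<notin> ?F" if "x \<in> ?M" for x using cv(2)[OF that] sectorD(2,3)[OF that, of x] I by blast
  \<comment> \<open>If the colours agree, moving \<open>p\<close> to \<open>m\<close> while fixing
    \<open>v\<close>, \<open>s\<close> and \<open>t\<close> is a partial homomorphism. It takes
    \<open>q\<close> to a vertex of the sector with the same colour.\<close>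
  have mv: "\<exists>q'\<in>?M. (E p q \<longrightarrow> E m q') \<and> (E q p \<longrightarrow> E q' m) \<and> (E v q' \<longleftrightarrow> E v q)"
    if p: "p \<in> ?M" and m: "m \<in> ?M" and q: "q \<in> ?M" and col: "E v p \<longleftrightarrow> E v m" for p q m
  proof -
    have "E p f \<Longrightarrow> E m f" "E f p \<Longrightarrow> E f m" if "f \<in> ?F" for f
      using that col cv[OF p] cv[OF m] sectorD(2,3)[OF p] sectorD(2,3)[OF m] A by blast+
    then obtain q' where q': "q' \<in> V" "E p q \<longrightarrow> E m q'" "E q p \<longrightarrow> E q' m"
      "\<forall>f\<in>?F. (E f q \<longrightarrow> E f q') \<and> (E q f \<longrightarrow> E q' f)"
      using one_move[OF T F sectorD(1)[OF p] sectorD(1)[OF m] notF[OF p] notF[OF m] _ _ sectorD(1)[OF q]] by metis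
    have "q' \<in> ?M" by (rule sectorI) (use q' sectorD(2,3)[OF q] in blast)+
    moreover have "E v q' \<longleftrightarrow> E v q" using q'(4) cv[OF q] A by blast
    ultimately show ?thesis using q' by blast
  qed
  obtain m where m: "m \<in> ?M" "E v m \<longleftrightarrow> w 0"
  proof (cases "w 0")
    case True
    then show thesis using Suc.prems(5) that by blast
  next
    case False
    then show thesis using Suc.prems(6) that A by blast
  qed
  have mixed: "\<exists>p\<in>?M. \<exists>q\<in>?M. E p q \<and> (E v p \<longleftrightarrow> w 0) \<and> (E v q \<longleftrightarrow> \<not> w 0)"
  proof -
    obtain x y where xy: "x \<in> ?M" "E v x" "y \<in> ?M" "E y v" using Suc.prems(5,6) by blast
    note mx = mixed_arcs[OF M C cv(1) xy]
    show ?thesis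
    proof (cases "w 0")
      case True
      then show ?thesis using mx(1) A by metis
    next
      case False
      then show ?thesis using mx(2) A by metis
    qed
  qed
  obtain d where d: "d \<in> ?M" "E m d" "E v d \<longleftrightarrow> \<not> w 0"
  proof -
    from mixed obtain p q where pq: "p \<in> ?M" "q \<in> ?M" "E p q" "E v p \<longleftrightarrow> w 0" "E v q \<longleftrightarrow> \<not> w 0" by blast
    then obtain q' where "q' \<in> ?M" "E p q \<longrightarrow> E m q'" "E v q' \<longleftrightarrow> E v q" using mv[OF pq(1) m(1) pq(2)] m(2) by blast
    then show thesis using pq that by blast
  qed
  \<comment> \<open>If \<open>m\<close> were alone in its colour, an in-neighbour \<open>d1\<close>
    and an out-neighbour \<open>d2\<close> would share the other colour. Moving \<open>d1\<close> to
    \<open>d2\<close> takes \<open>m\<close> to a vertex of its own colour, hence to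
    \<open>m\<close>, which would be dominated by \<open>d2\<close>.\<close>
  have two: "\<exists>p\<in>?M. p \<noteq> m \<and> (E v p \<longleftrightarrow> w 0)"
  proof (rule ccontr)
    assume n: "\<not> ?thesis"
    have "\<exists>d1\<in>?M. \<exists>d2\<in>?M. E d1 m \<and> E m d2"
    proof -
      have "embw E [b] [m]" by simp
      from move_list2[OF M this _ _ C(1,3)] have "\<exists>w\<in>?M. \<exists>w'\<in>?M. emb E [b, a, c] [m, w, w'] E"
        using C m by (simp del: emb.simps)
      then obtain w1 w2 where w: "w1 \<in> ?M" "w2 \<in> ?M" "emb E [b, a, c] [m, w1, w2] E" by blast
      then have "E w1 m" "E m w2" using C(4) unfolding c3_def by simp_all
      then show ?thesis using w by blast
    qed
    then obtain d1 d2 where d12: "d1 \<in> ?M" "d2 \<in> ?M" "E d1 m" "E m d2" by blast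
    then have "E v d1 \<longleftrightarrow> E v d2" using n I m by metis
    from mv[OF d12(1,2) m(1) this] obtain m' where m': "m' \<in> ?M" "E d2 m'" "E v m' \<longleftrightarrow> E v m" using d12 by blast
    then have "m' = m" using n m by blast
    then show False using m' d12 A by blast
  qed
  obtain e where e: "e \<in> ?M" "E m e" "E v e \<longleftrightarrow> w 0"
  proof -
    from two obtain p where p: "p \<in> ?M" "p \<noteq> m" "E v p \<longleftrightarrow> w 0" by blast
    show thesis
    proof (cases "E m p")
      case True then show ?thesis using that p by blast
    next
      case False
      then have pm: "E p m" using htourD[OF M m(1) p(1)] p by blast
      \<comment> \<open>Moving \<open>p\<close> to \<open>m\<close> takes \<open>m\<close>, an
        out-neighbour of \<open>p\<close>, to an out-neighbour of \<open>m\<close> of the same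
        colour.\<close>
      obtain m' where "m' \<in> ?M" "E m m'" "E v m' \<longleftrightarrow> E v m" using mv[OF p(1) m(1) m(1)] pm p(3) m(2) by blast
      then show ?thesis using that m by blast
    qed
  qed
  let ?t = "insert m t"
  have sec: "sector E V s ?t = sector E ?M {} {m}" unfolding sector_sector by (simp add: Un_commute)
  have sub: "sector E V s ?t \<subseteq> ?M" unfolding sector_def by blast
  have mem: "x \<in> sector E V s ?t" if "x \<in> ?M" "E m x" for x
    unfolding sec by (rule sectorI) (use that in auto)
  have "\<exists>c. chain E (sector E V s ?t) n c \<and> (\<forall>i<n. E v (c i) \<longleftrightarrow> w (Suc i))"
  proof (rule Suc.IH)
    show "good E (sector E V s ?t)" unfolding sec by (rule good_sector_one[OF Suc.prems(4) m(1)])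
    show "\<exists>x\<in>sector E V s ?t. E v x" using mem d e by blast
    show "\<exists>x\<in>sector E V s ?t. E x v" using mem d e cv(1) by blast
  qed (use Suc.prems m sub sectorD(1)[OF m(1)] in auto)
  then obtain c' where c': "chain E (sector E V s ?t) n c'" "\<And>i. i < n \<Longrightarrow> E v (c' i) \<longleftrightarrow> w (Suc i)" by blast
  have "chain E ?M (Suc n) (case_nat m c')" using chain_Cons[OF m(1)] c'(1) unfolding sec by blast
  moreover have "\<forall>i<Suc n. E v (case_nat m c' i) \<longleftrightarrow> w i" using c'(2) m(2) by (auto split: nat.split)
  ultimately show ?case by blast
qed

lemma chain_phom:
  assumes "asy E" and l: "chain E V n l'" "chain E V n l" and S: "phom E V S"
    and x: "\<And>x y i. (x, y) \<in> S \<Longrightarrow> i < n \<Longrightarrow> x \<noteq> l' i \<and> (E x (l' i) \<longrightarrow> E y (l i)) \<and> (E (l' i) x \<longrightarrow> E (l i) y)"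
  shows "phom E V (S \<union> (\<lambda>i. (l' i, l i)) ` {..<n})"
proof (rule phomI)
  let ?r = "S \<union> (\<lambda>i. (l' i, l i)) ` {..<n}"
  show "finite ?r" using S unfolding phom_def by simp
  fix x x' assume x1: "(x, x') \<in> ?r"
  show "x \<in> V \<and> x' \<in> V" using x1 phomD(3,4)[OF S] chainD(1)[OF l(1)] chainD(1)[OF l(2)] by blast
  fix y y' assume y1: "(y, y') \<in> ?r"
  from x1 y1 consider "(x, x') \<in> S" "(y, y') \<in> S" | i where "(x, x') \<in> S" "i < n" "y = l' i" "y' = l i"
    | i where "(y, y') \<in> S" "i < n" "x = l' i" "x' = l i"
    | i j where "i < n" "x = l' i" "x' = l i" "j < n" "y = l' j" "y' = l j" by blast
  then show "x' = y'" if "x = y"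
  proof cases
    case 1 then show ?thesis using that phomD(1)[OF S] by blast
  next
    case 2 then show ?thesis using that x by blast
  next
    case 3 then show ?thesis using that x by blast
  next
    case 4 then show ?thesis using that chain_iff(2)[OF assms(1) l(1)] by metis
  qed
  from x1 y1 consider "(x, x') \<in> S" "(y, y') \<in> S" | i where "(x, x') \<in> S" "i < n" "y = l' i" "y' = l i"
    | i where "(y, y') \<in> S" "i < n" "x = l' i" "x' = l i"
    | i j where "i < n" "x = l' i" "x' = l i" "j < n" "y = l' j" "y' = l j" by blast
  then show "E x' y'" if "E x y"
  proof cases
    case 1 then show ?thesis using that phomD(2)[OF S] by blast
  next
    case 2 then show ?thesis using that x by blast
  next
    case 3 then show ?thesis using that x by blast
  next
    case 4 then show ?thesis using that chain_iff(1)[OF assms(1) l(1)] chain_iff(1)[OF assms(1) l(2)] by metis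
  qed
qed

lemma phom_Id: "finite F \<Longrightarrow> F \<subseteq> V \<Longrightarrow> phom E V ((\<lambda>x. (x, x)) ` F)"
  by (rule phomI) auto

lemma chain_move:
  assumes T: "htour E V" and l: "chain E V n l'" "chain E V n l" and S: "phom E V S"
    and x: "\<forall>p\<in>S. \<forall>i<n. fst p \<noteq> l' i \<and> (E (fst p) (l' i) \<longrightarrow> E (snd p) (l i)) \<and> (E (l' i) (fst p) \<longrightarrow> E (l i) (snd p))"
    and B: "finite B" "B \<subseteq> V"
  shows "\<exists>g. (\<forall>i<n. g (l' i) = l i) \<and> (\<forall>p\<in>S. g (fst p) = snd p) \<and>
    (\<forall>x\<in>l' ` {..<n} \<union> fst ` S \<union> B. g x \<in> V) \<and>
    (\<forall>x\<in>l' ` {..<n} \<union> fst ` S \<union> B. \<forall>y\<in>l' ` {..<n} \<union> fst ` S \<union> B. (E x y \<longleftrightarrow> E (g x) (g y)) \<and> (g x = g y \<longleftrightarrow> x = y))"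
proof -
  let ?r = "S \<union> (\<lambda>i. (l' i, l i)) ` {..<n}"
  have "phom E V ?r" by (rule chain_phom[OF htour_asy[OF T] l S]) (use x in force)
  from htour_move[OF T this B] obtain g where g: "\<forall>(x, x')\<in>?r. g x = x'" "\<forall>x\<in>fst ` ?r \<union> B. g x \<in> V"
    "\<forall>x\<in>fst ` ?r \<union> B. \<forall>y\<in>fst ` ?r \<union> B. (E x y \<longleftrightarrow> E (g x) (g y)) \<and> (g x = g y \<longleftrightarrow> x = y)" by (elim exE conjE)
  have f: "fst ` ?r = l' ` {..<n} \<union> fst ` S" by force
  have "g (l' i) = l i" if "i < n" for i using bspec[OF g(1), of "(l' i, l i)"] that by auto
  moreover have "g (fst p) = snd p" if "p \<in> S" for p using bspec[OF g(1), of p] that by (auto simp: case_prod_beta)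
  ultimately show ?thesis using g(2,3) unfolding f by (intro exI[of _ g] conjI) blast+
qed

text \<open>Take \<open>2 ^ k\<close> elements \<open>u\<^sub>j\<close> of the second sort over one long chain of the first sort, which has a
  block of length \<open>m\<close> for every \<open>k\<close>-tuple of indices: towards the block of \<open>\<sigma>\<close>, the element \<open>u\<^bsub>\<sigma> r\<^esub>\<close>
  has the arcs prescribed for the \<open>r\<close>-th element of the second chain. The \<open>u\<^sub>j\<close> contain a chain of
  length \<open>k\<close>, whose indices select the block.\<close>

lemma ramsey_sorts:
  assumes T: "htour E V" and fin: "finite s" "s \<subseteq> V" "finite t" "t \<subseteq> V"
    and words: "\<And>n w. \<exists>c u. chain E (sector E V s t) n c \<and> u \<in> sector E V t s \<and> (\<forall>i<n. E u (c i) \<longleftrightarrow> w i)"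
    and disj: "\<And>x. x \<in> sector E V s t \<Longrightarrow> x \<notin> sector E V t s"
  shows "\<exists>c d. chain E (sector E V s t) m c \<and> chain E (sector E V t s) k d \<and>
    (\<forall>i<m. \<forall>j<k. (E (d j) (c i) \<longleftrightarrow> X i j) \<and> (E (c i) (d j) \<longleftrightarrow> \<not> X i j) \<and> c i \<noteq> d j)"
proof -
  note A = asyD[OF htour_asy[OF T]] and I = asy_irrefl[OF htour_asy[OF T]]
  let ?D = "sector E V s t" and ?U = "sector E V t s"
  define N where "N = (2::nat) ^ k"
  define S where "S = {\<sigma> :: nat list. set \<sigma> \<subseteq> {..<N} \<and> length \<sigma> = k}"
  have "finite S" unfolding S_def by (rule finite_lists_length_eq) simp
  then obtain e where e: "bij_betw e S {0..<card S}" using ex_bij_betw_finite_nat by blast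
  define q where "q = card S"
  define n where "n = q * m + N"
  \<comment> \<open>Position \<open>pos\<close> in the blocks is place \<open>pos mod m\<close> of
    block \<open>pos div m\<close>. The last \<open>N\<close> positions carry a single mark at
    \<open>j\<close>, which makes the vertices \<open>u j\<close> pairwise distinct.\<close>
  define W where "W j pos \<longleftrightarrow> (if pos < q * m then \<exists>r<k. (inv_into S e (pos div m)) ! r = j \<and> X (pos mod m) r else pos = q * m + j)" for j pos
  obtain c where c: "chain E ?D n c" using words[of n "\<lambda>_. True"] by blast
  have cV: "chain E V n c" using c by (rule chain_subset) (auto simp: sector_def)
  \<comment> \<open>\<open>words\<close> gives a vertex over a chain of its own. That chain is moved
    onto \<open>c\<close> with \<open>s\<close> and \<open>t\<close> fixed, so the vertex stays in
    its sector.\<close>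
  have "\<exists>u\<in>?U. \<forall>i<n. E u (c i) \<longleftrightarrow> W j i" for j
  proof -
    obtain c' u where u: "chain E ?D n c'" "u \<in> ?U" "\<forall>i<n. E u (c' i) \<longleftrightarrow> W j i" using words[of n "W j"] by blast
    have cV': "chain E V n c'" using u(1) by (rule chain_subset) (auto simp: sector_def)
    have S: "phom E V ((\<lambda>x. (x, x)) ` (s \<union> t))" by (rule phom_Id) (use fin in auto)
    have "f \<noteq> c' i \<and> (E f (c' i) \<longrightarrow> E f (c i)) \<and> (E (c' i) f \<longrightarrow> E (c i) f)" if "f \<in> s \<union> t" "i < n" for f i
      using sectorD(2,3)[OF chainD(1)[OF u(1) that(2)], of f] sectorD(2,3)[OF chainD(1)[OF c that(2)], of f] that(1) I A by blast
    then have cr: "\<forall>p\<in>(\<lambda>x. (x, x)) ` (s \<union> t). \<forall>i<n. fst p \<noteq> c' i \<and> (E (fst p) (c' i) \<longrightarrow> E (snd p) (c i)) \<and>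
       (E (c' i) (fst p) \<longrightarrow> E (c i) (snd p))" by auto
    have fu: "finite {u}" "{u} \<subseteq> V" using sectorD(1)[OF u(2)] by simp_all
    from chain_move[OF T cV' cV S cr fu] obtain g where g: "\<forall>i<n. g (c' i) = c i" "\<forall>p\<in>(\<lambda>x. (x, x)) ` (s \<union> t). g (fst p) = snd p"
      "\<forall>x\<in>c' ` {..<n} \<union> fst ` (\<lambda>x. (x, x)) ` (s \<union> t) \<union> {u}. g x \<in> V"
      "\<forall>x\<in>c' ` {..<n} \<union> fst ` (\<lambda>x. (x, x)) ` (s \<union> t) \<union> {u}. \<forall>y\<in>c' ` {..<n} \<union> fst ` (\<lambda>x. (x, x)) ` (s \<union> t) \<union> {u}.
         (E x y \<longleftrightarrow> E (g x) (g y)) \<and> (g x = g y \<longleftrightarrow> x = y)"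
      by (elim exE conjE)
    have gf: "g f = f" if "f \<in> s \<union> t" for f using g(2) that by auto
    have "E (g u) (g f) \<longleftrightarrow> E u f" "E (g f) (g u) \<longleftrightarrow> E f u" if "f \<in> s \<union> t" for f
      using g(4) that by (simp_all add: image_image)
    then have "g u \<in> ?U" using gf g(3) sectorD(2,3)[OF u(2)] by (intro sectorI) simp_all
    moreover have "E (g u) (c i) \<longleftrightarrow> W j i" if "i < n" for i
    proof -
      have "E (g u) (g (c' i)) \<longleftrightarrow> E u (c' i)" using g(4) that by simp
      then show ?thesis using g(1) u(3) that by simp
    qed
    ultimately show ?thesis by blast
  qed
  then obtain u where u: "\<And>j. u j \<in> ?U" "\<And>i j. i < n \<Longrightarrow> E (u j) (c i) \<longleftrightarrow> W j i" by metis
  have inj: "inj_on u {..<N}"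
  proof (rule inj_onI)
    fix j j' assume j: "j \<in> {..<N}" "j' \<in> {..<N}" "u j = u j'"
    have "q * m + j < n" using j unfolding n_def by simp
    then show "j = j'" using u(2)[of "q * m + j" j] u(2)[of "q * m + j" j'] j(3) unfolding W_def by simp
  qed
  have "card (u ` {..<N}) = 2 ^ k" using card_image[OF inj] unfolding N_def by simp
  moreover have "tour E V" using T unfolding htour_def by blast
  moreover have uV: "u ` {..<N} \<subseteq> V" using sectorD(1)[OF u(1)] by blast
  ultimately obtain d where d: "chain E (u ` {..<N}) k d" using tour_chain[of E V "u ` {..<N}" k] by auto
  define \<sigma> where "\<sigma> = map (\<lambda>r. inv_into {..<N} u (d r)) [0..<k]"
  have ud: "u (\<sigma> ! r) = d r" "\<sigma> ! r < N" if "r < k" for r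
    using chainD(1)[OF d that] that f_inv_into_f[of "d r" u "{..<N}"] inv_into_into[of "d r" u "{..<N}"]
    unfolding \<sigma>_def by auto
  have \<sigma>: "\<sigma> \<in> S" unfolding S_def using ud(2) by (auto simp: in_set_conv_nth) (simp_all add: \<sigma>_def)
  have \<sigma>inj: "\<sigma> ! r = \<sigma> ! r' \<longleftrightarrow> r = r'" if "r < k" "r' < k" for r r'
    using ud(1)[OF that(1)] ud(1)[OF that(2)] chain_iff(2)[OF htour_asy[OF T] d that] by metis
  have e\<sigma>: "e \<sigma> < q" "inv_into S e (e \<sigma>) = \<sigma>" using e \<sigma> unfolding bij_betw_def q_def by auto
  define f where "f i = e \<sigma> * m + i" for i
  have fq: "f i < q * m" if "i < m" for i
  proof -
    have "e \<sigma> * m + i < (e \<sigma> + 1) * m" using that by simp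
    also have "\<dots> \<le> q * m" using e\<sigma> by (intro mult_right_mono) auto
    finally show ?thesis unfolding f_def .
  qed
  then have fn: "f i < n" if "i < m" for i using that unfolding n_def by (simp add: trans_less_add1)
  have c': "chain E ?D m (c \<circ> f)" by (rule chain_compose[OF c fn]) (auto simp: f_def)
  have d': "chain E ?U k d" by (rule chain_subset[OF d]) (use u(1) in blast)
  have "(E (d r) (c (f i)) \<longleftrightarrow> X i r) \<and> (E (c (f i)) (d r) \<longleftrightarrow> \<not> X i r) \<and> c (f i) \<noteq> d r" if "i < m" "r < k" for i r
  proof -
    have m: "c (f i) \<in> ?D" "d r \<in> ?U" using chainD(1)[OF c fn[OF that(1)]] chainD(1)[OF d' that(2)] .
    then have ne: "c (f i) \<noteq> d r" using disj by metis
    have "f i div m = e \<sigma>" "f i mod m = i" using that unfolding f_def by auto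
    then have "W (\<sigma> ! r) (f i) \<longleftrightarrow> X i r" using fq[OF that(1)] e\<sigma>(2) \<sigma>inj that(2) unfolding W_def by auto
    then have "E (d r) (c (f i)) \<longleftrightarrow> X i r" using u(2)[OF fn[OF that(1)], of "\<sigma> ! r"] ud(1)[OF that(2)] by simp
    then show ?thesis using ne htourD[OF T sectorD(1)[OF m(1)] sectorD(1)[OF m(2)] ne] A by blast
  qed
  then show ?thesis using c' d' by (intro exI[of _ "c \<circ> f"] exI[of _ d]) simp
qed

text \<open>The sorts come from two third vertices \<open>z1 -> z2\<close> over an arc
  \<open>a1 -> b1\<close>. The vertices \<open>x\<close> with \<open>z1 -> x -> a1\<close> form a
  good sector; \<open>b1\<close> lies on the opposite side of both \<open>z1\<close> and
  \<open>a1\<close> and has both colours on this sector.\<close>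

lemma two_chains:
  assumes G: "good E V"
  shows "\<exists>c d. chain E V m c \<and> chain E V k d \<and>
    (\<forall>i<m. \<forall>j<k. (E (d j) (c i) \<longleftrightarrow> X i j) \<and> (E (c i) (d j) \<longleftrightarrow> \<not> X i j) \<and> c i \<noteq> d j)"
proof -
  have T: "htour E V" using G by (rule good_htour)
  note A = asyD[OF htour_asy[OF T]] and I = asy_irrefl[OF htour_asy[OF T]] and tot = htourD[OF T]
  obtain d1 a1 b1 c1 where y: "d1 \<in> V" "a1 \<in> V" "b1 \<in> V" "c1 \<in> V" "c3 E a1 b1 c1" "E a1 d1" "E b1 d1" "E c1 d1"
    using G by (rule goodE')
  have ab: "E a1 b1" using y(5) unfolding c3_def by blast
  obtain z1 z2 where z: "z1 \<in> V" "z2 \<in> V" "E z1 z2" "E b1 z1" "E z1 a1" "E b1 z2" "E z2 a1"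
    using two_c3_over_arc[OF T y(2-4,1,5-8) y(2,3) ab] by blast
  let ?l1 = z1 and ?l2 = a1 and ?v = b1
  have ne: "z1 \<noteq> a1" "a1 \<noteq> b1" "b1 \<noteq> z1" "z2 \<noteq> a1" "z2 \<noteq> b1" "z1 \<noteq> z2" using z ab I by blast+
  have nn: "\<not> E a1 z1" "\<not> E b1 a1" "\<not> E z1 b1" "\<not> E a1 z2" "\<not> E z2 b1" using z ab A by blast+
  \<comment> \<open>The 3-cycle \<open>b1 z2 a1\<close> goes to \<open>z1 a1 b1\<close>. The copy
    \<open>m2\<close> of \<open>z1\<close> is the vertex of the sector with an arc to
    \<open>b1\<close>, while \<open>z2\<close> is the one with an arc from it.\<close>
  have "embw E [b1, z2, a1] [z1, a1, b1]" using z ab ne nn by simp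
  from move_list1[OF T this _ _ z(1)] have "\<exists>w\<in>V. emb E [b1, z2, a1, z1] [z1, a1, b1, w] E"
    using z y by (simp del: emb.simps)
  then obtain m2 where m2: "m2 \<in> V" "emb E [b1, z2, a1, z1] [z1, a1, b1, m2] E" by blast
  then have m2': "E z1 m2" "E m2 a1" "E m2 b1" using z ab by simp_all
  let ?M = "sector E V {a1} {z1}"
  have sec: "?M = sector E (sector E V {} {z1}) {a1} {}" unfolding sector_sector by simp
  have GM: "good E ?M" unfolding sec
    by (rule good_sector_one'[OF good_sector_one[OF G z(1)]]) (use y z in \<open>simp add: sector_def\<close>)
  have w: "\<exists>c. chain E ?M n c \<and> (\<forall>i<n. E b1 (c i) \<longleftrightarrow> w i)" for n w
  proof (rule coloured_words[OF T y(3)])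
    show "\<exists>x\<in>?M. E b1 x" using z by (intro bexI[of _ z2] sectorI) auto
    show "\<exists>x\<in>?M. E x b1" using m2(1) m2' by (intro bexI[of _ m2] sectorI) auto
    show "b1 \<notin> ?M" using sectorD(2)[of b1 E V "{a1}" "{z1}" a1] nn by blast
  qed (use y z GM in auto)
  have u: "b1 \<in> sector E V {z1} {a1}" using y z ab by (intro sectorI) auto
  have "\<exists>c d. chain E ?M m c \<and> chain E (sector E V {z1} {a1}) k d \<and>
    (\<forall>i<m. \<forall>j<k. (E (d j) (c i) \<longleftrightarrow> X i j) \<and> (E (c i) (d j) \<longleftrightarrow> \<not> X i j) \<and> c i \<noteq> d j)"
  proof (rule ramsey_sorts[OF T])
    show "\<exists>c u. chain E ?M n c \<and> u \<in> sector E V {z1} {a1} \<and> (\<forall>i<n. E u (c i) \<longleftrightarrow> w i)" for n w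
      using w u by blast
    show "x \<notin> sector E V {z1} {a1}" if "x \<in> ?M" for x using sectorD(2)[OF that, of a1] sectorD(3)[of x E V "{z1}" "{a1}" a1] A by blast
  qed (use y z in auto)
  then obtain c d where cd: "chain E ?M m c" "chain E (sector E V {z1} {a1}) k d"
    "\<forall>i<m. \<forall>j<k. (E (d j) (c i) \<longleftrightarrow> X i j) \<and> (E (c i) (d j) \<longleftrightarrow> \<not> X i j) \<and> c i \<noteq> d j" by (elim exE conjE)
  have "chain E V m c" by (rule chain_subset[OF cd(1)]) (auto simp: sector_def)
  moreover have "chain E V k d" by (rule chain_subset[OF cd(2)]) (auto simp: sector_def)
  ultimately show ?thesis using cd(3) by (intro exI[of _ c] exI[of _ d] conjI)
qed

section \<open>Types over a chain\<close>

definition ty :: "('a \<Rightarrow> 'a \<Rightarrow> bool) \<Rightarrow> 'a set \<Rightarrow> nat \<Rightarrow> (nat \<Rightarrow> 'a) \<Rightarrow> (nat \<Rightarrow> bool) \<Rightarrow> 'a set" where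
  "ty E V n l p = {x \<in> V. \<forall>i<n. if p i then E x (l i) else E (l i) x}"

lemma ty_sector: "ty E V n l p = sector E V (l ` {i. i < n \<and> p i}) (l ` {i. i < n \<and> \<not> p i})"
  unfolding ty_def sector_def by auto

lemma tyD:
  assumes "x \<in> ty E V n l p" shows "x \<in> V" "i < n \<Longrightarrow> p i \<Longrightarrow> E x (l i)" "i < n \<Longrightarrow> \<not> p i \<Longrightarrow> E (l i) x"
  using assms unfolding ty_def by auto

lemma tyI: "x \<in> V \<Longrightarrow> (\<And>i. i < n \<Longrightarrow> p i \<Longrightarrow> E x (l i)) \<Longrightarrow> (\<And>i. i < n \<Longrightarrow> \<not> p i \<Longrightarrow> E (l i) x) \<Longrightarrow> x \<in> ty E V n l p"
  unfolding ty_def by auto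

lemma htour_ty: "htour E V \<Longrightarrow> chain E V n l \<Longrightarrow> htour E (ty E V n l p)"
  unfolding ty_sector by (rule htour_sector) (auto simp: chain_def)

text \<open>\<open>K\<close> is a 3-cycle with a vertex dominating it. A chain \<open>l'\<close> is
  built over which \<open>K\<close> has type \<open>p\<close>: element \<open>j\<close> is a common
  out-neighbour of \<open>K\<close> if \<open>p j\<close>, and a common in-neighbour otherwise.
  Moving \<open>l'\<close> to \<open>l\<close> moves \<open>K\<close> into the type. The mixture is
  a chain because its two sources satisfy \<open>y j -> x i\<close> exactly for
  \<open>j < i\<close>.\<close>

lemma ty_good:
  assumes G: "good E V" and l: "chain E V n l"
  shows "good E (ty E V n l p)"
proof -
  have T: "htour E V" using G by (rule good_htour)
  note A = asyD[OF htour_asy[OF T]] and I = asy_irrefl[OF htour_asy[OF T]] and tot = htourD[OF T]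
  note ci = chain_iff[OF htour_asy[OF T]]
  obtain i a b c where z: "i \<in> V" "a \<in> V" "b \<in> V" "c \<in> V" "c3 E a b c" "E i a" "E i b" "E i c"
    using G by (rule goodE)
  have C: "E a b" "E b c" "E c a" using z(5) unfolding c3_def by blast+
  have ne: "i \<noteq> a" "i \<noteq> b" "i \<noteq> c" "a \<noteq> b" "b \<noteq> c" "a \<noteq> c" using z C I by blast+
  have nn: "\<not> E a i" "\<not> E b i" "\<not> E c i" "\<not> E b a" "\<not> E c b" "\<not> E a c" using z C A by blast+
  let ?K = "{i, a, b, c}"
  let ?D = "sector E V {} ?K" and ?U = "sector E V ?K {}"
  have K: "finite ?K" "?K \<subseteq> V" using z by auto
  have mem: "w \<in> ?D \<longleftrightarrow> E i w \<and> E a w \<and> E b w \<and> E c w" "w \<in> ?U \<longleftrightarrow> E w i \<and> E w a \<and> E w b \<and> E w c" if "w \<in> V" for w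
    using that unfolding sector_def by auto
  have GD: "good E ?D"
  proof -
    \<comment> \<open>With this matrix both \<open>x 0, y 0, x 1, x 2\<close> and
      \<open>x 3, y 1, x 4, x 5\<close> are a vertex followed by a 3-cycle it dominates, and every
      vertex of the first quadruple dominates every vertex of the second.\<close>
    define Z where "Z i j \<longleftrightarrow> (if j = 0 then i \<noteq> 0 \<and> i \<noteq> 2 else i = (4::nat))" for i j :: nat
    obtain x y where xy: "chain E V 6 x" "chain E V 2 y"
      "\<forall>i<6. \<forall>j<2. (E (y j) (x i) \<longleftrightarrow> Z i j) \<and> (E (x i) (y j) \<longleftrightarrow> \<not> Z i j) \<and> x i \<noteq> y j"
      using two_chains[OF G, of 6 2 Z] by (elim exE conjE)
    have X: "x 0 \<in> V" "x 1 \<in> V" "x 2 \<in> V" "x 3 \<in> V" "x 4 \<in> V" "x 5 \<in> V" "y 0 \<in> V" "y 1 \<in> V"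
      using xy(1,2) unfolding chain_def by simp_all
    have xx: "E (x i) (x j) \<longleftrightarrow> i < j" "x i = x j \<longleftrightarrow> i = j" if "i < 6" "j < 6" for i j using ci[OF xy(1) that] by blast+
    have yy: "E (y 0) (y 1)" using ci[OF xy(2), of 0 1] by simp
    have yx: "E (y 0) (x i) \<longleftrightarrow> i \<noteq> 0 \<and> i \<noteq> 2" "E (y 1) (x i) \<longleftrightarrow> i = 4"
      "E (x i) (y 0) \<longleftrightarrow> i = 0 \<or> i = 2" "E (x i) (y 1) \<longleftrightarrow> i \<noteq> 4" "x i \<noteq> y 0" "x i \<noteq> y 1" "y 0 \<noteq> x i" "y 1 \<noteq> x i" if "i < 6" for i
      using xy(3)[rule_format, of i 0] xy(3)[rule_format, of i 1] that unfolding Z_def by auto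
    have "embw E [x 0, y 0, x 1, x 2] [i, a, b, c]"
      using xx yx z C ne nn by simp
    from move_list[OF T this, of "[x 3, y 1, x 4, x 5]"] obtain ws where ws: "length ws = Suc (Suc (Suc (Suc 0)))"
      "set ws \<subseteq> V" "emb E ([x 0, y 0, x 1, x 2] @ [x 3, y 1, x 4, x 5]) ([i, a, b, c] @ ws) E"
      using X z by (auto simp del: emb.simps)
    from ws(1) obtain i' a' b' c' where ws': "ws = [i', a', b', c']" by (auto simp: length_Suc_conv)
    have e: "E i i'" "E a i'" "E b i'" "E c i'" "E i a'" "E a a'" "E b a'" "E c a'" "E i b'" "E a b'" "E b b'" "E c b'"
      "E i c'" "E a c'" "E b c'" "E c c'" "E i' a'" "E i' b'" "E i' c'" "E a' b'" "E b' c'" "E c' a'"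
      using ws(3) xx yx yy unfolding ws' by simp_all
    show ?thesis
    proof (rule goodI[of _ _ i' a' b' c'])
      show "htour E ?D" by (rule htour_sector[OF T]) (use z in auto)
    qed (use e ws(2) ws' mem in \<open>auto simp: c3_def\<close>)
  qed
  have ex: "\<exists>u\<in>?U. \<exists>d\<in>?D. E d u \<longleftrightarrow> B" for B
  proof -
    \<comment> \<open>Here \<open>x 1, y 0, x 2, x 3\<close> is a copy of \<open>K\<close>,
      \<open>x 0\<close> dominates it, \<open>y 1\<close> is dominated by it, and \<open>B\<close>
      decides the arc between \<open>y 1\<close> and \<open>x 0\<close>.\<close>
    define Z where "Z i j \<longleftrightarrow> (if j = 0 then i = 2 else i = (0::nat) \<and> B)" for i j :: nat
    obtain x y where xy: "chain E V 4 x" "chain E V 2 y"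
      "\<forall>i<4. \<forall>j<2. (E (y j) (x i) \<longleftrightarrow> Z i j) \<and> (E (x i) (y j) \<longleftrightarrow> \<not> Z i j) \<and> x i \<noteq> y j"
      using two_chains[OF G, of 4 2 Z] by (elim exE conjE)
    have X: "x 0 \<in> V" "x 1 \<in> V" "x 2 \<in> V" "x 3 \<in> V" "y 0 \<in> V" "y 1 \<in> V"
      using xy(1,2) unfolding chain_def by simp_all
    have xx: "E (x i) (x j) \<longleftrightarrow> i < j" "x i = x j \<longleftrightarrow> i = j" if "i < 4" "j < 4" for i j using ci[OF xy(1) that] by blast+
    have yy: "E (y 0) (y 1)" using ci[OF xy(2), of 0 1] by simp
    have yx: "E (y 0) (x i) \<longleftrightarrow> i = 2" "E (y 1) (x i) \<longleftrightarrow> i = 0 \<and> B"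
      "E (x i) (y 0) \<longleftrightarrow> i \<noteq> 2" "E (x i) (y 1) \<longleftrightarrow> i \<noteq> 0 \<or> \<not> B" "x i \<noteq> y 0" "x i \<noteq> y 1" "y 0 \<noteq> x i" "y 1 \<noteq> x i" if "i < 4" for i
      using xy(3)[rule_format, of i 0] xy(3)[rule_format, of i 1] that unfolding Z_def by auto
    have "embw E [x 1, y 0, x 2, x 3] [i, a, b, c]"
      using xx yx z C ne nn by simp
    from move_list2[OF T this _ _ X(1,6)] have "\<exists>w\<in>V. \<exists>w'\<in>V. emb E [x 1, y 0, x 2, x 3, x 0, y 1] [i, a, b, c, w, w'] E"
      using X z by (simp del: emb.simps)
    then obtain u d where ud: "u \<in> V" "d \<in> V" "emb E [x 1, y 0, x 2, x 3, x 0, y 1] [i, a, b, c, u, d] E" by blast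
    have "E u i" "E u a" "E u b" "E u c" "E i d" "E a d" "E b d" "E c d" "E d u \<longleftrightarrow> B"
      using ud(3) xx yx yy by simp_all
    then show ?thesis using ud(1,2) mem by blast
  qed
  obtain u d where u: "u \<in> ?U" "d \<in> ?D" "\<not> E d u" using ex[of False] by auto
  obtain u2 d2 where u2: "u2 \<in> ?U" "d2 \<in> ?D" "E d2 u2" using ex[of True] by auto
  have disj: "x \<notin> ?U" if "x \<in> ?D" for x using sectorD(3)[OF that, of i] sectorD(2)[of x E V ?K "{}" i] A by blast
  have "d \<noteq> u" using disj[OF u(2)] u(1) by metis
  then have ud: "E u d" using u(3) tot[OF sectorD(1)[OF u(1)] sectorD(1)[OF u(2)]] by metis
  have notK: "w \<notin> ?K" if "w \<in> ?U" for w using sectorD(2)[OF that, of w] I by blast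
  \<comment> \<open>\<open>u\<close> has an arc to \<open>d\<close>. Moving \<open>u2\<close> to
    \<open>u\<close> over \<open>K\<close> carries \<open>d2\<close> to a vertex with an arc to
    \<open>u\<close>, so both colours of \<open>u\<close> occur in \<open>?D\<close>.\<close>
  have "\<exists>d'\<in>V. (E u2 d2 \<longrightarrow> E u d') \<and> (E d2 u2 \<longrightarrow> E d' u) \<and> (\<forall>f\<in>?K. (E f d2 \<longrightarrow> E f d') \<and> (E d2 f \<longrightarrow> E d' f))"
  proof (rule one_move[OF T K sectorD(1)[OF u2(1)] sectorD(1)[OF u(1)] notK[OF u2(1)] notK[OF u(1)]])
    show "E u f" if "f \<in> ?K" for f using sectorD(2)[OF u(1)] that by blast
    show "E f u" if "f \<in> ?K" "E f u2" for f using sectorD(2)[OF u2(1)] that A by blast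
  qed (use sectorD(1)[OF u2(2)] in blast)
  then obtain d' where d': "d' \<in> V" "E d' u" "\<forall>f\<in>?K. E f d'" using u2(3) sectorD(3)[OF u2(2)] by blast
  have d'D: "d' \<in> ?D" using d' by (intro sectorI) auto
  have w: "\<exists>c. chain E ?D n c \<and> (\<forall>i<n. E u (c i) \<longleftrightarrow> w i)" for n w
  proof (rule coloured_words[OF T sectorD(1)[OF u(1)]])
    show "u \<notin> ?D" using disj u(1) by metis
    show "good E ?D" by (rule GD)
    show "\<exists>x\<in>?D. E u x" using u(2) ud by (rule bexI[rotated])
    show "\<exists>x\<in>?D. E x u" using d'D d'(2) by (rule bexI[rotated])
  qed (use K in simp_all)
  have "\<exists>x y. chain E ?D n x \<and> chain E ?U n y \<and>
    (\<forall>i<n. \<forall>j<n. (E (y j) (x i) \<longleftrightarrow> j < i) \<and> (E (x i) (y j) \<longleftrightarrow> \<not> j < i) \<and> x i \<noteq> y j)"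
  proof (rule ramsey_sorts[OF T])
    show "\<exists>c u. chain E ?D n c \<and> u \<in> ?U \<and> (\<forall>i<n. E u (c i) \<longleftrightarrow> w i)" for n w
      using w u by blast
    show "x \<notin> ?U" if "x \<in> ?D" for x by (rule disj[OF that])
  qed (use K in auto)
  then obtain x y where xy: "chain E ?D n x" "chain E ?U n y" "\<And>i j. i < n \<Longrightarrow> j < n \<Longrightarrow> E (y j) (x i) \<longleftrightarrow> j < i"
    "\<And>i j. i < n \<Longrightarrow> j < n \<Longrightarrow> E (x i) (y j) \<longleftrightarrow> \<not> j < i" by blast
  define l' where "l' j = (if p j then x j else y j)" for j
  have l'K: "if p j then E w (l' j) else E (l' j) w" if "j < n" "w \<in> ?K" for j w
    using sectorD(3)[OF chainD(1)[OF xy(1) that(1)] that(2)] sectorD(2)[OF chainD(1)[OF xy(2) that(1)] that(2)]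
    unfolding l'_def by auto
  have l': "chain E V n l'" unfolding chain_def
  proof (intro conjI allI impI)
    fix j assume "j < n" then show "l' j \<in> V" unfolding l'_def using sectorD(1)[OF chainD(1)[OF xy(1)]] sectorD(1)[OF chainD(1)[OF xy(2)]] by simp
  next
    fix j k assume jk: "j < k" "k < n"
    have "E (x j) (y k)" using xy(4)[of j k] jk by auto
    then show "E (l' j) (l' k)"
      unfolding l'_def using chainD(2)[OF xy(1) jk] chainD(2)[OF xy(2) jk] xy(3)[of k j] jk by auto
  qed
  \<comment> \<open>\<open>S\<close> is the empty map: apart from the chain nothing is
    prescribed.\<close>
  define S where "S = (\<lambda>x. (x, x)) ` (V - V)"
  have S: "phom E V S" unfolding S_def by (rule phom_Id) simp_all
  have cr: "\<forall>p\<in>S. \<forall>i<n. fst p \<noteq> l' i \<and> (E (fst p) (l' i) \<longrightarrow> E (snd p) (l i)) \<and> (E (l' i) (fst p) \<longrightarrow> E (l i) (snd p))"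
    unfolding S_def by simp
  from chain_move[OF T l' l S cr K] obtain g where g0: "\<forall>i<n. g (l' i) = l i" "\<forall>p\<in>S. g (fst p) = snd p"
    "\<forall>x\<in>l' ` {..<n} \<union> fst ` S \<union> ?K. g x \<in> V"
    "\<forall>x\<in>l' ` {..<n} \<union> fst ` S \<union> ?K. \<forall>y\<in>l' ` {..<n} \<union> fst ` S \<union> ?K. (E x y \<longleftrightarrow> E (g x) (g y)) \<and> (g x = g y \<longleftrightarrow> x = y)"
    by (elim exE conjE)
  have S0: "fst ` S = {}" unfolding S_def by simp
  note g = g0(1) g0(3,4)[unfolded S0 Un_empty_right]
  have gt: "g w \<in> ty E V n l p" if "w \<in> ?K" for w
  proof (rule tyI)
    show "g w \<in> V" using g(2) that by blast
    fix j assume j: "j < n"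
    have "(E w (l' j) \<longleftrightarrow> E (g w) (l j)) \<and> (E (l' j) w \<longleftrightarrow> E (l j) (g w))" using g(1,3) that j by (metis UnI1 UnI2 imageI lessThan_iff)
    moreover have "if p j then E w (l' j) else E (l' j) w" by (rule l'K[OF j that])
    ultimately show "p j \<Longrightarrow> E (g w) (l j)" "\<not> p j \<Longrightarrow> E (l j) (g w)" by auto
  qed
  have gE: "E v w \<Longrightarrow> E (g v) (g w)" if "v \<in> ?K" "w \<in> ?K" for v w using g(3) that by blast
  show ?thesis
    by (rule goodI[where i = "g i" and a = "g a" and b = "g b" and c = "g c", OF htour_ty[OF T l]])
      (use gt gE z C in \<open>auto simp: c3_def\<close>)
qed

section \<open>Prescribed types over a chain\<close>

lemma ty_move_list:
  assumes T: "htour E V" and l: "chain E V n l'" "chain E V n l" and e: "embw E xs ys"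
    and t: "list_all2 (\<lambda>x y. \<exists>p. x \<in> ty E V n l' p \<and> y \<in> ty E V n l p) xs ys" and vs: "set vs \<subseteq> V"
  shows "\<exists>ws. length ws = length vs \<and> set ws \<subseteq> V \<and> emb E (xs @ vs) (ys @ ws) E \<and>
    list_all2 (\<lambda>v w. \<forall>p. v \<in> ty E V n l' p \<longrightarrow> w \<in> ty E V n l p) vs ws"
proof -
  note A = asyD[OF htour_asy[OF T]] and I = asy_irrefl[OF htour_asy[OF T]]
  have tr: "tour E V" using T unfolding htour_def by blast
  have tp: "\<exists>p. fst q \<in> ty E V n l' p \<and> snd q \<in> ty E V n l p" if "q \<in> set (zip xs ys)" for q
    using t that unfolding list_all2_iff by (auto simp: case_prod_beta)
  have len: "length xs = length ys" using t by (rule list_all2_lengthD)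
  have V: "set xs \<subseteq> V" "set ys \<subseteq> V"
    using t by (auto simp: list_all2_conv_all_nth in_set_conv_nth dest: tyD(1))+
  note P = embw_pairs[OF e tr V]
  have "set (zip xs ys) \<subseteq> V \<times> V" using V by (auto dest: set_zip_leftD set_zip_rightD)
  then have S: "phom E V (set (zip xs ys))" unfolding phom_def using P by blast
  have cr: "\<forall>p\<in>set (zip xs ys). \<forall>i<n. fst p \<noteq> l' i \<and> (E (fst p) (l' i) \<longrightarrow> E (snd p) (l i)) \<and> (E (l' i) (fst p) \<longrightarrow> E (l i) (snd p))"
  proof (intro ballI allI impI)
    fix q i assume "q \<in> set (zip xs ys)" and i: "i < n"
    then obtain p where p: "fst q \<in> ty E V n l' p" "snd q \<in> ty E V n l p" using tp by blast
    show "fst q \<noteq> l' i \<and> (E (fst q) (l' i) \<longrightarrow> E (snd q) (l i)) \<and> (E (l' i) (fst q) \<longrightarrow> E (l i) (snd q))"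
      using tyD(2,3)[OF p(1) i] tyD(2,3)[OF p(2) i] A I by (cases "p i") metis+
  qed
  from chain_move[OF T l S cr finite_set vs] obtain g where g: "\<forall>i<n. g (l' i) = l i"
    "\<forall>p\<in>set (zip xs ys). g (fst p) = snd p"
    "\<forall>x\<in>l' ` {..<n} \<union> fst ` set (zip xs ys) \<union> set vs. g x \<in> V"
    "\<forall>x\<in>l' ` {..<n} \<union> fst ` set (zip xs ys) \<union> set vs. \<forall>y\<in>l' ` {..<n} \<union> fst ` set (zip xs ys) \<union> set vs.
       (E x y \<longleftrightarrow> E (g x) (g y)) \<and> (g x = g y \<longleftrightarrow> x = y)" by (elim exE conjE)
  have f: "fst ` set (zip xs ys) = set xs" using len by (metis list.set_map map_fst_zip)
  have "g (xs ! i) = ys ! i" if "i < length xs" for i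
  proof -
    have "(xs ! i, ys ! i) \<in> set (zip xs ys)" using that len by (auto simp: set_zip)
    from bspec[OF g(2) this] show ?thesis by simp
  qed
  then have m: "map g xs = ys" using len by (intro nth_equalityI) simp_all
  have em: "emb E (xs @ vs) (map g (xs @ vs)) E" by (rule emb_map) (use g(4) f in simp)
  have tw: "g v \<in> ty E V n l p" if v: "v \<in> set vs" "v \<in> ty E V n l' p" for v p
  proof (rule tyI)
    show "g v \<in> V" using g(3) v by blast
    fix i assume i: "i < n"
    have q: "E v (l' i) \<longleftrightarrow> E (g v) (g (l' i))" "E (l' i) v \<longleftrightarrow> E (g (l' i)) (g v)" using g(4) v(1) i by simp_all
    show "E (g v) (l i)" if "p i" using tyD(2)[OF v(2) i that] q(1) g(1) i by simp
    show "E (l i) (g v)" if "\<not> p i" using tyD(3)[OF v(2) i that] q(2) g(1) i by simp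
  qed
  show ?thesis
  proof (intro exI[of _ "map g vs"] conjI)
    show "set (map g vs) \<subseteq> V" using g(3) by auto
    show "emb E (xs @ vs) (ys @ map g vs) E" using em m by simp
    show "list_all2 (\<lambda>v w. \<forall>p. v \<in> ty E V n l' p \<longrightarrow> w \<in> ty E V n l p) vs (map g vs)"
      using tw by (simp add: list_all2_conv_all_nth)
  qed simp
qed

lemma ty_move1:
  assumes "htour E V" "chain E V n l'" "chain E V n l" "embw E xs ys"
    "list_all2 (\<lambda>x y. \<exists>p. x \<in> ty E V n l' p \<and> y \<in> ty E V n l p) xs ys" "v \<in> ty E V n l' p"
  shows "\<exists>w\<in>ty E V n l p. emb E (xs @ [v]) (ys @ [w]) E"
proof -
  have "set [v] \<subseteq> V" using tyD(1)[OF assms(6)] by simp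
  from ty_move_list[OF assms(1-5) this] obtain ws where ws: "length ws = Suc 0" "emb E (xs @ [v]) (ys @ ws) E"
    "list_all2 (\<lambda>v w. \<forall>p. v \<in> ty E V n l' p \<longrightarrow> w \<in> ty E V n l p) [v] ws" by (auto simp del: emb.simps)
  moreover from ws(1) obtain w where "ws = [w]" by (auto simp: length_Suc_conv)
  ultimately show ?thesis using assms(6) by (intro bexI[of _ w]) simp_all
qed

lemma ty_move2:
  assumes "htour E V" "chain E V n l'" "chain E V n l" "embw E xs ys"
    "list_all2 (\<lambda>x y. \<exists>p. x \<in> ty E V n l' p \<and> y \<in> ty E V n l p) xs ys" "v \<in> ty E V n l' p" "v' \<in> ty E V n l' p'"
  shows "\<exists>w\<in>ty E V n l p. \<exists>w'\<in>ty E V n l p'. emb E (xs @ [v, v']) (ys @ [w, w']) E"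
proof -
  have "set [v, v'] \<subseteq> V" using tyD(1)[OF assms(6)] tyD(1)[OF assms(7)] by simp
  from ty_move_list[OF assms(1-5) this] obtain ws where ws: "length ws = Suc (Suc 0)" "emb E (xs @ [v, v']) (ys @ ws) E"
    "list_all2 (\<lambda>v w. \<forall>p. v \<in> ty E V n l' p \<longrightarrow> w \<in> ty E V n l p) [v, v'] ws" by (auto simp del: emb.simps)
  moreover from ws(1) obtain w w' where "ws = [w, w']" by (auto simp: length_Suc_conv)
  ultimately show ?thesis using assms(6,7) by (intro bexI[of _ w] bexI[of _ w']) simp_all
qed

text \<open>\<open>two_chains\<close> realises the prescription as its matrix over one chain
  \<open>l'\<close>; conjugating \<open>l'\<close> to \<open>l\<close> realises it over every
  chain.\<close>

lemma ty_chain: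
  assumes G: "good E V" and l: "chain E V n l"
  shows "\<exists>d. chain E V k d \<and> (\<forall>j<k. d j \<in> ty E V n l (P j))"
proof -
  have T: "htour E V" using G by (rule good_htour)
  obtain l' d where ld: "chain E V n l'" "chain E V k d"
    "\<forall>i<n. \<forall>j<k. (E (d j) (l' i) \<longleftrightarrow> P j i) \<and> (E (l' i) (d j) \<longleftrightarrow> \<not> P j i) \<and> l' i \<noteq> d j"
    using two_chains[OF G, of n k "\<lambda>i j. P j i"] by blast
  have t: "d j \<in> ty E V n l' (P j)" if "j < k" for j
    by (rule tyI) (use ld that chainD(1)[OF ld(2)] in auto)
  have "set (map d [0..<k]) \<subseteq> V" using chainD(1)[OF ld(2)] by auto
  from ty_move_list[OF T ld(1) l, of "[]" "[]", OF _ _ this] obtain ws where ws: "length ws = k" "set ws \<subseteq> V"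
    "emb E (map d [0..<k]) ws E"
    "list_all2 (\<lambda>v w. \<forall>p. v \<in> ty E V n l' p \<longrightarrow> w \<in> ty E V n l p) (map d [0..<k]) ws"
    by (auto simp del: emb.simps simp: emb.simps(1))
  have tw: "ws ! j \<in> ty E V n l (P j)" if "j < k" for j
    using ws(4) t[OF that] that by (simp add: list_all2_conv_all_nth)
  have emn: "E (xs ! i) (xs ! j) \<Longrightarrow> E (zs ! i) (zs ! j)" if "emb E xs zs E" "i < j" "j < length xs" for xs zs i j
    using that
  proof (induction xs arbitrary: zs i j)
    case (Cons x xs)
    then obtain z zs' where zs: "zs = z # zs'" by (cases zs) auto
    obtain j' where j: "j = Suc j'" using Cons.prems by (cases j) auto
    show ?case
    proof (cases i)
      case 0 then show ?thesis using Cons.prems unfolding zs j by (auto simp: list_all2_conv_all_nth)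
    next
      case (Suc i') then show ?thesis using Cons.IH[where zs = zs' and i = i' and j = j'] Cons.prems unfolding zs j by auto
    qed
  qed simp
  have "chain E V k ((!) ws)" unfolding chain_def
  proof (intro conjI allI impI)
    show "ws ! i \<in> V" if "i < k" for i using ws(1,2) that by auto
    show "E (ws ! i) (ws ! j)" if "i < j" "j < k" for i j
      using emn[OF ws(3), of i j] chainD(2)[OF ld(2) that] that by simp
  qed
  then show ?thesis using tw by (intro exI[of _ "(!) ws"]) simp
qed

lemma ty_disjoint:
  assumes "asy E" "i < n" "p i \<noteq> q i" "x \<in> ty E V n l p"
  shows "x \<notin> ty E V n l q"
  using tyD(2,3)[OF assms(4,2)] tyD(2,3)[of x E V n l q, OF _ assms(2)] assms(3) asyD[OF assms(1)] by metis

lemma ty_colours: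
  assumes G: "good E V" and l: "chain E V n l" and v: "v \<in> ty E V n l q"
  shows "\<exists>x\<in>ty E V n l p. E v x" "\<exists>x\<in>ty E V n l p. E x v"
proof -
  have T: "htour E V" using G by (rule good_htour)
  obtain d where d: "chain E V 2 d" "\<forall>j<2. d j \<in> ty E V n l (if j = 0 then q else p)"
    using ty_chain[OF G l, of 2 "\<lambda>j. if j = (0::nat) then q else p"] by blast
  have d': "E (d 0) (d 1)" "d 0 \<in> ty E V n l q" "d 1 \<in> ty E V n l p"
    using chainD(2)[OF d(1), of 0 1] d(2)[rule_format, of 0] d(2)[rule_format, of 1] by simp_all
  have "\<exists>w\<in>ty E V n l p. emb E ([d 0] @ [d 1]) ([v] @ [w]) E"
    by (rule ty_move1[OF T l l]) (use d' v in auto)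
  then show "\<exists>x\<in>ty E V n l p. E v x" using d'(1) by auto
  obtain d where d: "chain E V 2 d" "\<forall>j<2. d j \<in> ty E V n l (if j = 0 then p else q)"
    using ty_chain[OF G l, of 2 "\<lambda>j. if j = (0::nat) then p else q"] by blast
  have d': "E (d 0) (d 1)" "d 0 \<in> ty E V n l p" "d 1 \<in> ty E V n l q"
    using chainD(2)[OF d(1), of 0 1] d(2)[rule_format, of 0] d(2)[rule_format, of 1] by simp_all
  have "\<exists>w\<in>ty E V n l p. emb E ([d 1] @ [d 0]) ([v] @ [w]) E"
    by (rule ty_move1[OF T l l]) (use d' v in auto)
  then show "\<exists>x\<in>ty E V n l p. E x v" using d'(1) by auto
qed

text \<open>\<open>coloured_words\<close> gives a chain of type \<open>p\<close> coloured by
  \<open>v\<close>, and homogeneity inside the type supplies \<open>a\<close> with arbitrary colours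
  on the same chain. The arc between \<open>a\<close> and \<open>v\<close> stays free; users choose
  \<open>u\<close> and \<open>w\<close> so that both directions help.\<close>

lemma ty_amalgam:
  assumes G: "good E V" and l: "chain E V n l" and pq: "i0 < n" "p i0 \<noteq> q i0"
  shows "\<exists>c a v. chain E (ty E V n l p) m c \<and> a \<in> ty E V n l p \<and> v \<in> ty E V n l q \<and> (E a v \<or> E v a) \<and>
    (\<forall>i<m. (E a (c i) \<longleftrightarrow> u i) \<and> (E (c i) a \<longleftrightarrow> \<not> u i) \<and> (E v (c i) \<longleftrightarrow> w i) \<and> (E (c i) v \<longleftrightarrow> \<not> w i))"
proof -
  have T: "htour E V" using G by (rule good_htour)
  note A = asyD[OF htour_asy[OF T]] and tot = htourD[OF T]
  let ?X = "ty E V n l p"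
  have GX: "good E ?X" by (rule ty_good[OF G l])
  have TX: "htour E ?X" using GX by (rule good_htour)
  obtain d where d: "\<forall>j<(1::nat). d j \<in> ty E V n l q" using ty_chain[OF G l, of 1 "\<lambda>_. q"] by blast
  define v where "v = d (0::nat)"
  have v: "v \<in> ty E V n l q" using d unfolding v_def by simp
  have vn: "x \<noteq> v" if "x \<in> ?X" for x using ty_disjoint[where p = p and q = q, OF htour_asy[OF T] pq that] v by metis
  have "\<exists>c. chain E (sector E V (l ` {i. i < n \<and> p i}) (l ` {i. i < n \<and> \<not> p i})) m c \<and> (\<forall>i<m. E v (c i) \<longleftrightarrow> w i)"
    by (rule coloured_words[OF T tyD(1)[OF v]])
      (use chainD(1)[OF l] vn GX ty_colours[OF G l v, of p] in \<open>auto simp: ty_sector[symmetric]\<close>)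
  then obtain c where c: "chain E ?X m c" "\<forall>i<m. E v (c i) \<longleftrightarrow> w i" unfolding ty_sector by blast
  obtain c' d where cd: "chain E ?X m c'" "chain E ?X 1 d"
    "\<forall>i<m. \<forall>j<1. (E (d j) (c' i) \<longleftrightarrow> u i) \<and> (E (c' i) (d j) \<longleftrightarrow> \<not> u i) \<and> c' i \<noteq> d j"
    using two_chains[OF GX, of m 1 "\<lambda>i j. u i"] by blast
  have d0: "d 0 \<in> ?X" using chainD(1)[OF cd(2)] by simp
  have "d 0 \<in> ty E ?X m c' u" by (rule tyI) (use d0 cd(3) in auto)
  from ty_move1[OF TX cd(1) c(1), of "[]" "[]", OF _ _ this] obtain a where a: "a \<in> ty E ?X m c u" by auto
  have aX: "a \<in> ?X" by (rule tyD(1)[OF a])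
  have "E a v \<or> E v a" using tot[OF tyD(1)[OF aX] tyD(1)[OF v] vn[OF aX]] .
  moreover have "(E a (c i) \<longleftrightarrow> u i) \<and> (E (c i) a \<longleftrightarrow> \<not> u i) \<and> (E v (c i) \<longleftrightarrow> w i) \<and> (E (c i) v \<longleftrightarrow> \<not> w i)" if "i < m" for i
  proof -
    have ci: "c i \<in> ?X" using chainD(1)[OF c(1) that] .
    have "E v (c i) \<or> E (c i) v" using tot[OF tyD(1)[OF ci] tyD(1)[OF v] vn[OF ci]] by blast
    then show ?thesis using c(2) that tyD(2,3)[OF a that] A by blast
  qed
  ultimately show ?thesis using c(1) aX v by blast
qed

section \<open>Dominated 3-cycles with prescribed types\<close>

definition cat :: "nat \<Rightarrow> (nat \<Rightarrow> bool) \<Rightarrow> (nat \<Rightarrow> bool) \<Rightarrow> nat \<Rightarrow> bool" where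
  "cat n p q i = (if i < n then p i else q (i - n))"

lemma ty_cat:
  assumes "x \<in> ty E V (n + m) l (cat n p q)"
  shows "x \<in> ty E V n l p" "x \<in> ty E V m (\<lambda>i. l (n + i)) q"
proof -
  have *: "if cat n p q i then E x (l i) else E (l i) x" if "i < n + m" for i
    using assms that unfolding ty_def by blast
  have x: "x \<in> V" by (rule tyD(1)[OF assms])
  have "if p i then E x (l i) else E (l i) x" if "i < n" for i using *[of i] that by (simp add: cat_def)
  then show "x \<in> ty E V n l p" using x unfolding ty_def by blast
  have "if q i then E x (l (n + i)) else E (l (n + i)) x" if "i < m" for i using *[of "n + i"] that by (simp add: cat_def)
  then show "x \<in> ty E V m (\<lambda>i. l (n + i)) q" using x unfolding ty_def by blast
qed

lemma chain_cat:
  assumes "chain E V (n + m) l"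
  shows "chain E V n l" "chain E V m (\<lambda>i. l (n + i))"
  using assms unfolding chain_def by auto

lemma ex_chain: "good E V \<Longrightarrow> \<exists>l. chain E V n l"
  using two_chains[of E V n 0] by blast

text \<open>Some chain of length \<open>n\<close> is as good as all, since chains are conjugate. The
  property passes to segments of the chain, so its failure for \<open>p\<close>, \<open>q\<close>
  persists for all prescriptions that contain them.\<close>

definition dominates_c3 where
  "dominates_c3 E V n p q \<longleftrightarrow> (\<exists>l v a b c. chain E V n l \<and> v \<in> ty E V n l q \<and> a \<in> ty E V n l p \<and> b \<in> ty E V n l p \<and>
     c \<in> ty E V n l p \<and> c3 E a b c \<and> E v a \<and> E v b \<and> E v c)"

definition dominated_c3 where
  "dominated_c3 E V n p q \<longleftrightarrow> (\<exists>l v a b c. chain E V n l \<and> v \<in> ty E V n l q \<and> a \<in> ty E V n l p \<and> b \<in> ty E V n l p \<and>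
     c \<in> ty E V n l p \<and> c3 E a b c \<and> E a v \<and> E b v \<and> E c v)"

lemma dominates_c3_cat:
  assumes "dominates_c3 E V (n + m) (cat n p p') (cat n q q')"
  shows "dominates_c3 E V n p q" "dominates_c3 E V m p' q'"
proof -
  obtain l v a b c where *: "chain E V (n + m) l" "v \<in> ty E V (n + m) l (cat n q q')" "a \<in> ty E V (n + m) l (cat n p p')"
    "b \<in> ty E V (n + m) l (cat n p p')" "c \<in> ty E V (n + m) l (cat n p p')" "c3 E a b c" "E v a" "E v b" "E v c"
    using assms unfolding dominates_c3_def by blast
  note ty_cat(1)[OF *(2)] ty_cat(1)[OF *(3)] ty_cat(1)[OF *(4)] ty_cat(1)[OF *(5)] chain_cat(1)[OF *(1)]
  then show "dominates_c3 E V n p q" unfolding dominates_c3_def using *(6-9) by blast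
  note ty_cat(2)[OF *(2)] ty_cat(2)[OF *(3)] ty_cat(2)[OF *(4)] ty_cat(2)[OF *(5)] chain_cat(2)[OF *(1)]
  then show "dominates_c3 E V m p' q'" unfolding dominates_c3_def using *(6-9) by blast
qed

lemma dominated_c3_cat:
  assumes "dominated_c3 E V (n + m) (cat n p p') (cat n q q')"
  shows "dominated_c3 E V m p' q'"
proof -
  obtain l v a b c where *: "chain E V (n + m) l" "v \<in> ty E V (n + m) l (cat n q q')" "a \<in> ty E V (n + m) l (cat n p p')"
    "b \<in> ty E V (n + m) l (cat n p p')" "c \<in> ty E V (n + m) l (cat n p p')" "c3 E a b c" "E a v" "E b v" "E c v"
    using assms unfolding dominated_c3_def by blast
  note ty_cat(2)[OF *(2)] ty_cat(2)[OF *(3)] ty_cat(2)[OF *(4)] ty_cat(2)[OF *(5)] chain_cat(2)[OF *(1)]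
  then show ?thesis unfolding dominated_c3_def using *(6-9) by blast
qed

text \<open>Over the concatenated chain \<open>a\<close> lies in the 3-cycles \<open>a c0 c1\<close>
  and \<open>a c2 c3\<close>, while \<open>v\<close> dominates \<open>c0\<close>, \<open>c1\<close>
  and is dominated by \<open>c2\<close>, \<open>c3\<close>. The arc \<open>v -> a\<close> would
  contradict \<open>no\<close> on the first segment, so \<open>a -> v\<close>, which settles the
  second.\<close>

lemma dominates_or_dominated:
  assumes G: "good E V" and pq: "i0 < n" "p i0 \<noteq> q i0" and no: "\<not> dominates_c3 E V n p q"
  shows "dominated_c3 E V n' p' q'"
proof -
  let ?N = "n + n'" and ?P = "cat n p p'" and ?Q = "cat n q q'"
  obtain l where l: "chain E V ?N l" using ex_chain[OF G] by blast
  have "i0 < ?N" "?P i0 \<noteq> ?Q i0" using pq by (simp_all add: cat_def)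
  from ty_amalgam[where p = ?P and q = ?Q, OF G l this, of 4 "\<lambda>i. i = 0 \<or> i = 2" "\<lambda>i. i < 2"] obtain c a v where
    c: "chain E (ty E V ?N l ?P) 4 c" "a \<in> ty E V ?N l ?P" "v \<in> ty E V ?N l ?Q" "E a v \<or> E v a"
    "\<forall>i<4. (E a (c i) \<longleftrightarrow> i = 0 \<or> i = 2) \<and> (E (c i) a \<longleftrightarrow> \<not> (i = 0 \<or> i = 2)) \<and> (E v (c i) \<longleftrightarrow> i < 2) \<and> (E (c i) v \<longleftrightarrow> \<not> i < 2)"
    by (elim exE conjE)
  have m: "c 0 \<in> ty E V ?N l ?P" "c 1 \<in> ty E V ?N l ?P" "c 2 \<in> ty E V ?N l ?P" "c 3 \<in> ty E V ?N l ?P"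
    and e: "E (c 0) (c 1)" "E (c 2) (c 3)"
    using chainD(1)[OF c(1)] chainD(2)[OF c(1), of 0 1] chainD(2)[OF c(1), of 2 3] by simp_all
  have f: "E a (c 0)" "E (c 1) a" "E a (c 2)" "E (c 3) a" "E v (c 0)" "E v (c 1)" "E (c 2) v" "E (c 3) v"
    using c(5)[rule_format, of 0] c(5)[rule_format, of 1] c(5)[rule_format, of 2] c(5)[rule_format, of 3] by simp_all
  have C: "c3 E a (c 0) (c 1)" "c3 E a (c 2) (c 3)" using e f unfolding c3_def by blast+
  have "\<not> E v a"
  proof
    assume "E v a"
    then have "dominates_c3 E V ?N ?P ?Q" unfolding dominates_c3_def using l c(2,3) m C f by blast
    then show False using dominates_c3_cat(1) no by blast
  qed
  then have "E a v" using c(4) by blast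
  then have "dominated_c3 E V ?N ?P ?Q" unfolding dominated_c3_def using l c(2,3) m C f by blast
  then show ?thesis by (rule dominated_c3_cat)
qed

text \<open>Both directions of the free arc of \<open>ty_amalgam\<close> serve: for
  \<open>a -> x\<close> take the 3-cycle \<open>a c0 c1\<close>, for \<open>x -> a\<close> the
  3-cycle \<open>c3 a c2\<close>.\<close>

lemma mixed_c3:
  assumes G: "good E V" and pq: "i0 < n" "p i0 \<noteq> q i0"
  shows "\<exists>l x v m1 m2. chain E V n l \<and> x \<in> ty E V n l p \<and> v \<in> ty E V n l q \<and> m1 \<in> ty E V n l q \<and>
     m2 \<in> ty E V n l q \<and> c3 E v m1 m2 \<and> E v x \<and> E x m1 \<and> E x m2"
proof -
  obtain l where l: "chain E V n l" using ex_chain[OF G] by blast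
  from ty_amalgam[where p = q and q = p, OF G l pq(1) pq(2)[symmetric], of 4 "\<lambda>i. i = 0 \<or> i = 2" "\<lambda>i. i < 3"] obtain c a x where
    c: "chain E (ty E V n l q) 4 c" "a \<in> ty E V n l q" "x \<in> ty E V n l p" "E a x \<or> E x a"
    "\<forall>i<4. (E a (c i) \<longleftrightarrow> i = 0 \<or> i = 2) \<and> (E (c i) a \<longleftrightarrow> \<not> (i = 0 \<or> i = 2)) \<and> (E x (c i) \<longleftrightarrow> i < 3) \<and> (E (c i) x \<longleftrightarrow> \<not> i < 3)"
    by (elim exE conjE)
  have m: "c 0 \<in> ty E V n l q" "c 1 \<in> ty E V n l q" "c 2 \<in> ty E V n l q" "c 3 \<in> ty E V n l q"
    and e: "E (c 0) (c 1)" "E (c 2) (c 3)"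
    using chainD(1)[OF c(1)] chainD(2)[OF c(1), of 0 1] chainD(2)[OF c(1), of 2 3] by simp_all
  have f: "E a (c 0)" "E (c 1) a" "E a (c 2)" "E (c 3) a" "E x (c 0)" "E x (c 1)" "E x (c 2)" "E (c 3) x"
    using c(5)[rule_format, of 0] c(5)[rule_format, of 1] c(5)[rule_format, of 2] c(5)[rule_format, of 3] by simp_all
  have C: "c3 E a (c 0) (c 1)" "c3 E (c 3) a (c 2)" using e f unfolding c3_def by blast+
  from c(4) show ?thesis
  proof
    assume "E a x" then show ?thesis using l c(2,3) m C f by blast
  next
    assume "E x a" then show ?thesis using l c(2,3) m C f by blast
  qed
qed

text \<open>On two segments with the types \<open>(p, q)\<close> and \<open>(q, p)\<close> the
  failure becomes symmetric: no vertex of either type dominates a 3-cycle of the other. Two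
  configurations are glued along \<open>l1 l2 m1 m2\<close>. Then \<open>a -> v\<close> makes
  \<open>a\<close> dominate the 3-cycle \<open>v m1 m2\<close>, and \<open>v -> a\<close> makes
  \<open>v\<close> dominate \<open>a l1 l2\<close>; both are excluded.\<close>

lemma all_dominates_c3:
  assumes G: "good E V" and pq: "i0 < n" "p i0 \<noteq> q i0"
  shows "dominates_c3 E V n p q"
proof (rule ccontr)
  assume no: "\<not> dominates_c3 E V n p q"
  have T: "htour E V" using G by (rule good_htour)
  note A = asyD[OF htour_asy[OF T]] and tot = htourD[OF T] and I = asy_irrefl[OF htour_asy[OF T]]
  let ?N = "n + n" and ?P = "cat n p q" and ?Q = "cat n q p"
  let ?T = "ty E V ?N"
  have no1: "\<not> dominates_c3 E V ?N ?P ?Q" "\<not> dominates_c3 E V ?N ?Q ?P"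
    using dominates_c3_cat no by blast+
  \<comment> \<open>One further chain element, with opposite prescriptions, tells apart two vertices
    that are obtained separately.\<close>
  let ?M = "?N + 1"
  have z: "i0 < ?M" "cat ?N ?P (\<lambda>_. r) i0 \<noteq> cat ?N ?Q (\<lambda>_. s) i0" for r s using pq by (simp_all add: cat_def)
  have bit: "if r then E x (l ?N) else E (l ?N) x" if "x \<in> ty E V ?M l (cat ?N p' (\<lambda>_. r))" for x l p' r
    using tyD(2,3)[OF that, of ?N] by (simp add: cat_def)
  have c3d: "a \<noteq> b" "b \<noteq> c" "a \<noteq> c" "E a b" "E b c" "\<not> E a c" if "c3 E a b c" for a b c
    using that A I unfolding c3_def by blast+
  obtain l a l1 l2 m1 m2 where s1: "chain E V ?N l" "a \<in> ?T l ?P" "l1 \<in> ?T l ?P" "l2 \<in> ?T l ?P" "c3 E a l1 l2"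
    "m1 \<in> ?T l ?Q" "m2 \<in> ?T l ?Q" "E m1 m2" "E a m1" "E l1 m1" "E l2 m1" "E a m2" "E l1 m2" "E l2 m2"
  proof -
    note R = dominates_or_dominated[where p = p and q = q, OF G pq no, of ?M, unfolded dominated_c3_def]
    obtain l v a b c where *: "chain E V ?M l" "v \<in> ty E V ?M l (cat ?N ?Q (\<lambda>_. False))"
      "a \<in> ty E V ?M l (cat ?N ?P (\<lambda>_. False))" "b \<in> ty E V ?M l (cat ?N ?P (\<lambda>_. False))"
      "c \<in> ty E V ?M l (cat ?N ?P (\<lambda>_. False))" "c3 E a b c" "E a v" "E b v" "E c v"
      using R[of "cat ?N ?Q (\<lambda>_. False)" "cat ?N ?P (\<lambda>_. False)"] by blast
    obtain l' v' a' b' c' where **: "chain E V ?M l'" "v' \<in> ty E V ?M l' (cat ?N ?Q (\<lambda>_. True))"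
      "a' \<in> ty E V ?M l' (cat ?N ?P (\<lambda>_. False))" "b' \<in> ty E V ?M l' (cat ?N ?P (\<lambda>_. False))"
      "c' \<in> ty E V ?M l' (cat ?N ?P (\<lambda>_. False))" "c3 E a' b' c'" "E a' v'" "E b' v'" "E c' v'"
      using R[of "cat ?N ?Q (\<lambda>_. True)" "cat ?N ?P (\<lambda>_. False)"] by blast
    have "\<exists>w\<in>ty E V ?M l (cat ?N ?Q (\<lambda>_. True)). emb E ([a', b', c'] @ [v']) ([a, b, c] @ [w]) E"
    proof (rule ty_move1[OF T **(1) *(1)])
      show "embw E [a', b', c'] [a, b, c]" using c3d[OF *(6)] c3d[OF **(6)] by simp
    qed (use * ** in auto)
    then obtain w where w: "w \<in> ty E V ?M l (cat ?N ?Q (\<lambda>_. True))" "emb E ([a', b', c'] @ [v']) ([a, b, c] @ [w]) E" by blast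
    have e: "E a w" "E b w" "E c w" using w(2) ** by simp_all
    have "E w (l ?N)" "E (l ?N) v" using bit[OF w(1)] bit[OF *(2)] by simp_all
    then have "w \<noteq> v" using A by blast
    then consider "E v w" | "E w v" using tot[OF tyD(1)[OF w(1)] tyD(1)[OF *(2)]] by blast
    then show thesis
    proof cases
      case 1
      then show thesis by (intro that[of l a b c v w]) (use chain_cat(1)[OF *(1)] ty_cat(1)[OF *(2)] ty_cat(1)[OF *(3)] ty_cat(1)[OF *(4)] ty_cat(1)[OF *(5)] ty_cat(1)[OF w(1)] *(6-9) e in \<open>simp_all only:\<close>)
    next
      case 2
      then show thesis by (intro that[of l a b c w v]) (use chain_cat(1)[OF *(1)] ty_cat(1)[OF *(2)] ty_cat(1)[OF *(3)] ty_cat(1)[OF *(4)] ty_cat(1)[OF *(5)] ty_cat(1)[OF w(1)] *(6-9) e in \<open>simp_all only:\<close>)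
    qed
  qed
  obtain l' v' l1' l2' m1' m2' where s2: "chain E V ?N l'" "v' \<in> ?T l' ?Q" "m1' \<in> ?T l' ?Q" "m2' \<in> ?T l' ?Q" "c3 E v' m1' m2'"
    "l1' \<in> ?T l' ?P" "l2' \<in> ?T l' ?P" "E l1' l2'" "E v' l1'" "E v' l2'" "E l1' m1'" "E l1' m2'" "E l2' m1'" "E l2' m2'"
  proof -
    obtain l x v m1 m2 where *: "chain E V ?M l" "x \<in> ty E V ?M l (cat ?N ?P (\<lambda>_. False))"
      "v \<in> ty E V ?M l (cat ?N ?Q (\<lambda>_. False))" "m1 \<in> ty E V ?M l (cat ?N ?Q (\<lambda>_. False))"
      "m2 \<in> ty E V ?M l (cat ?N ?Q (\<lambda>_. False))" "c3 E v m1 m2" "E v x" "E x m1" "E x m2"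
      using mixed_c3[where p = "cat ?N ?P (\<lambda>_. False)" and q = "cat ?N ?Q (\<lambda>_. False)", OF G z] by blast
    obtain l' x' v' m1' m2' where **: "chain E V ?M l'" "x' \<in> ty E V ?M l' (cat ?N ?P (\<lambda>_. True))"
      "v' \<in> ty E V ?M l' (cat ?N ?Q (\<lambda>_. False))" "m1' \<in> ty E V ?M l' (cat ?N ?Q (\<lambda>_. False))"
      "m2' \<in> ty E V ?M l' (cat ?N ?Q (\<lambda>_. False))" "c3 E v' m1' m2'" "E v' x'" "E x' m1'" "E x' m2'"
      using mixed_c3[where p = "cat ?N ?P (\<lambda>_. True)" and q = "cat ?N ?Q (\<lambda>_. False)", OF G z] by blast
    have "\<exists>w\<in>ty E V ?M l (cat ?N ?P (\<lambda>_. True)). emb E ([v', m1', m2'] @ [x']) ([v, m1, m2] @ [w]) E"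
    proof (rule ty_move1[OF T **(1) *(1)])
      show "embw E [v', m1', m2'] [v, m1, m2]" using c3d[OF *(6)] c3d[OF **(6)] by simp
    qed (use * ** in auto)
    then obtain w where w: "w \<in> ty E V ?M l (cat ?N ?P (\<lambda>_. True))" "emb E ([v', m1', m2'] @ [x']) ([v, m1, m2] @ [w]) E" by blast
    have e: "E v w" "E w m1" "E w m2" using w(2) ** by simp_all
    have "E w (l ?N)" "E (l ?N) x" using bit[OF w(1)] bit[OF *(2)] by simp_all
    then have "w \<noteq> x" using A by blast
    then consider "E x w" | "E w x" using tot[OF tyD(1)[OF w(1)] tyD(1)[OF *(2)]] by blast
    then show thesis
    proof cases
      case 1
      then show thesis by (intro that[of l v m1 m2 x w]) (use chain_cat(1)[OF *(1)] ty_cat(1)[OF *(2)] ty_cat(1)[OF *(3)] ty_cat(1)[OF *(4)] ty_cat(1)[OF *(5)] ty_cat(1)[OF w(1)] *(6-9) e in \<open>simp_all only:\<close>)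
    next
      case 2
      then show thesis by (intro that[of l v m1 m2 w x]) (use chain_cat(1)[OF *(1)] ty_cat(1)[OF *(2)] ty_cat(1)[OF *(3)] ty_cat(1)[OF *(4)] ty_cat(1)[OF *(5)] ty_cat(1)[OF w(1)] *(6-9) e in \<open>simp_all only:\<close>)
    qed
  qed
  have "\<exists>w\<in>?T l ?Q. emb E ([l1', l2', m1', m2'] @ [v']) ([l1, l2, m1, m2] @ [w]) E"
  proof (rule ty_move1[OF T s2(1) s1(1)])
    have "E l1 l2" "E m1' m2'" using s1(5) s2(5) unfolding c3_def by blast+
    moreover have "x \<noteq> y" if "E x y" for x y using that I by blast
    ultimately show "embw E [l1', l2', m1', m2'] [l1, l2, m1, m2]" using s1 s2 by simp
  qed (use s1 s2 in auto)
  then obtain v where v: "v \<in> ?T l ?Q" "emb E ([l1', l2', m1', m2'] @ [v']) ([l1, l2, m1, m2] @ [v]) E" by blast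
  have ve: "E v l1" "E v l2" "E v m1" "E m2 v" using v(2) s2 unfolding c3_def by simp_all
  have "a \<noteq> v" using ve(2) s1(5) A unfolding c3_def by blast
  then consider "E a v" | "E v a" using tot[OF tyD(1)[OF s1(2)] tyD(1)[OF v(1)]] by blast
  then show False
  proof cases
    case 1
    have "c3 E v m1 m2" using ve s1 unfolding c3_def by blast
    then have "dominates_c3 E V ?N ?Q ?P" unfolding dominates_c3_def using s1 v(1) 1 by blast
    then show False using no1 by blast
  next
    case 2
    then have "dominates_c3 E V ?N ?P ?Q" unfolding dominates_c3_def using s1 v(1) ve by blast
    then show False using no1 by blast
  qed
qed

definition differ :: "nat \<Rightarrow> (nat \<Rightarrow> bool) \<Rightarrow> (nat \<Rightarrow> bool) \<Rightarrow> bool" where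
  "differ n p q \<longleftrightarrow> (\<exists>i<n. p i \<noteq> q i)"

lemma differ_cat: "differ n p q \<Longrightarrow> differ (n + m) (cat n p p') (cat n q q')"
  unfolding differ_def cat_def by (metis trans_less_add1)

lemma differ_ty: "asy E \<Longrightarrow> differ n p q \<Longrightarrow> x \<in> ty E V n l p \<Longrightarrow> x \<notin> ty E V n l q"
  unfolding differ_def using ty_disjoint by metis

lemma all_dominates_c3':
  "good E V \<Longrightarrow> differ n p q \<Longrightarrow> dominates_c3 E V n p q"
  unfolding differ_def using all_dominates_c3 by metis

text \<open>The out-neighbours of \<open>i\<close> of type \<open>p3\<close> contain a 3-cycle and
  form a homogeneous tournament, so \<open>mixed_arcs\<close> applies to them once \<open>b\<close>
  has arcs in both directions.\<close>

lemma c3_two_types: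
  assumes G: "good E V" and d: "differ n p3 p0" "differ n p2 p3"
  shows "\<exists>l i b c c2. chain E V n l \<and> i \<in> ty E V n l p0 \<and> b \<in> ty E V n l p2 \<and> c \<in> ty E V n l p3 \<and> c2 \<in> ty E V n l p3 \<and>
     E i b \<and> E i c \<and> E i c2 \<and> E c c2 \<and> E c2 b \<and> E b c"
proof -
  have T: "htour E V" using G by (rule good_htour)
  note A = asyD[OF htour_asy[OF T]] and tot = htourD[OF T] and I = asy_irrefl[OF htour_asy[OF T]]
  obtain l i x y z where l: "chain E V n l" and xyz: "i \<in> ty E V n l p0" "x \<in> ty E V n l p3" "y \<in> ty E V n l p3"
     "z \<in> ty E V n l p3" "c3 E x y z" "E i x" "E i y" "E i z"
    using all_dominates_c3'[OF G d(1)] unfolding dominates_c3_def by blast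
  have ex: "\<exists>u\<in>ty E V n l q. \<exists>v\<in>ty E V n l r. E i u \<and> E i v \<and> E u v" for q r
  proof -
    obtain d where d: "chain E V 3 d" "\<forall>j<3. d j \<in> ty E V n l (if j = 0 then p0 else if j = 1 then q else r)"
      using ty_chain[OF G l, of 3 "\<lambda>j. if j = (0::nat) then p0 else if j = 1 then q else r"] by blast
    have d': "E (d 0) (d 1)" "E (d 0) (d 2)" "E (d 1) (d 2)" "d 0 \<in> ty E V n l p0" "d 1 \<in> ty E V n l q" "d 2 \<in> ty E V n l r"
      using chainD(2)[OF d(1), of 0 1] chainD(2)[OF d(1), of 0 2] chainD(2)[OF d(1), of 1 2]
        d(2)[rule_format, of 0] d(2)[rule_format, of 1] d(2)[rule_format, of 2] by simp_all
    have "\<exists>w\<in>ty E V n l q. \<exists>w'\<in>ty E V n l r. emb E ([d 0] @ [d 1, d 2]) ([i] @ [w, w']) E"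
      by (rule ty_move2[OF T l l]) (use d' xyz in auto)
    then obtain w w' where w: "w \<in> ty E V n l q" "w' \<in> ty E V n l r" "emb E ([d 0] @ [d 1, d 2]) ([i] @ [w, w']) E" by blast
    then have "E i w" "E i w'" "E w w'" using d' by simp_all
    then show ?thesis using w by blast
  qed
  obtain b v where b: "b \<in> ty E V n l p2" "v \<in> ty E V n l p3" "E i b" "E i v" "E b v" using ex by blast
  obtain v' b' where b': "v' \<in> ty E V n l p3" "b' \<in> ty E V n l p2" "E i v'" "E i b'" "E v' b'" using ex by blast
  have "\<exists>w\<in>ty E V n l p3. emb E ([i, b'] @ [v']) ([i, b] @ [w]) E"
  proof (rule ty_move1[OF T l l])
    show "embw E [i, b'] [i, b]" using b b' I by auto
  qed (use b b' xyz in auto)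
  then obtain w where w: "w \<in> ty E V n l p3" "emb E ([i, b'] @ [v']) ([i, b] @ [w]) E" by blast
  have we: "E i w" "E w b" using w(2) b' by simp_all
  let ?M = "sector E V (l ` {j. j < n \<and> p3 j}) (insert i (l ` {j. j < n \<and> \<not> p3 j}))"
  have M: "u \<in> ?M \<longleftrightarrow> u \<in> ty E V n l p3 \<and> E i u" for u unfolding ty_sector unfolding sector_def by blast
  have TM: "htour E ?M" by (rule htour_sector[OF T]) (use chainD(1)[OF l] tyD(1)[OF xyz(1)] in auto)
  have nb: "E b u \<or> E u b" if "u \<in> ?M" for u
  proof -
    have u: "u \<in> ty E V n l p3" using that M by blast
    then have "u \<noteq> b" using differ_ty[OF htour_asy[OF T] d(2) b(1)] by blast
    then show ?thesis using tot[OF tyD(1)[OF u] tyD(1)[OF b(1)]] by blast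
  qed
  have xM: "x \<in> ?M" "y \<in> ?M" "z \<in> ?M" "v \<in> ?M" "w \<in> ?M" using M xyz b w we by blast+
  obtain c c2 where "c \<in> ?M" "c2 \<in> ?M" "E c c2" "E b c" "E c2 b"
    using mixed_arcs(1)[OF TM xM(1-3) xyz(5) nb xM(4) b(5) xM(5) we(2)] by blast
  then show ?thesis using l xyz(1) b M by blast
qed

text \<open>On a second segment \<open>p1\<close> and \<open>p2\<close> are swapped. With
  \<open>c -> a -> c2\<close> and \<open>c2 -> b -> c\<close>, the arc \<open>a -> b\<close> closes
  the 3-cycle \<open>a b c\<close> with the right types on the first segment, and
  \<open>b -> a\<close> closes \<open>b a c2\<close> with the right types on the second.\<close>

lemma c3_four_types_distinct:
  assumes G: "good E V" and d: "differ n p3 p0" "differ n p1 p3" "differ n p2 p3" "differ n p1 p2"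
  shows "\<exists>l i a b c. chain E V n l \<and> i \<in> ty E V n l p0 \<and> a \<in> ty E V n l p1 \<and> b \<in> ty E V n l p2 \<and> c \<in> ty E V n l p3 \<and>
     c3 E a b c \<and> E i a \<and> E i b \<and> E i c"
proof (rule ccontr)
  assume no: "\<not> ?thesis"
  have T: "htour E V" using G by (rule good_htour)
  note A = asyD[OF htour_asy[OF T]] and tot = htourD[OF T] and I = asy_irrefl[OF htour_asy[OF T]]
  let ?N = "n + n"
  let ?P0 = "cat n p0 p0" and ?P1 = "cat n p1 p2" and ?P2 = "cat n p2 p1" and ?P3 = "cat n p3 p3"
  obtain l i b c c2 where s: "chain E V ?N l" "i \<in> ty E V ?N l ?P0" "b \<in> ty E V ?N l ?P2" "c \<in> ty E V ?N l ?P3"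
    "c2 \<in> ty E V ?N l ?P3" "E i b" "E i c" "E i c2" "E c c2" "E c2 b" "E b c"
    using c3_two_types[OF G differ_cat[OF d(1), where m = n and p' = p3 and q' = p0]
        differ_cat[OF d(3), where m = n and p' = p1 and q' = p3]] by blast
  obtain e where e: "chain E V 4 e" "\<forall>j<4. e j \<in> ty E V ?N l (if j = 0 then ?P0 else if j = 2 then ?P1 else ?P3)"
    using ty_chain[OF G s(1), of 4 "\<lambda>j. if j = (0::nat) then ?P0 else if j = 2 then ?P1 else ?P3"] by blast
  have e': "E (e 0) (e 1)" "E (e 0) (e 2)" "E (e 0) (e 3)" "E (e 1) (e 2)" "E (e 1) (e 3)" "E (e 2) (e 3)"
     "e 0 \<in> ty E V ?N l ?P0" "e 1 \<in> ty E V ?N l ?P3" "e 2 \<in> ty E V ?N l ?P1" "e 3 \<in> ty E V ?N l ?P3"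
    using chainD(2)[OF e(1)] e(2)[rule_format, of 0] e(2)[rule_format, of 1] e(2)[rule_format, of 2] e(2)[rule_format, of 3] by simp_all
  have "\<exists>a\<in>ty E V ?N l ?P1. emb E ([e 0, e 1, e 3] @ [e 2]) ([i, c, c2] @ [a]) E"
  proof (rule ty_move1[OF T s(1) s(1)])
    have "x \<noteq> y" if "E x y" for x y using that I by blast
    then show "embw E [e 0, e 1, e 3] [i, c, c2]" using s e' by simp
  qed (use s e' in auto)
  then obtain a where a: "a \<in> ty E V ?N l ?P1" "emb E ([e 0, e 1, e 3] @ [e 2]) ([i, c, c2] @ [a]) E" by blast
  have ae: "E i a" "E c a" "E a c2" using a(2) e' by simp_all
  have "a \<noteq> b" using ae s A by blast
  then consider "E a b" | "E b a" using tot[OF tyD(1)[OF a(1)] tyD(1)[OF s(3)]] by blast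
  then show False
  proof cases
    case 1
    then have "c3 E a b c" using ae s unfolding c3_def by blast
    then show False using no chain_cat(1)[OF s(1)] ty_cat(1)[OF s(2)] ty_cat(1)[OF s(3)] ty_cat(1)[OF s(4)] ty_cat(1)[OF a(1)] s ae by blast
  next
    case 2
    then have "c3 E b a c2" using ae s unfolding c3_def by blast
    then show False using no chain_cat(2)[OF s(1)] ty_cat(2)[OF s(2)] ty_cat(2)[OF s(3)] ty_cat(2)[OF s(5)] ty_cat(2)[OF a(1)] s ae by blast
  qed
qed

text \<open>Four additional chain elements make the types pairwise distinct: type \<open>k\<close>
  is marked by an arc to additional element \<open>k\<close> only. Dropping these elements
  afterwards restores the given types.\<close>

lemma c3_four_types:
  assumes G: "good E V"
  shows "\<exists>l i a b c. chain E V n l \<and> i \<in> ty E V n l p0 \<and> a \<in> ty E V n l p1 \<and> b \<in> ty E V n l p2 \<and> c \<in> ty E V n l p3 \<and>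
     c3 E a b c \<and> E i a \<and> E i b \<and> E i c"
proof -
  let ?q = "\<lambda>p k. cat n p (\<lambda>j. j = (k::nat))"
  have d: "differ (n + 4) (?q p j) (?q p' k)" if "j \<noteq> k" "j < 4" for p p' j k
    unfolding differ_def using that by (intro exI[of _ "n + j"]) (simp add: cat_def)
  have dd: "differ (n + 4) (?q p3 3) (?q p0 0)" "differ (n + 4) (?q p1 1) (?q p3 3)"
    "differ (n + 4) (?q p2 2) (?q p3 3)" "differ (n + 4) (?q p1 1) (?q p2 2)" by (rule d; simp)+
  obtain l i a b c where s: "chain E V (n + 4) l" "i \<in> ty E V (n + 4) l (?q p0 0)" "a \<in> ty E V (n + 4) l (?q p1 1)"
    "b \<in> ty E V (n + 4) l (?q p2 2)" "c \<in> ty E V (n + 4) l (?q p3 3)" "c3 E a b c" "E i a" "E i b" "E i c"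
    using c3_four_types_distinct[OF G dd] by (elim exE conjE)
  show ?thesis using chain_cat(1)[OF s(1)] ty_cat(1)[OF s(2)] ty_cat(1)[OF s(3)] ty_cat(1)[OF s(4)] ty_cat(1)[OF s(5)] s(6-9) by blast
qed

section \<open>The amalgamation class of Lachlan\<close>

text \<open>The tournament \<open>(F, R)\<close> has to be realised over some chain of length \<open>n\<close>, not over every one:
  chains of the same length are conjugate by homogeneity.\<close>

definition plus :: "('a \<Rightarrow> 'a \<Rightarrow> bool) \<Rightarrow> 'a set \<Rightarrow> 'b set \<Rightarrow> ('b \<Rightarrow> 'b \<Rightarrow> bool) \<Rightarrow> bool" where
  "plus E V F R \<longleftrightarrow> finite F \<and> tour R F \<and> (\<forall>n p. \<exists>l g. chain E V n l \<and>
     (\<forall>x\<in>F. g x \<in> ty E V n l (p x)) \<and> (\<forall>x\<in>F. \<forall>y\<in>F. R x y \<longleftrightarrow> E (g x) (g y)))"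

text \<open>Allows the finitely many failures in \<open>plus_amalgamation\<close> to be tested on a
  single chain.\<close>

lemma finite_concat:
  fixes n :: "'s \<Rightarrow> nat" and p :: "'s \<Rightarrow> 'b \<Rightarrow> nat \<Rightarrow> bool"
  assumes "finite S"
  shows "\<exists>N P. \<forall>s\<in>S. \<exists>k. k + n s \<le> N \<and> (\<forall>x. \<forall>i<n s. P x (k + i) = p s x i)"
  using assms
proof (induction S rule: finite_induct)
  case (insert s S)
  then obtain N P where NP: "\<forall>s\<in>S. \<exists>k. k + n s \<le> N \<and> (\<forall>x. \<forall>i<n s. P x (k + i) = p s x i)" by blast
  show ?case
  proof (rule exI[of _ "N + n s"], rule exI[of _ "\<lambda>x. cat N (P x) (p s x)"], rule ballI)
    fix s' assume "s' \<in> insert s S"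
    then show "\<exists>k. k + n s' \<le> N + n s \<and> (\<forall>x. \<forall>i<n s'. cat N (P x) (p s x) (k + i) = p s' x i)"
    proof
      assume "s' = s" then show ?thesis by (intro exI[of _ N]) (simp add: cat_def)
    next
      assume "s' \<in> S"
      then obtain k where "k + n s' \<le> N" "\<forall>x. \<forall>i<n s'. P x (k + i) = p s' x i" using NP by blast
      then show ?thesis by (intro exI[of _ k]) (simp add: cat_def)
    qed
  qed
qed simp

lemma ty_shift:
  assumes "x \<in> ty E V N l P" "k + n \<le> N" "\<forall>i<n. P (k + i) = p i"
  shows "x \<in> ty E V n (\<lambda>i. l (k + i)) p"
proof (rule tyI)
  show "x \<in> V" by (rule tyD(1)[OF assms(1)])
  fix i assume i: "i < n"
  show "p i \<Longrightarrow> E x (l (k + i))" "\<not> p i \<Longrightarrow> E (l (k + i)) x"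
    using tyD(2,3)[OF assms(1), of "k + i"] assms(2,3) i by auto
qed

lemma chain_shift: "chain E V N l \<Longrightarrow> k + n \<le> N \<Longrightarrow> chain E V n (\<lambda>i. l (k + i))"
  unfolding chain_def by auto

text \<open>If every amalgam failed, each would fail for some length and prescription. All these are
  concatenated, \<open>F\<close> and \<open>insert w A\<close> are realised over chains of that
  total length, and homogeneity makes the chains and the copies of \<open>A\<close> agree. The
  resulting vertex \<open>v\<close> determines an amalgam that is realised on its own segment. The
  hypothesis \<open>no\<close> keeps \<open>v\<close> off the copy of \<open>F\<close>.\<close>

lemma plus_amalgamation:
  fixes R1 :: "'b \<Rightarrow> 'b \<Rightarrow> bool"
  assumes T: "htour E V" and F: "plus E V F R" and AF: "A \<subseteq> F" and w: "w \<notin> F"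
    and A: "plus E V (insert w A) R1" and same: "\<And>x y. x \<in> A \<Longrightarrow> y \<in> A \<Longrightarrow> R1 x y \<longleftrightarrow> R x y"
    and no: "\<And>f. f \<in> F \<Longrightarrow> \<exists>x\<in>A. R f x \<noteq> R1 w x \<or> R x f \<noteq> R1 x w"
  shows "\<exists>s\<subseteq>F. (\<forall>x\<in>A. x \<in> s \<longleftrightarrow> R1 w x) \<and>
    plus E V (insert w F) (\<lambda>x y. if x = w then y \<in> s else if y = w then x \<in> F - s else x \<in> F \<and> y \<in> F \<and> R x y)"
proof (rule ccontr)
  assume neg: "\<not> ?thesis"
  note As = asyD[OF htour_asy[OF T]] and I = asy_irrefl[OF htour_asy[OF T]] and tot = htourD[OF T]
  let ?R = "\<lambda>s x y. if x = w then y \<in> s else if y = w then x \<in> F - s else x \<in> F \<and> y \<in> F \<and> R x y"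
  have fF: "finite F" and tF: "tour R F" and tA: "tour R1 (insert w A)" using F A unfolding plus_def by blast+
  have rF: "\<And>n p. \<exists>l g. chain E V n l \<and> (\<forall>x\<in>F. g x \<in> ty E V n l (p x)) \<and> (\<forall>x\<in>F. \<forall>y\<in>F. R x y \<longleftrightarrow> E (g x) (g y))"
    using F unfolding plus_def by blast
  have rA: "\<And>n p. \<exists>l g. chain E V n l \<and> (\<forall>x\<in>insert w A. g x \<in> ty E V n l (p x)) \<and>
     (\<forall>x\<in>insert w A. \<forall>y\<in>insert w A. R1 x y \<longleftrightarrow> E (g x) (g y))"
    using A unfolding plus_def by blast
  have RI: "\<not> R x x" "R x y \<Longrightarrow> \<not> R y x" for x y using asy_irrefl[OF tour_asy[OF tF]] asyD[OF tour_asy[OF tF]] by blast+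
  have tR: "tour (?R s) (insert w F)" if "s \<subseteq> F" for s
    unfolding tour_def asy_def using that w RI tourD[OF tF] by auto
  define SS where "SS = {s. s \<subseteq> F \<and> (\<forall>x\<in>A. x \<in> s \<longleftrightarrow> R1 w x)}"
  have fS: "finite SS" unfolding SS_def using fF by auto
  have "\<exists>n p. \<not> (\<exists>l g. chain E V n l \<and> (\<forall>x\<in>insert w F. g x \<in> ty E V n l (p x)) \<and>
     (\<forall>x\<in>insert w F. \<forall>y\<in>insert w F. ?R s x y \<longleftrightarrow> E (g x) (g y)))" if "s \<in> SS" for s
  proof -
    have "\<not> plus E V (insert w F) (?R s)" using neg that unfolding SS_def by blast
    then show ?thesis unfolding plus_def using tR[of s] that fF unfolding SS_def by blast
  qed
  then obtain n p where np: "\<And>s. s \<in> SS \<Longrightarrow> \<not> (\<exists>l g. chain E V (n s) l \<and> (\<forall>x\<in>insert w F. g x \<in> ty E V (n s) l (p s x)) \<and>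
     (\<forall>x\<in>insert w F. \<forall>y\<in>insert w F. ?R s x y \<longleftrightarrow> E (g x) (g y)))" by metis
  obtain N P where NP: "\<And>s. s \<in> SS \<Longrightarrow> \<exists>k. k + n s \<le> N \<and> (\<forall>x. \<forall>i<n s. P x (k + i) = p s x i)"
    using finite_concat[OF fS, of n p] by blast
  obtain l g where g: "chain E V N l" "\<And>x. x \<in> F \<Longrightarrow> g x \<in> ty E V N l (P x)" "\<And>x y. x \<in> F \<Longrightarrow> y \<in> F \<Longrightarrow> R x y \<longleftrightarrow> E (g x) (g y)"
    using rF[of N P] by blast
  obtain l' h where h: "chain E V N l'" "\<And>x. x \<in> insert w A \<Longrightarrow> h x \<in> ty E V N l' (P x)"
    "\<And>x y. x \<in> insert w A \<Longrightarrow> y \<in> insert w A \<Longrightarrow> R1 x y \<longleftrightarrow> E (h x) (h y)"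
    using rA[of N P] by blast
  have ginj: "g x \<noteq> g y" if "x \<in> F" "y \<in> F" "x \<noteq> y" for x y using tourD[OF tF that] g(3) that I by metis
  have hinj: "h x \<noteq> h y" if "x \<in> insert w A" "y \<in> insert w A" "x \<noteq> y" for x y using tourD[OF tA that] h(3) that I by metis
  define S where "S = (\<lambda>x. (h x, g x)) ` A"
  have S: "phom E V S" unfolding S_def
  proof (rule phomI)
    show "finite ((\<lambda>x. (h x, g x)) ` A)" using fF AF finite_subset by blast
    fix x x' assume x: "(x, x') \<in> (\<lambda>x. (h x, g x)) ` A"
    then obtain a where a: "a \<in> A" "x = h a" "x' = g a" by blast
    show "x \<in> V \<and> x' \<in> V" using a tyD(1)[OF h(2)] tyD(1)[OF g(2)] AF by blast
    fix y y' assume y: "(y, y') \<in> (\<lambda>x. (h x, g x)) ` A"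
    then obtain b where b: "b \<in> A" "y = h b" "y' = g b" by blast
    show "x' = y'" if "x = y" using that a b hinj[of a b] by blast
    show "E x' y'" if "E x y" using that a b h(3)[of a b] g(3)[of a b] same[of a b] AF by blast
  qed
  have cr: "\<forall>q\<in>S. \<forall>i<N. fst q \<noteq> l' i \<and> (E (fst q) (l' i) \<longrightarrow> E (snd q) (l i)) \<and> (E (l' i) (fst q) \<longrightarrow> E (l i) (snd q))"
  proof (intro ballI allI impI)
    fix q i assume "q \<in> S" and i: "i < N"
    then obtain a where a: "a \<in> A" "q = (h a, g a)" unfolding S_def by blast
    have m: "h a \<in> ty E V N l' (P a)" "g a \<in> ty E V N l (P a)" using a h(2) g(2) AF by blast+
    show "fst q \<noteq> l' i \<and> (E (fst q) (l' i) \<longrightarrow> E (snd q) (l i)) \<and> (E (l' i) (fst q) \<longrightarrow> E (l i) (snd q))"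
      using tyD(2,3)[OF m(1) i] tyD(2,3)[OF m(2) i] As I unfolding a(2) by (cases "P a i") (metis fst_conv snd_conv)+
  qed
  have hw: "h w \<in> ty E V N l' (P w)" using h(2) by blast
  have "finite {h w}" "{h w} \<subseteq> V" using tyD(1)[OF hw] by simp_all
  from chain_move[OF T h(1) g(1) S cr this] obtain f where f: "\<forall>i<N. f (l' i) = l i" "\<forall>p\<in>S. f (fst p) = snd p"
    "\<forall>x\<in>l' ` {..<N} \<union> fst ` S \<union> {h w}. f x \<in> V"
    "\<forall>x\<in>l' ` {..<N} \<union> fst ` S \<union> {h w}. \<forall>y\<in>l' ` {..<N} \<union> fst ` S \<union> {h w}. (E x y \<longleftrightarrow> E (f x) (f y)) \<and> (f x = f y \<longleftrightarrow> x = y)"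
    by (elim exE conjE)
  define v where "v = f (h w)"
  have v: "v \<in> ty E V N l (P w)"
  proof (rule tyI)
    show "v \<in> V" using f(3) unfolding v_def by blast
    fix i assume i: "i < N"
    have q: "E (h w) (l' i) \<longleftrightarrow> E v (f (l' i))" "E (l' i) (h w) \<longleftrightarrow> E (f (l' i)) v" using f(4) i unfolding v_def by simp_all
    show "E v (l i)" if "P w i" using tyD(2)[OF hw i that] q(1) f(1) i by simp
    show "E (l i) v" if "\<not> P w i" using tyD(3)[OF hw i that] q(2) f(1) i by simp
  qed
  have va: "(E v (g a) \<longleftrightarrow> R1 w a) \<and> (E (g a) v \<longleftrightarrow> R1 a w)" if "a \<in> A" for a
  proof -
    have m: "(h a, g a) \<in> S" using that unfolding S_def by blast
    then have fa: "f (h a) = g a" using bspec[OF f(2) m] by simp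
    have "h a \<in> fst ` S" using m by force
    then have "E (h w) (h a) \<longleftrightarrow> E v (f (h a))" "E (h a) (h w) \<longleftrightarrow> E (f (h a)) v" using f(4) unfolding v_def by blast+
    then show ?thesis using fa h(3)[of w a] h(3)[of a w] that by simp
  qed
  have vF: "v \<noteq> g x" if xF: "x \<in> F" for x
  proof
    assume e: "v = g x"
    obtain a where a: "a \<in> A" "R x a \<noteq> R1 w a \<or> R a x \<noteq> R1 a w" using no[OF xF] by blast
    show False using va[OF a(1)] a(2) g(3)[of x a] g(3)[of a x] xF a(1) AF unfolding e by blast
  qed
  define s where "s = {x\<in>F. E v (g x)}"
  have s: "s \<in> SS" unfolding SS_def s_def using va AF by blast
  obtain k where k: "k + n s \<le> N" "\<forall>x. \<forall>i<n s. P x (k + i) = p s x i" using NP[OF s] by blast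
  let ?g = "\<lambda>x. if x = w then v else g x"
  have r1: "chain E V (n s) (\<lambda>i. l (k + i))" by (rule chain_shift[OF g(1) k(1)])
  have r2: "\<forall>x\<in>insert w F. ?g x \<in> ty E V (n s) (\<lambda>i. l (k + i)) (p s x)"
  proof
    fix x assume "x \<in> insert w F"
    then have "?g x \<in> ty E V N l (P x)" using v g(2) by auto
    then show "?g x \<in> ty E V (n s) (\<lambda>i. l (k + i)) (p s x)" by (rule ty_shift) (use k in auto)
  qed
  have r3: "\<forall>x\<in>insert w F. \<forall>y\<in>insert w F. ?R s x y \<longleftrightarrow> E (?g x) (?g y)"
  proof (intro ballI)
    fix x y assume xy: "x \<in> insert w F" "y \<in> insert w F"
    have gx: "E v (g z) \<longleftrightarrow> z \<in> s" "E (g z) v \<longleftrightarrow> z \<in> F - s" if "z \<in> F" for z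
      using that tot[OF tyD(1)[OF v] tyD(1)[OF g(2)[OF that]] vF[OF that]] As unfolding s_def by blast+
    have ws: "w \<notin> s" using w unfolding s_def by blast
    consider "x = w" "y = w" | "x = w" "y \<in> F" "y \<noteq> w" | "x \<in> F" "x \<noteq> w" "y = w" | "x \<in> F" "y \<in> F" "x \<noteq> w" "y \<noteq> w"
      using xy w by blast
    then show "?R s x y \<longleftrightarrow> E (?g x) (?g y)"
      by cases (use ws I gx g(3) in simp_all)
  qed
  have "\<exists>l g. chain E V (n s) l \<and> (\<forall>x\<in>insert w F. g x \<in> ty E V (n s) l (p s x)) \<and>
     (\<forall>x\<in>insert w F. \<forall>y\<in>insert w F. ?R s x y \<longleftrightarrow> E (g x) (g y))"
    by (rule exI[of _ "\<lambda>i. l (k + i)"], rule exI[of _ ?g], intro conjI r1 r2 r3)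
  with np[OF s] show False by (rule notE)
qed

lemma plus_embed:
  assumes P: "plus E V F R" and F': "finite F'" "tour R' F'" and b: "\<And>x. x \<in> F' \<Longrightarrow> b x \<in> F" "inj_on b F'"
    and R: "\<And>x y. x \<in> F' \<Longrightarrow> y \<in> F' \<Longrightarrow> R' x y \<longleftrightarrow> R (b x) (b y)"
  shows "plus E V F' R'"
  unfolding plus_def
proof (intro conjI allI)
  fix n and p :: "'c \<Rightarrow> nat \<Rightarrow> bool"
  obtain l g where g: "chain E V n l" "\<forall>x\<in>F. g x \<in> ty E V n l (p (inv_into F' b x))"
    "\<forall>x\<in>F. \<forall>y\<in>F. R x y \<longleftrightarrow> E (g x) (g y)"
    using P[unfolded plus_def, THEN conjunct2, THEN conjunct2, rule_format, of n "\<lambda>x. p (inv_into F' b x)"] by blast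
  have "g (b x) \<in> ty E V n l (p x)" if "x \<in> F'" for x
    using bspec[OF g(2) b(1)[OF that]] inv_into_f_f[OF b(2) that] by simp
  moreover have "R' x y \<longleftrightarrow> E (g (b x)) (g (b y))" if "x \<in> F'" "y \<in> F'" for x y
    using R[OF that] g(3) b(1)[OF that(1)] b(1)[OF that(2)] by blast
  ultimately show "\<exists>l g. chain E V n l \<and> (\<forall>x\<in>F'. g x \<in> ty E V n l (p x)) \<and> (\<forall>x\<in>F'. \<forall>y\<in>F'. R' x y \<longleftrightarrow> E (g x) (g y))"
    using g(1) by (intro exI[of _ l] exI[of _ "g \<circ> b"]) simp
qed (use F' in auto)

lemma plus_tour: "plus E V F R \<Longrightarrow> tour R F" "plus E V F R \<Longrightarrow> finite F"
  unfolding plus_def by blast+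

section \<open>The limit of the amalgamation class\<close>

definition ext_rel :: "'b set \<Rightarrow> ('b \<Rightarrow> 'b \<Rightarrow> bool) \<Rightarrow> 'b \<Rightarrow> 'b set \<Rightarrow> 'b \<Rightarrow> 'b \<Rightarrow> bool" where
  "ext_rel F R w s x y = (if x = w then y \<in> s else if y = w then x \<in> F - s else x \<in> F \<and> y \<in> F \<and> R x y)"

text \<open>A Fraisse construction on the natural numbers by finite conditions. It starts from a
  vertex dominating a 3-cycle, which belongs to the class by \<open>c3_four_types\<close>; this
  makes the limit \<open>good\<close>.\<close>

lemma plus_limit:
  assumes G: "good E V"
  shows "\<exists>(R :: nat \<Rightarrow> nat \<Rightarrow> bool) W. good R W \<and> (\<forall>A. finite A \<longrightarrow> A \<subseteq> W \<longrightarrow> plus E V A R)"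
proof -
  have T: "htour E V" using G by (rule good_htour)
  define ok where "ok A s R \<longleftrightarrow> (\<forall>w. w \<notin> A \<longrightarrow> plus E V (insert w A) (ext_rel A R w s))"
    for A s :: "nat set" and R
  define P where "P c = plus E V (fst c) (fst (snd c))" for c :: "nat set \<times> (nat \<Rightarrow> nat \<Rightarrow> bool) \<times> nat"
  define le where "le c d \<longleftrightarrow> fst c \<subseteq> fst d \<and> (\<forall>x\<in>fst c. \<forall>y\<in>fst c. fst (snd d) x y \<longleftrightarrow> fst (snd c) x y) \<and> snd (snd c) \<le> snd (snd d)"
    for c d :: "nat set \<times> (nat \<Rightarrow> nat \<Rightarrow> bool) \<times> nat"
  define real where "real F R A s \<longleftrightarrow> (\<exists>f\<in>F. \<forall>x\<in>A. (R f x \<longleftrightarrow> x \<in> s) \<and> (R x f \<longleftrightarrow> x \<in> A - s))"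
    for F A s :: "nat set" and R :: "nat \<Rightarrow> nat \<Rightarrow> bool"
  \<comment> \<open>The requirement is vacuous while \<open>A\<close> is not contained in the
    condition. So each type occurs with every number, which the counter has to reach: a large number
    forces a stage at which \<open>A\<close> is already present.\<close>
  define D where "D i c \<longleftrightarrow> snd i \<le> snd (snd c) \<and>
     (fst (fst i) \<subseteq> fst c \<longrightarrow> ok (fst (fst i)) (snd (fst i)) (fst (snd c)) \<longrightarrow> real (fst c) (fst (snd c)) (fst (fst i)) (snd (fst i)))"
    for i :: "(nat set \<times> nat set) \<times> nat" and c :: "nat set \<times> (nat \<Rightarrow> nat \<Rightarrow> bool) \<times> nat"
  define Ix :: "((nat set \<times> nat set) \<times> nat) set" where "Ix = (Collect finite \<times> Collect finite) \<times> UNIV"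
  define K :: "nat \<Rightarrow> nat \<Rightarrow> bool" where "K x y \<longleftrightarrow> (x, y) \<in> {(0, 1), (0, 2), (0, 3), (1, 2), (2, 3), (3, 1)}" for x y
  have K: "plus E V {0, 1, 2, 3} K" unfolding plus_def
  proof (intro conjI allI)
    show "tour K {0, 1, 2, 3}" unfolding tour_def asy_def K_def by auto
    fix n and p :: "nat \<Rightarrow> nat \<Rightarrow> bool"
    obtain l i a b c where s: "chain E V n l" "i \<in> ty E V n l (p 0)" "a \<in> ty E V n l (p 1)" "b \<in> ty E V n l (p 2)"
      "c \<in> ty E V n l (p 3)" "c3 E a b c" "E i a" "E i b" "E i c"
      using c3_four_types[OF G, of n "p 0" "p 1" "p 2" "p 3"] by blast
    define g where "g x = (if x = 0 then i else if x = 1 then a else if x = 2 then b else c)" for x :: nat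
    have A: "\<not> E a i" "\<not> E b i" "\<not> E c i" "\<not> E b a" "\<not> E c b" "\<not> E a c" "\<not> E i i" "\<not> E a a" "\<not> E b b" "\<not> E c c"
      and e: "E a b" "E b c" "E c a"
      using s asyD[OF htour_asy[OF T]] asy_irrefl[OF htour_asy[OF T]] unfolding c3_def by blast+
    have "\<forall>x\<in>{0, 1, 2, 3}. g x \<in> ty E V n l (p x)" using s unfolding g_def by simp
    moreover have "\<forall>x\<in>{0, 1, 2, 3}. \<forall>y\<in>{0, 1, 2, 3}. K x y \<longleftrightarrow> E (g x) (g y)"
      using s(7-9) A e unfolding g_def K_def by simp
    ultimately show "\<exists>l g. chain E V n l \<and> (\<forall>x\<in>{0, 1, 2, 3}. g x \<in> ty E V n l (p x)) \<and> (\<forall>x\<in>{0, 1, 2, 3}. \<forall>y\<in>{0, 1, 2, 3}. K x y \<longleftrightarrow> E (g x) (g y))"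
      using s(1) by blast
  qed simp
  have "\<exists>f :: nat \<Rightarrow> nat set \<times> (nat \<Rightarrow> nat \<Rightarrow> bool) \<times> nat. f 0 = ({0, 1, 2, 3}, K, 0) \<and> (\<forall>n. P (f n)) \<and>
     (\<forall>m n. m \<le> n \<longrightarrow> le (f m) (f n)) \<and> (\<forall>i\<in>Ix. \<exists>n. D i (f n))"
  proof (rule rasiowa_sikorski)
    show "P ({0, 1, 2, 3}, K, 0)" unfolding P_def using K by simp
    show "countable Ix" unfolding Ix_def by (intro countable_SIGMA countable_Collect_finite) simp
    show "le p p" for p unfolding le_def by simp
    show "le p r" if "le p q" "le q r" for p q r using that unfolding le_def by (meson dual_order.trans subset_eq)
    fix i c assume i: "i \<in> Ix" and c: "P c"
    obtain A s m where ieq: "i = ((A, s), m)" by (metis prod.collapse)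
    obtain F R k where ceq: "c = (F, R, k)" by (metis prod.collapse)
    have PF: "plus E V F R" using c unfolding P_def ceq by simp
    show "\<exists>q. P q \<and> le c q \<and> D i q"
    proof (cases "A \<subseteq> F \<and> ok A s R \<and> \<not> real F R A s")
      case False
      then show ?thesis unfolding ieq ceq P_def le_def D_def using PF
        by (intro exI[of _ "(F, R, max k m)"]) auto
    next
      case True
      obtain w where w: "w \<notin> F" using plus_tour(2)[OF PF] ex_new_if_finite infinite_UNIV_nat by blast
      have "w \<notin> A" using w True by blast
      then have PA: "plus E V (insert w A) (ext_rel A R w s)" using True unfolding ok_def by blast
      have ex: "ext_rel A R w s x y \<longleftrightarrow> R x y" if "x \<in> A" "y \<in> A" for x y
        using that \<open>w \<notin> A\<close> unfolding ext_rel_def by auto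
      have new: "\<exists>x\<in>A. R f x \<noteq> ext_rel A R w s w x \<or> R x f \<noteq> ext_rel A R w s x w" if "f \<in> F" for f
      proof (rule ccontr)
        assume n: "\<not> ?thesis"
        have "R f x \<longleftrightarrow> x \<in> s" "R x f \<longleftrightarrow> x \<in> A - s" if "x \<in> A" for x
          using n that \<open>w \<notin> A\<close> unfolding ext_rel_def by (metis (full_types))+
        then have "real F R A s" using \<open>f \<in> F\<close> unfolding real_def by blast
        then show False using True by blast
      qed
      obtain s' where s': "s' \<subseteq> F" "\<forall>x\<in>A. x \<in> s' \<longleftrightarrow> ext_rel A R w s w x"
        "plus E V (insert w F) (\<lambda>x y. if x = w then y \<in> s' else if y = w then x \<in> F - s' else x \<in> F \<and> y \<in> F \<and> R x y)"
        using plus_amalgamation[OF T PF _ w PA ex new] True by (elim exE conjE impE) blast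
      have eq: "(\<lambda>x y. if x = w then y \<in> s' else if y = w then x \<in> F - s' else x \<in> F \<and> y \<in> F \<and> R x y) = ext_rel F R w s'"
        by (intro ext) (simp add: ext_rel_def)
      let ?q = "(insert w F, ext_rel F R w s', max k m)"
      have "P ?q" using s'(3) unfolding eq P_def by simp
      moreover have "le c ?q" unfolding le_def ceq using w by (auto simp: ext_rel_def)
      moreover have "real (insert w F) (ext_rel F R w s') A s"
        unfolding real_def
      proof (intro bexI[of _ w] ballI)
        fix x assume x: "x \<in> A"
        then have "x \<in> s' \<longleftrightarrow> x \<in> s" using s'(2) unfolding ext_rel_def by simp
        then show "(ext_rel F R w s' w x \<longleftrightarrow> x \<in> s) \<and> (ext_rel F R w s' x w \<longleftrightarrow> x \<in> A - s)"
          using x True w unfolding ext_rel_def by auto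
      qed simp
      ultimately show ?thesis unfolding D_def ieq by (intro exI[of _ ?q]) simp
    qed
  qed
  then obtain f :: "nat \<Rightarrow> nat set \<times> (nat \<Rightarrow> nat \<Rightarrow> bool) \<times> nat" where f: "f 0 = ({0, 1, 2, 3}, K, 0)" "\<forall>n. P (f n)"
     "\<forall>m n. m \<le> n \<longrightarrow> le (f m) (f n)" "\<forall>i\<in>Ix. \<exists>n. D i (f n)" by blast
  define F where "F n = fst (f n)" for n
  define R where "R n = fst (snd (f n))" for n
  define k where "k n = snd (snd (f n))" for n
  have FP: "plus E V (F n) (R n)" for n using f(2) unfolding P_def F_def R_def by blast
  have mono: "F m \<subseteq> F n" "\<And>x y. x \<in> F m \<Longrightarrow> y \<in> F m \<Longrightarrow> R n x y \<longleftrightarrow> R m x y" "k m \<le> k n" if "m \<le> n" for m n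
    using f(3) that unfolding le_def F_def R_def k_def by blast+
  define W where "W = (\<Union>n. F n)"
  define S where "S x y \<longleftrightarrow> (\<exists>n. x \<in> F n \<and> y \<in> F n \<and> R n x y)" for x y
  have SR: "S x y \<longleftrightarrow> R n x y" if "x \<in> F n" "y \<in> F n" for x y n
  proof
    assume "S x y"
    then obtain m where m: "x \<in> F m" "y \<in> F m" "R m x y" unfolding S_def by blast
    then have "R (max m n) x y" using mono(2)[of m "max m n"] by simp
    then show "R n x y" using mono(2)[of n "max m n"] that by simp
  next
    assume "R n x y" then show "S x y" unfolding S_def using that by blast
  qed
  have stage: "\<exists>n. A \<subseteq> F n" if "finite A" "A \<subseteq> W" for A
    using that
  proof (induction A rule: finite_induct)
    case (insert a A)
    then obtain n m where "A \<subseteq> F n" "a \<in> F m" unfolding W_def by blast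
    then have "insert a A \<subseteq> F (max n m)" using mono(1)[of n "max n m"] mono(1)[of m "max n m"] by auto
    then show ?case by blast
  qed simp
  have asyS: "asy S" unfolding asy_def
  proof (intro allI impI)
    fix x y assume "S x y"
    then obtain n where n: "x \<in> F n" "y \<in> F n" "R n x y" unfolding S_def by blast
    then have "\<not> R n y x" using asyD[OF tour_asy[OF plus_tour(1)[OF FP]]] by blast
    then show "\<not> S y x" using SR n by blast
  qed
  have tS: "tour S W" unfolding tour_def
  proof (intro conjI ballI impI asyS)
    fix x y assume xy: "x \<in> W" "y \<in> W" "x \<noteq> y"
    then have "finite {x, y}" "{x, y} \<subseteq> W" by simp_all
    then obtain n where n: "{x, y} \<subseteq> F n" using stage by blast
    then have "R n x y \<or> R n y x" using tourD[OF plus_tour(1)[OF FP]] xy by blast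
    then show "S x y \<or> S y x" using SR n by blast
  qed
  have plusS: "plus E V A S" if A: "finite A" "A \<subseteq> W" for A
  proof -
    obtain n where n: "A \<subseteq> F n" using stage[OF A] by blast
    show ?thesis
    proof (rule plus_embed[OF FP[of n], where b = id])
      show "tour S A" using tS A unfolding tour_def by blast
      show "S x y \<longleftrightarrow> R n (id x) (id y)" if "x \<in> A" "y \<in> A" for x y
        using SR[of x n y] n that by auto
    qed (use n A in auto)
  qed
  have "hh S W" unfolding hh_def
  proof (intro allI impI)
    fix r v assume r: "phom S W r" and v: "v \<in> W"
    let ?A = "fst ` r" and ?B = "snd ` r"
    have fr: "finite r" and rW: "r \<subseteq> W \<times> W" using r unfolding phom_def by blast+
    show "\<exists>w\<in>W. phom S W (insert (v, w) r)"
    proof (cases "v \<in> ?A")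
      case True
      then obtain w where vw: "(v, w) \<in> r" by force
      then have "phom S W (insert (v, w) r)" using r by (simp add: insert_absorb)
      moreover have "w \<in> W" using vw rW by blast
      ultimately show ?thesis by blast
    next
      case False
      define s where "s = {y. \<exists>x. (x, y) \<in> r \<and> S v x}"
      have sB: "s \<subseteq> ?B" unfolding s_def by force
      note it = phom_iff[OF tS r]
      have AW: "?A \<subseteq> W" "?B \<subseteq> W" using rW by auto
      have fB: "finite ?B" "finite ?A" using fr by simp_all
      have ms: "y \<in> s \<longleftrightarrow> S v x" if "(x, y) \<in> r" for x y
        using that it(2) unfolding s_def by blast
      \<comment> \<open>The type to be realised over the image is that of \<open>v\<close> over the
        domain. The extended image is isomorphic to \<open>insert v ?A\<close>, a finite subset of
        \<open>W\<close>, and so belongs to the class.\<close>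
      have okS: "ok ?B s S" unfolding ok_def
      proof (intro allI impI)
        fix w assume w: "w \<notin> ?B"
        define b where "b z = (if z = w then v else SOME x. (x, z) \<in> r)" for z
        have bB: "(b z, z) \<in> r" if "z \<in> ?B" for z
        proof -
          have "z \<noteq> w" using w that by blast
          moreover have "\<exists>x. (x, z) \<in> r" using that by force
          ultimately show ?thesis unfolding b_def using someI_ex[of "\<lambda>x. (x, z) \<in> r"] by simp
        qed
        have bw: "b w = v" unfolding b_def by simp
        have bA: "b z \<in> ?A" if "z \<in> ?B" for z using bB[OF that] by force
        have P: "plus E V (insert v ?A) S" by (rule plusS) (use fB AW v in auto)
        have wz: "ext_rel ?B S w s x y \<longleftrightarrow> S (b x) (b y)" if xy: "x \<in> insert w ?B" "y \<in> insert w ?B" for x y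
        proof -
          consider "x = w" "y = w" | "x = w" "y \<in> ?B" "y \<noteq> w" | "x \<in> ?B" "x \<noteq> w" "y = w" | "x \<in> ?B" "y \<in> ?B" "x \<noteq> w" "y \<noteq> w"
            using xy w by blast
          then show ?thesis
          proof cases
            case 1
            then show ?thesis using w sB asy_irrefl[OF asyS] unfolding ext_rel_def bw by auto
          next
            case 2
            then show ?thesis using ms[OF bB[OF 2(2)]] bw unfolding ext_rel_def by simp
          next
            case 3
            have "b x \<noteq> v" using bA[OF 3(1)] False by blast
            moreover have "b x \<in> W" using bA[OF 3(1)] AW by blast
            ultimately have "S v (b x) \<longleftrightarrow> \<not> S (b x) v" using tourD[OF tS v] asyD[OF asyS] by metis
            then show ?thesis using 3 ms[OF bB[OF 3(1)]] bw unfolding ext_rel_def by simp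
          next
            case 4
            then show ?thesis using it(1)[OF bB[OF 4(1)] bB[OF 4(2)]] unfolding ext_rel_def by simp
          qed
        qed
        have inj: "inj_on b (insert w ?B)"
        proof (rule inj_onI)
          fix x y assume xy: "x \<in> insert w ?B" "y \<in> insert w ?B" "b x = b y"
          consider "x = w" "y = w" | "x = w" "y \<in> ?B" | "x \<in> ?B" "y = w" | "x \<in> ?B" "y \<in> ?B" using xy by blast
          then show "x = y"
          proof cases
            case 2 then show ?thesis using bA[OF 2(2)] False xy(3) bw by simp
          next
            case 3 then show ?thesis using bA[OF 3(1)] False xy(3) bw by simp
          next
            case 4
            have "(b x, y) \<in> r" using bB[OF 4(2)] xy(3) by simp
            then show ?thesis using it(2)[OF bB[OF 4(1)]] by blast
          qed simp
        qed
        show "plus E V (insert w ?B) (ext_rel ?B S w s)"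
        proof (rule plus_embed[OF P _ _ _ inj wz])
          show "tour (ext_rel ?B S w s) (insert w ?B)"
            unfolding tour_def
          proof (intro conjI ballI impI)
            show "asy (ext_rel ?B S w s)"
              unfolding asy_def ext_rel_def using w sB asyS unfolding asy_def by auto
            fix x y assume xy: "x \<in> insert w ?B" "y \<in> insert w ?B" "x \<noteq> y"
            have "b x \<in> W" "b y \<in> W" using xy bA AW bw v by auto
            moreover have "b x \<noteq> b y" using inj xy unfolding inj_on_def by blast
            ultimately show "ext_rel ?B S w s x y \<or> ext_rel ?B S w s y x"
              using wz[OF xy(1,2)] wz[OF xy(2,1)] tourD[OF tS] by blast
          qed
        qed (use fB bA bw in auto)
      qed
      obtain n0 where n0: "?B \<subseteq> F n0" using stage[OF fB(1) AW(2)] by blast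
      \<comment> \<open>The counter is monotone, so \<open>Suc (k n0)\<close> forces a stage after
        \<open>n0\<close>, where \<open>?B\<close> is present.\<close>
      have "((?B, s), Suc (k n0)) \<in> Ix" unfolding Ix_def using fB finite_subset[OF sB] by simp
      then obtain n where n: "D ((?B, s), Suc (k n0)) (f n)" using f(4) by blast
      have "\<not> n \<le> n0" using n mono(3)[of n n0] unfolding D_def k_def by auto
      then have BF: "?B \<subseteq> F n" using n0 mono(1)[of n0 n] by simp
      have "ok ?B s (R n)"
      proof -
        have eq: "R n x y \<longleftrightarrow> S x y" if "x \<in> ?B" "y \<in> ?B" for x y
          using SR[of x n y] that BF by blast
        have "ext_rel ?B (R n) w s x y \<longleftrightarrow> ext_rel ?B S w s x y" for w x y
          by (cases "x \<in> ?B"; cases "y \<in> ?B"; simp add: ext_rel_def eq)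
        then have "ext_rel ?B (R n) w s = ext_rel ?B S w s" for w
          by (intro ext)
        then show ?thesis using okS unfolding ok_def by simp
      qed
      then have "real (F n) (R n) ?B s" using n BF unfolding D_def F_def R_def by simp
      then obtain u where u: "u \<in> F n" "\<forall>x\<in>?B. (R n u x \<longleftrightarrow> x \<in> s) \<and> (R n x u \<longleftrightarrow> x \<in> ?B - s)" unfolding real_def by blast
      have us: "(S u y \<longleftrightarrow> y \<in> s) \<and> (S y u \<longleftrightarrow> y \<notin> s)" if "y \<in> ?B" for y
        using u that BF SR by blast
      have uW: "u \<in> W" using u unfolding W_def by blast
      have "phom S W (insert (v, u) r)"
      proof (rule phomI)
        show "finite (insert (v, u) r)" using fr by simp
        fix x x' assume x: "(x, x') \<in> insert (v, u) r"
        show "x \<in> W \<and> x' \<in> W" using x rW v uW by auto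
        fix y y' assume y: "(y, y') \<in> insert (v, u) r"
        have xx: "x = v \<and> x' = u \<or> (x, x') \<in> r \<and> x \<noteq> v" and yy: "y = v \<and> y' = u \<or> (y, y') \<in> r \<and> y \<noteq> v"
          using x y False by force+
        show "x' = y'" if "x = y" using that xx yy phomD(1)[OF r] by blast
        have rs: "S v z \<longleftrightarrow> S u z'" "S z v \<longleftrightarrow> S z' u" if z: "(z, z') \<in> r" for z z'
        proof -
          have "z \<noteq> v" "z \<in> W" "z' \<in> ?B" using z False rW by force+
          then show "S v z \<longleftrightarrow> S u z'" "S z v \<longleftrightarrow> S z' u" using us ms[OF z] tourD[OF tS v] asyD[OF asyS] by metis+
        qed
        show "S x' y'" if "S x y" using that xx yy rs phomD(2)[OF r] asy_irrefl[OF asyS] by metis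
      qed
      then show ?thesis using uW by blast
    qed
  qed
  then have hS: "htour S W" using tS unfolding htour_def by blast
  have F0: "F 0 = {0, 1, 2, 3}" "R 0 = K" using f(1) unfolding F_def R_def by simp_all
  have "good S W"
  proof (rule goodI[OF hS, of 0 1 2 3])
    show "c3 S 1 2 3" "S 0 1" "S 0 2" "S 0 3" unfolding c3_def using SR[of _ 0] unfolding F0 K_def by auto
  qed (use F0 in \<open>auto simp: W_def\<close>)
  then show ?thesis using plusS by blast
qed

text \<open>Stated on natural numbers because the induction hypothesis is applied to the limit,
  which lives there, and a type cannot vary inside an induction.\<close>

lemma good_embeds_nat:
  fixes E :: "nat \<Rightarrow> nat \<Rightarrow> bool" and R :: "nat \<Rightarrow> nat \<Rightarrow> bool"
  assumes "good E V" "finite F" "card F = n" "tour R F"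
  shows "\<exists>g. \<forall>x\<in>F. g x \<in> V \<and> (\<forall>y\<in>F. R x y \<longleftrightarrow> E (g x) (g y))"
  using assms
proof (induction n arbitrary: E V F R)
  case 0
  then show ?case by simp
next
  case (Suc n)
  obtain v F' where F: "F = insert v F'" "v \<notin> F'" "card F' = n" "finite F'"
    using Suc.prems(2,3) by (metis card_Suc_eq finite_insert)
  obtain S :: "nat \<Rightarrow> nat \<Rightarrow> bool" and W where S: "good S W" "\<And>A. finite A \<Longrightarrow> A \<subseteq> W \<Longrightarrow> plus E V A S"
    using plus_limit[OF Suc.prems(1)] by blast
  have tF': "tour R F'" using Suc.prems(4) F(1) unfolding tour_def by blast
  obtain g where g: "\<And>x. x \<in> F' \<Longrightarrow> g x \<in> W" "\<And>x y. x \<in> F' \<Longrightarrow> y \<in> F' \<Longrightarrow> R x y \<longleftrightarrow> S (g x) (g y)"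
    using Suc.IH[OF S(1) F(4,3) tF'] by blast
  have T: "htour E V" using Suc.prems(1) by (rule good_htour)
  note A = asyD[OF htour_asy[OF T]] and I = asy_irrefl[OF htour_asy[OF T]]
  have Ri: "\<not> R x x" "R x y \<Longrightarrow> \<not> R y x" for x y
    using asy_irrefl[OF tour_asy[OF Suc.prems(4)]] asyD[OF tour_asy[OF Suc.prems(4)]] by blast+
  have Si: "\<not> S x x" for x using asy_irrefl[OF htour_asy[OF good_htour[OF S(1)]]] by blast
  have inj: "inj_on g F'" by (rule inj_onI) (use g(2) tourD[OF tF'] Si in metis)
  have "plus E V (g ` F') S" by (rule S(2)) (use F g in auto)
  \<comment> \<open>The prescription towards the single chain element \<open>l 0\<close> copies the
    arcs between \<open>F'\<close> and \<open>v\<close>.\<close>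
  then obtain l h where h: "chain E V 1 l" "\<forall>x\<in>g ` F'. h x \<in> ty E V 1 l (\<lambda>_. R (inv_into F' g x) v)"
    "\<forall>x\<in>g ` F'. \<forall>y\<in>g ` F'. S x y \<longleftrightarrow> E (h x) (h y)"
    unfolding plus_def by (elim conjE allE[of _ 1] allE[of _ "\<lambda>x _. R (inv_into F' g x) v"]) blast
  have l0: "l 0 \<in> V" using chainD(1)[OF h(1)] by simp
  have t: "h (g x) \<in> ty E V 1 l (\<lambda>_. R x v)" if "x \<in> F'" for x
    using h(2) that inv_into_f_f[OF inj that] by auto
  have hv: "E (h (g x)) (l 0) \<longleftrightarrow> R x v" "E (l 0) (h (g x)) \<longleftrightarrow> R v x" if "x \<in> F'" for x
  proof -
    have "R x v \<or> R v x" using tourD[OF Suc.prems(4)] F that by blast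
    then show "E (h (g x)) (l 0) \<longleftrightarrow> R x v" "E (l 0) (h (g x)) \<longleftrightarrow> R v x"
      using tyD(2,3)[OF t[OF that], of 0] A Ri(2) by auto
  qed
  let ?g = "\<lambda>x. if x = v then l 0 else h (g x)"
  have "?g x \<in> V \<and> (\<forall>y\<in>F. R x y \<longleftrightarrow> E (?g x) (?g y))" if xF: "x \<in> F" for x
  proof (intro conjI ballI)
    show "?g x \<in> V" using xF l0 tyD(1)[OF t] F(1) by auto
    fix y assume y: "y \<in> F"
    consider "x = v" "y = v" | "x = v" "y \<in> F'" "y \<noteq> v" | "x \<in> F'" "x \<noteq> v" "y = v" | "x \<in> F'" "y \<in> F'" "x \<noteq> v" "y \<noteq> v"
      using xF y F by blast
    then show "R x y \<longleftrightarrow> E (?g x) (?g y)"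
      by cases (use hv g(2) h(3) I Ri in auto)
  qed
  then show ?case by (intro exI[of _ ?g]) blast
qed

section \<open>Tournaments in which no 3-cycle is dominated\<close>

text \<open>\<open>d0\<close> excludes C_3. By \<open>nd1\<close> no out-neighbourhood contains a
  3-cycle, so each is a chain.\<close>

locale local_tournament =
  fixes E :: "'a \<Rightarrow> 'a \<Rightarrow> bool" and V :: "'a set" and v0 a0 b0 c0 d0 :: 'a
  assumes T: "htour E V" and cnt: "countable V" and v0: "v0 \<in> V"
    and abc: "a0 \<in> V" "b0 \<in> V" "c0 \<in> V" "d0 \<in> V" "c3 E a0 b0 c0" "d0 \<notin> {a0, b0, c0}"
    and nd1: "\<And>i a b c. i \<in> V \<Longrightarrow> a \<in> V \<Longrightarrow> b \<in> V \<Longrightarrow> c \<in> V \<Longrightarrow> c3 E a b c \<Longrightarrow> E i a \<Longrightarrow> E i b \<Longrightarrow> \<not> E i c"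
begin

lemma A: "E x y \<Longrightarrow> \<not> E y x" and I: "\<not> E x x" and ne: "E x y \<Longrightarrow> x \<noteq> y"
  using asyD[OF htour_asy[OF T]] asy_irrefl[OF htour_asy[OF T]] by blast+

lemma tot: "x \<in> V \<Longrightarrow> y \<in> V \<Longrightarrow> x \<noteq> y \<Longrightarrow> E x y \<or> E y x"
  by (rule htourD[OF T])

lemma nd2:
  assumes i: "i \<in> V" and V: "a \<in> V" "b \<in> V" "c \<in> V" and C: "c3 E a b c" and e: "E a i" "E b i"
  shows "\<not> E c i"
proof
  assume "E c i"
  show False
    by (rule not_dominating_c3[OF T V C _ i e \<open>E c i\<close>]) (rule nd1)
qed

text \<open>The arcs between \<open>d0\<close> and the cycle do not all point the same way, so
  \<open>d0\<close> closes a second 3-cycle over one arc of the cycle.\<close>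

lemma two_over: "\<exists>x\<in>V. \<exists>y\<in>V. \<exists>z1\<in>V. \<exists>z2\<in>V. E x y \<and> E z1 z2 \<and> E y z1 \<and> E z1 x \<and> E y z2 \<and> E z2 x"
proof -
  have e: "E a0 b0" "E b0 c0" "E c0 a0" using abc(5) unfolding c3_def by blast+
  have C: "c3 E b0 c0 a0" "c3 E c0 a0 b0" using e unfolding c3_def by blast+
  have t: "E a0 d0 \<or> E d0 a0" "E b0 d0 \<or> E d0 b0" "E c0 d0 \<or> E d0 c0" using tot abc by blast+
  have n: "\<not> (E d0 a0 \<and> E d0 b0 \<and> E d0 c0)" "\<not> (E a0 d0 \<and> E b0 d0 \<and> E c0 d0)"
    using nd1[OF abc(4,1,2,3,5)] nd2[OF abc(4,1,2,3,5)] by blast+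
  have k: ?thesis if "x \<in> V" "y \<in> V" "z \<in> V" "c3 E x y z" "E y d0" "E d0 x" "z \<noteq> d0" for x y z
  proof -
    have "E x y" "E y z" "E z x" using that(4) unfolding c3_def by blast+
    moreover have "E z d0 \<or> E d0 z" using tot that(3,7) abc(4) by blast
    ultimately show ?thesis using that abc(4) by blast
  qed
  consider "E b0 d0 \<and> E d0 a0" | "E c0 d0 \<and> E d0 b0" | "E a0 d0 \<and> E d0 c0" using t n by blast
  then show ?thesis
    by cases (use k[of a0 b0 c0] k[of b0 c0 a0] k[of c0 a0 b0] abc C in blast)+
qed

text \<open>Copying \<open>y, z1\<close> to \<open>y, z2\<close> takes \<open>z2\<close> to
  \<open>w\<close>. The arc \<open>w -> z1\<close> would make \<open>y\<close> dominate the 3-cycle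
  \<open>z1 z2 w\<close>.\<close>

lemma chain4: "\<exists>p\<in>V. \<exists>q\<in>V. \<exists>r\<in>V. \<exists>s\<in>V. E p q \<and> E p r \<and> E p s \<and> E q r \<and> E q s \<and> E r s"
proof -
  obtain x y z1 z2 where z: "x \<in> V" "y \<in> V" "z1 \<in> V" "z2 \<in> V" "E x y" "E z1 z2" "E y z1" "E z1 x" "E y z2" "E z2 x"
    using two_over by blast
  have "embw E [y, z1] [y, z2]" using z ne by simp
  from move_list1[OF T this _ _ z(4)] have "\<exists>w\<in>V. emb E [y, z1, z2] [y, z2, w] E"
    using z by (simp del: emb.simps)
  then obtain w where w: "w \<in> V" "emb E [y, z1, z2] [y, z2, w] E" by blast
  have e: "E y w" "E z2 w" using w(2) z by simp_all
  have "\<not> E w z1" using nd1[OF z(2,3,4) w(1)] z e unfolding c3_def by blast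
  moreover have "w \<noteq> z1" using e z A by blast
  ultimately have "E z1 w" using tot w z by blast
  then show ?thesis using z w e by blast
qed

text \<open>On the circle this rotates the in-neighbours of \<open>v0\<close> by pi. They join the
  out-neighbours on the half circle following \<open>v0\<close>, where arcs agree with the order of
  the angles.\<close>

definition prec where "prec x y \<longleftrightarrow> (if E v0 x = E v0 y then E x y else E y x)"

abbreviation "M \<equiv> V - {v0}"

lemma side: "x \<in> M \<Longrightarrow> \<not> E v0 x \<longleftrightarrow> E x v0"
  using tot[of x v0] v0 A by blast

lemma prec_irrefl: "\<not> prec x x"
  unfolding prec_def using I by simp

lemma prec_total: "x \<in> M \<Longrightarrow> y \<in> M \<Longrightarrow> x \<noteq> y \<Longrightarrow> prec x y \<or> prec y x"
  unfolding prec_def using tot[of x y] by auto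

text \<open>For each distribution of \<open>x\<close>, \<open>y\<close>, \<open>z\<close> over the
  two sides of \<open>v0\<close>, a failure would give a 3-cycle among these four vertices that
  dominates, or is dominated by, the fourth.\<close>

lemma prec_trans:
  assumes M: "x \<in> M" "y \<in> M" "z \<in> M" and xy: "prec x y" and yz: "prec y z"
  shows "prec x z"
proof -
  have V: "x \<in> V" "y \<in> V" "z \<in> V" "x \<noteq> v0" "y \<noteq> v0" "z \<noteq> v0" using M by auto
  have xz: "x \<noteq> z"
    using xy yz A unfolding prec_def by (auto split: if_splits)
  have t: "E x z \<or> E z x" using tot V xz by blast
  note s = side[OF M(1)] side[OF M(2)] side[OF M(3)]
  have n1: "\<not> (E i a \<and> E i b \<and> E i c \<and> E a b \<and> E b c \<and> E c a)"
   and n2: "\<not> (E a i \<and> E b i \<and> E c i \<and> E a b \<and> E b c \<and> E c a)"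
    if "i \<in> V" "a \<in> V" "b \<in> V" "c \<in> V" for i a b c
    using nd1[OF that] nd2[OF that] unfolding c3_def by blast+
  note n = n1[OF v0 V(1-3)] n1[OF v0 V(1,3,2)] n2[OF v0 V(1-3)] n2[OF v0 V(1,3,2)]
    n1[OF V(1) v0 V(2,3)] n1[OF V(1) v0 V(3,2)] n2[OF V(1) v0 V(2,3)] n2[OF V(1) v0 V(3,2)]
    n1[OF V(2) v0 V(1,3)] n1[OF V(2) v0 V(3,1)] n2[OF V(2) v0 V(1,3)] n2[OF V(2) v0 V(3,1)]
    n1[OF V(3) v0 V(1,2)] n1[OF V(3) v0 V(2,1)] n2[OF V(3) v0 V(1,2)] n2[OF V(3) v0 V(2,1)]
  show ?thesis
    using xy yz t n s A[of v0 x] A[of v0 y] A[of v0 z] unfolding prec_def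
    by (cases "E v0 x"; cases "E v0 y"; cases "E v0 z"; simp; blast?)
qed

text \<open>Each side of \<open>v0\<close> has to be dense by itself, since later each fills its own
  half circle. The witnesses are copied from \<open>chain4\<close>, \<open>two_over\<close> and
  \<open>arc_c3\<close>, depending on the sides of \<open>x\<close> and \<open>y\<close>.\<close>

lemma prec_between:
  assumes M: "x \<in> M" "y \<in> M" and xy: "prec x y"
  shows "(\<exists>z\<in>M. prec x z \<and> prec z y \<and> E v0 z) \<and> (\<exists>z\<in>M. prec x z \<and> prec z y \<and> \<not> E v0 z)"
proof -
  have V: "x \<in> V" "y \<in> V" "x \<noteq> v0" "y \<noteq> v0" using M by auto
  obtain p q r s where c: "p \<in> V" "q \<in> V" "r \<in> V" "s \<in> V" "E p q" "E p r" "E p s" "E q r" "E q s" "E r s"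
    using chain4 by blast
  \<comment> \<open>\<open>g1\<close> to \<open>g4\<close> insert a vertex at each of the four
    places of a transitive triple; \<open>h1\<close> and \<open>h2\<close> add one to a
    3-cycle.\<close>
  have g1: "\<exists>w\<in>V. E a w \<and> E b w \<and> E w d" if "a \<in> V" "b \<in> V" "d \<in> V" "E a b" "E b d" "E a d" for a b d
  proof -
    have "embw E [p, q, s] [a, b, d]" using c that ne by simp
    from move_list1[OF T this _ _ c(3)] have "\<exists>w\<in>V. emb E [p, q, s, r] [a, b, d, w] E" using c that by (simp del: emb.simps)
    then obtain w where w: "w \<in> V" "emb E [p, q, s, r] [a, b, d, w] E" by blast
    then have "E a w" "E b w" "E w d" using c by simp_all
    then show ?thesis using w by blast
  qed
  have g2: "\<exists>w\<in>V. E a w \<and> E w b \<and> E w d" if "a \<in> V" "b \<in> V" "d \<in> V" "E a b" "E b d" "E a d" for a b d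
  proof -
    have "embw E [p, r, s] [a, b, d]" using c that ne by simp
    from move_list1[OF T this _ _ c(2)] have "\<exists>w\<in>V. emb E [p, r, s, q] [a, b, d, w] E" using c that by (simp del: emb.simps)
    then obtain w where w: "w \<in> V" "emb E [p, r, s, q] [a, b, d, w] E" by blast
    then have "E a w" "E w b" "E w d" using c by simp_all
    then show ?thesis using w by blast
  qed
  have g3: "\<exists>w\<in>V. E a w \<and> E b w \<and> E d w" if "a \<in> V" "b \<in> V" "d \<in> V" "E a b" "E b d" "E a d" for a b d
  proof -
    have "embw E [p, q, r] [a, b, d]" using c that ne by simp
    from move_list1[OF T this _ _ c(4)] have "\<exists>w\<in>V. emb E [p, q, r, s] [a, b, d, w] E" using c that by (simp del: emb.simps)
    then obtain w where w: "w \<in> V" "emb E [p, q, r, s] [a, b, d, w] E" by blast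
    then have "E a w" "E b w" "E d w" using c by simp_all
    then show ?thesis using w by blast
  qed
  have g4: "\<exists>w\<in>V. E w a \<and> E w b \<and> E w d" if "a \<in> V" "b \<in> V" "d \<in> V" "E a b" "E b d" "E a d" for a b d
  proof -
    have "embw E [q, r, s] [a, b, d]" using c that ne by simp
    from move_list1[OF T this _ _ c(1)] have "\<exists>w\<in>V. emb E [q, r, s, p] [a, b, d, w] E" using c that by (simp del: emb.simps)
    then obtain w where w: "w \<in> V" "emb E [q, r, s, p] [a, b, d, w] E" by blast
    then have "E w a" "E w b" "E w d" using c by simp_all
    then show ?thesis using w by blast
  qed
  obtain u v z1 z2 where z: "u \<in> V" "v \<in> V" "z1 \<in> V" "z2 \<in> V" "E u v" "E z1 z2" "E v z1" "E z1 u" "E v z2" "E z2 u"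
    using two_over by blast
  have zn: "\<not> E v u" "\<not> E z2 v" "\<not> E u z2" "\<not> E u z1" "\<not> E z1 v" using z A by blast+
  have h1: "\<exists>w\<in>V. E a w \<and> E w b \<and> E w d" if "a \<in> V" "b \<in> V" "d \<in> V" "E a b" "E b d" "E d a" for a b d
  proof -
    have "\<not> E a d" using that A by blast
    then have "embw E [v, z2, u] [a, b, d]" using z zn that ne by auto
    from move_list1[OF T this _ _ z(3)] have "\<exists>w\<in>V. emb E [v, z2, u, z1] [a, b, d, w] E" using z that by (simp del: emb.simps)
    then obtain w where w: "w \<in> V" "emb E [v, z2, u, z1] [a, b, d, w] E" by blast
    then have "E a w" "E w b" "E w d" using z by simp_all
    then show ?thesis using w by blast
  qed
  have h2: "\<exists>w\<in>V. E w a \<and> E b w \<and> E d w" if "a \<in> V" "b \<in> V" "d \<in> V" "E a b" "E b d" "E d a" for a b d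
  proof -
    have "\<not> E a d" using that A by blast
    then have "embw E [u, v, z1] [a, b, d]" using z zn that ne by auto
    from move_list1[OF T this _ _ z(4)] have "\<exists>w\<in>V. emb E [u, v, z1, z2] [a, b, d, w] E" using z that by (simp del: emb.simps)
    then obtain w where w: "w \<in> V" "emb E [u, v, z1, z2] [a, b, d, w] E" by blast
    then have "E w a" "E b w" "E d w" using z by simp_all
    then show ?thesis using w by blast
  qed
  have arc: "\<exists>w\<in>V. E b w \<and> E w a" if "a \<in> V" "b \<in> V" "E a b" for a b
    by (rule arc_c3[OF T abc(1-3,5) that])
  note s = side[OF M(1)] side[OF M(2)]
  have nv: "w \<noteq> v0" if "E v0 w \<or> E w v0" for w using that I by blast
  have pA: "E v0 w \<Longrightarrow> (prec x w \<longleftrightarrow> (if E v0 x then E x w else E w x)) \<and> (prec w y \<longleftrightarrow> (if E v0 y then E w y else E y w))"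
   and pB: "\<not> E v0 w \<Longrightarrow> (prec x w \<longleftrightarrow> (if E v0 x then E w x else E x w)) \<and> (prec w y \<longleftrightarrow> (if E v0 y then E y w else E w y))" for w
    unfolding prec_def by auto
  consider "E v0 x" "E v0 y" "E x y" | "\<not> E v0 x" "\<not> E v0 y" "E x y" | "E v0 x" "\<not> E v0 y" "E y x" | "\<not> E v0 x" "E v0 y" "E y x"
    using xy unfolding prec_def by metis
  then show ?thesis
  proof cases
    case 1
    obtain w where w: "w \<in> V" "E v0 w" "E x w" "E w y" using g1[of v0 x y] 1 v0 V by blast
    obtain w' where w': "w' \<in> V" "E y w'" "E w' x" using arc V 1 by blast
    have "\<not> E v0 w'" using nd1[of v0 x y w'] w' V v0 1 unfolding c3_def by blast
    moreover have "w' \<noteq> v0" using 1 w' A by blast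
    ultimately show ?thesis using w w' nv[of w] pA[of w] pB[of w'] 1 by auto
  next
    case 2
    have k2: "E x v0" "E y v0" using 2 s by blast+
    obtain w where w: "w \<in> V" "E w v0" "E x w" "E w y" using g2[of x y v0] 2 k2 v0 V by blast
    obtain w' where w': "w' \<in> V" "E y w'" "E w' x" using arc V 2 by blast
    have "\<not> E w' v0" using nd2[of v0 x y w'] w' V v0 2 k2 unfolding c3_def by blast
    moreover have "w' \<noteq> v0" using k2 w' A by blast
    ultimately have "E v0 w'" using tot w' v0 by blast
    then show ?thesis using w w' nv[of w] nv[of w'] pA[of w'] pB[of w] A[of w v0] 2 by auto
  next
    case 3
    have k3: "E y v0" using 3 s by blast
    obtain w where w: "w \<in> V" "E v0 w" "E x w" "E y w" using g3[of y v0 x] 3 k3 v0 V by blast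
    obtain w' where w': "w' \<in> V" "E w' v0" "E w' x" "E w' y" using g4[of y v0 x] 3 k3 v0 V by blast
    show ?thesis using w w' nv[of w] nv[of w'] pA[of w] pB[of w'] A[of w' v0] 3 by auto
  next
    case 4
    have k4: "E x v0" using 4 s by blast
    obtain w where w: "w \<in> V" "E v0 w" "E w y" "E w x" using h1[of v0 y x] 4 k4 v0 V by blast
    obtain w' where w': "w' \<in> V" "E w' v0" "E y w'" "E x w'" using h2[of v0 y x] 4 k4 v0 V by blast
    show ?thesis using w w' nv[of w] nv[of w'] pA[of w] pB[of w'] A[of w' v0] 4 by auto
  qed
qed

lemma prec_unbounded:
  assumes M: "x \<in> M"
  shows "\<exists>z\<in>M. prec z x" "\<exists>z\<in>M. prec x z"
proof -
  have V: "x \<in> V" "x \<noteq> v0" using M by auto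
  obtain p q r s where c: "p \<in> V" "q \<in> V" "r \<in> V" "E p q" "E p r" "E q r"
    using chain4 by blast
  have g: "\<exists>w\<in>V. E a w \<and> E w b" "\<exists>w\<in>V. E a w \<and> E b w" if "a \<in> V" "b \<in> V" "E a b" for a b
  proof -
    have "embw E [p, r] [a, b]" using c that ne by simp
    from move_list1[OF T this _ _ c(2)] have "\<exists>w\<in>V. emb E [p, r, q] [a, b, w] E" using c that by (simp del: emb.simps)
    then obtain w where w: "w \<in> V" "emb E [p, r, q] [a, b, w] E" by blast
    then have "E a w" "E w b" using c by simp_all
    then show "\<exists>w\<in>V. E a w \<and> E w b" using w by blast
    have "embw E [p, q] [a, b]" using c that ne by simp
    from move_list1[OF T this _ _ c(3)] have "\<exists>w\<in>V. emb E [p, q, r] [a, b, w] E" using c that by (simp del: emb.simps)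
    then obtain w where w: "w \<in> V" "emb E [p, q, r] [a, b, w] E" by blast
    then have "E a w" "E b w" using c by simp_all
    then show "\<exists>w\<in>V. E a w \<and> E b w" using w by blast
  qed
  show "\<exists>z\<in>M. prec z x"
  proof (cases "E v0 x")
    case True
    then obtain w where "w \<in> V" "E v0 w" "E w x" using g(1)[of v0 x] v0 V by blast
    then show ?thesis using True I by (intro bexI[of _ w]) (auto simp: prec_def)
  next
    case False
    then have "E x v0" using side[OF M] by blast
    then obtain w where "w \<in> V" "E x w" "E v0 w" using g(2)[of x v0] v0 V by blast
    then show ?thesis using False I by (intro bexI[of _ w]) (auto simp: prec_def)
  qed
  show "\<exists>z\<in>M. prec x z"
  proof (cases "E v0 x")
    case True
    then obtain w where "w \<in> V" "E v0 w" "E x w" using g(2)[of v0 x] v0 V by blast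
    then show ?thesis using True I by (intro bexI[of _ w]) (auto simp: prec_def)
  next
    case False
    then have "E x v0" using side[OF M] by blast
    then obtain w where "w \<in> V" "E x w" "E w v0" using g(1)[of x v0] v0 V by blast
    then show ?thesis using False I A[of w v0] by (intro bexI[of _ w]) (auto simp: prec_def)
  qed
qed

lemma dense_prec: "dense_order prec M"
  unfolding dense_order_def
proof (intro conjI ballI impI)
  show "M \<noteq> {}" using arc_c3[OF T abc(1-3,5)] abc ne v0 unfolding c3_def by (metis DiffI empty_iff singletonD)
  show "\<exists>z\<in>M. prec x z \<and> prec z y" if "x \<in> M" "y \<in> M" "prec x y" for x y using prec_between[OF that] by blast
qed (use prec_irrefl prec_total prec_trans prec_unbounded in blast)+

theorem circular_representation:
  "\<exists>f \<Delta>. circular_tournament \<Delta> \<and> bij_betw f V (verts \<Delta>) \<and> (\<forall>x\<in>V. \<forall>y\<in>V. E x y \<longleftrightarrow> (f x, f y) \<in> arcs \<Delta>)"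
proof -
  have cM: "countable M" using cnt by simp
  obtain e where e: "bij_betw e M (UNIV :: rat set)" "\<forall>x\<in>M. \<forall>y\<in>M. prec x y \<longleftrightarrow> e x < e y"
    using cantor_isomorphism[OF dense_prec cM] by blast
  \<comment> \<open>\<open>arctan\<close> squeezes the line into the angles between 0 and pi.
    \<open>f\<close> undoes the rotation behind \<open>prec\<close>: in-neighbours of
    \<open>v0\<close> go to the antipodes, and \<open>v0\<close> goes to 1.\<close>
  define \<theta> where "\<theta> x = pi / 2 + arctan (of_rat (e x))" for x
  define f where "f x = (if x = v0 then 1 else if E v0 x then cis (\<theta> x) else - cis (\<theta> x))" for x
  define \<Delta> :: "complex graph" where "\<Delta> = \<lparr>verts = f ` V, arcs = {(p, q). p \<in> f ` V \<and> q \<in> f ` V \<and> 0 < Arg2pi (q / p) \<and> Arg2pi (q / p) < pi}\<rparr>"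
  have th: "0 < \<theta> x" "\<theta> x < pi" for x
    using arctan_bounded[of "of_rat (e x)"] unfolding \<theta>_def by linarith+
  have thp: "prec x y \<longleftrightarrow> \<theta> x < \<theta> y" if "x \<in> M" "y \<in> M" for x y
    using e(2) that unfolding \<theta>_def by (simp add: arctan_less_iff of_rat_less)
  have sp: "0 < sin t \<longleftrightarrow> 0 < t" if "- pi < t" "t < pi" for t :: real
  proof
    show "0 < t" if s: "0 < sin t"
    proof (rule ccontr)
      assume "\<not> 0 < t"
      then have "0 \<le> sin (- t)" using \<open>- pi < t\<close> by (intro sin_ge_zero) auto
      then show False using s by simp
    qed
    show "0 < sin t" if "0 < t" using sin_gt_zero that \<open>t < pi\<close> by blast
  qed
  have nf: "norm (f x) = 1" for x unfolding f_def by simp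
  have cd: "Im (cis t / cis s) = sin (t - s)" for s t by (simp add: cis_divide)
  \<comment> \<open>The angle from \<open>f x\<close> to \<open>f y\<close> lies strictly between 0
    and pi iff the quotient has positive imaginary part. This is the sine of a difference of angles,
    with the sign changed if the vertices lie on opposite sides.\<close>
  have EI: "E x y \<longleftrightarrow> 0 < Im (f y / f x)" if x: "x \<in> V" and y: "y \<in> V" and xy: "x \<noteq> y" for x y
  proof -
    have sn: "0 < sin (\<theta> y - \<theta> x) \<longleftrightarrow> \<theta> x < \<theta> y" "0 < sin (\<theta> x - \<theta> y) \<longleftrightarrow> \<theta> y < \<theta> x"
      using sp[of "\<theta> y - \<theta> x"] sp[of "\<theta> x - \<theta> y"] th[of x] th[of y] by linarith+
    have sm: "sin (\<theta> y - \<theta> x) = - sin (\<theta> x - \<theta> y)" using sin_minus[of "\<theta> x - \<theta> y"] by simp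
    have p1: "0 < sin (\<theta> z)" for z using sin_gt_zero th by blast
    consider "x = v0" "y \<in> M" | "y = v0" "x \<in> M" | "x \<in> M" "y \<in> M" using x y xy by blast
    then show ?thesis
    proof cases
      case 1
      then show ?thesis using p1[of y] unfolding f_def by auto
    next
      case 2
      have "Im (1 / cis (\<theta> x)) = - sin (\<theta> x)" using cd[of 0 "\<theta> x"] by simp
      moreover have "Im (1 / (- cis (\<theta> x))) = sin (\<theta> x)" using cd[of 0 "\<theta> x"] by simp
      ultimately show ?thesis using p1[of x] side[OF 2(2)] A[of x v0] 2 unfolding f_def by auto
    next
      case 3
      have m: "Im ((- cis t) / cis s) = - sin (t - s)" "Im (cis t / (- cis s)) = - sin (t - s)" "Im ((- cis t) / (- cis s)) = sin (t - s)" for s t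
        using cd[of t s] by simp_all
      have pr: "prec x y \<longleftrightarrow> (if E v0 x = E v0 y then E x y else E y x)" "prec y x \<longleftrightarrow> (if E v0 x = E v0 y then E y x else E x y)"
        unfolding prec_def by auto
      note tp = thp[OF 3] thp[OF 3(2,1)]
      show ?thesis
        using 3 pr tp sn sm cd m unfolding f_def by (cases "E v0 x"; cases "E v0 y") auto
    qed
  qed
  have arc: "E x y \<longleftrightarrow> (f x, f y) \<in> arcs \<Delta>" if "x \<in> V" "y \<in> V" for x y
  proof (cases "x = y")
    case True
    have "f x \<noteq> 0" using nf[of x] by auto
    then have "\<not> 0 < Im (f x / f x)" by simp
    then show ?thesis using True I Arg2pi_lt_pi[of "f x / f x"] unfolding \<Delta>_def by auto
  next
    case False
    show ?thesis using EI[OF that False] that Arg2pi_lt_pi[of "f y / f x"] unfolding \<Delta>_def by auto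
  qed
  have inj: "inj_on f V"
  proof (rule inj_onI, rule ccontr)
    fix x y assume xy: "x \<in> V" "y \<in> V" "f x = f y" "x \<noteq> y"
    have "f x \<noteq> 0" "f y \<noteq> 0" using nf[of x] nf[of y] by auto
    then show False using EI[of x y] EI[of y x] xy tot by auto
  qed
  have M_e: "\<exists>x\<in>M. e x = q" for q using e(1) unfolding bij_betw_def by (metis UNIV_I imageE)
  have fT: "f ` V \<subseteq> closure (f ` V)" by (rule closure_subset)
  have dn: "\<exists>z\<in>M. E v0 z = B \<and> real_of_rat (e z) \<in> {u<..<w}" if "u < w" for u w :: real and B
  proof -
    obtain q1 where q1: "u < of_rat q1" "of_rat q1 < w" using of_rat_dense[OF \<open>u < w\<close>] by blast
    obtain q2 where q2: "of_rat q1 < real_of_rat q2" "of_rat q2 < w" using of_rat_dense[OF q1(2)] by blast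
    obtain x y where xy: "x \<in> M" "e x = q1" "y \<in> M" "e y = q2" using M_e by blast
    have "prec x y" using e(2) xy q2(1) by (simp add: of_rat_less)
    then obtain z where z: "z \<in> M" "prec x z" "prec z y" "E v0 z = B" using prec_between[OF xy(1,3)] by (cases B) auto
    then have "q1 < e z" "e z < q2" using e(2) xy by auto
    then have "real_of_rat q1 < of_rat (e z)" "real_of_rat (e z) < of_rat q2" by (simp_all add: of_rat_less)
    then show ?thesis using z q1 q2 by (intro bexI[of _ z]) auto
  qed
  \<comment> \<open>The angles of one side are the image of a dense set of reals under a continuous
    map, which covers the open half circle; its end points are then limits.\<close>
  have half: "(if B then cis t else - cis t) \<in> closure (f ` V)" if t: "0 \<le> t" "t \<le> pi" for t B
  proof -
    let ?c = "\<lambda>t. if B then cis t else - cis t"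
    let ?D = "(\<lambda>z. real_of_rat (e z)) ` {z \<in> M. E v0 z = B}"
    have "closure ?D = UNIV"
    proof (intro equalityI subsetI UNIV_I)
      fix u :: real
      show "u \<in> closure ?D" unfolding closure_approachable
      proof (intro allI impI)
        fix \<epsilon> :: real assume "0 < \<epsilon>"
        then obtain z where "z \<in> M" "E v0 z = B" "real_of_rat (e z) \<in> {u<..<u + \<epsilon>}" using dn[of u "u + \<epsilon>" B] by auto
        then show "\<exists>y\<in>?D. dist y u < \<epsilon>" by (intro bexI[of _ "real_of_rat (e z)"]) (auto simp: dist_real_def)
      qed
    qed
    moreover have "(\<lambda>u. ?c (pi / 2 + arctan u)) ` closure ?D \<subseteq> closure (f ` V)"
    proof (rule image_closure_subset)
      show "continuous_on (closure ?D) (\<lambda>u. ?c (pi / 2 + arctan u))"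
        by (cases B) (auto intro!: continuous_intros)
      show "(\<lambda>u. ?c (pi / 2 + arctan u)) ` ?D \<subseteq> closure (f ` V)"
      proof (rule image_subsetI)
        fix u assume "u \<in> ?D"
        then obtain z where z: "z \<in> M" "E v0 z = B" "u = real_of_rat (e z)" by blast
        have "?c (\<theta> z) = f z" using z unfolding f_def by auto
        moreover have "f z \<in> closure (f ` V)" using z(1) fT by blast
        ultimately show "?c (pi / 2 + arctan u) \<in> closure (f ` V)" unfolding \<theta>_def z(3) by simp
      qed
    qed simp
    ultimately have u: "?c (pi / 2 + arctan u) \<in> closure (f ` V)" for u by blast
    have op: "?c t \<in> closure (f ` V)" if "0 < t" "t < pi" for t
    proof -
      have "arctan (tan (t - pi / 2)) = t - pi / 2" by (rule arctan_tan) (use that in auto)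
      then have eq: "pi / 2 + arctan (tan (t - pi / 2)) = t" by linarith
      show ?thesis using u[of "tan (t - pi / 2)"] unfolding eq .
    qed
    have "?c ` closure {0<..<pi} \<subseteq> closure (f ` V)"
    proof (rule image_closure_subset)
      show "continuous_on (closure {0<..<pi}) ?c" by (cases B) (auto intro!: continuous_intros)
    qed (use op in auto)
    then show ?thesis using t by auto
  qed
  have "sphere 0 1 \<subseteq> closure (f ` V)"
  proof
    fix z :: complex assume z: "z \<in> sphere 0 1"
    have zc: "z = cis (Arg2pi z)" using Arg2pi_eq[of z] z by (simp add: cis_conv_exp)
    show "z \<in> closure (f ` V)"
    proof (cases "Arg2pi z \<le> pi")
      case True
      then show ?thesis using half[of "Arg2pi z" True] zc Arg2pi_ge_0[of z] by simp
    next
      case False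
      have "- cis (Arg2pi z - pi) = cis (Arg2pi z)" by (simp add: complex_eq_iff)
      then show ?thesis using half[of "Arg2pi z - pi" False] zc False Arg2pi_lt_2pi[of z] by simp
    qed
  qed
  \<comment> \<open>For antipodal images both quotients are -1, with imaginary part 0, so neither
    arc would be present.\<close>
  moreover have "- p \<notin> f ` V" if p: "p \<in> f ` V" for p
  proof
    assume "- p \<in> f ` V"
    then obtain x y where xy: "x \<in> V" "y \<in> V" "p = f x" "- p = f y" using p by blast
    have n0: "f x \<noteq> 0" using nf[of x] by auto
    have "x \<noteq> y" using xy n0 by auto
    moreover have fy: "f y = - f x" using xy by simp
    moreover have "f y / f x = - 1" "f x / f y = - 1" using n0 by (simp_all add: fy)
    ultimately show False using EI[OF xy(1,2)] EI[OF xy(2,1)] tot[OF xy(1,2)] by simp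
  qed
  ultimately have "circular_tournament \<Delta>"
    unfolding circular_tournament_def \<Delta>_def using cnt nf by auto
  moreover have "bij_betw f V (verts \<Delta>)" unfolding \<Delta>_def bij_betw_def using inj by simp
  ultimately show ?thesis using arc by (intro exI[of _ f] exI[of _ \<Delta>]) blast
qed

end

section \<open>Homomorphism homogeneous posets\<close>

definition piso :: "'a rel \<Rightarrow> 'a set \<Rightarrow> ('a \<times> 'a) set \<Rightarrow> bool" where
  "piso S V r \<longleftrightarrow> finite r \<and> r \<subseteq> V \<times> V \<and>
     (\<forall>p\<in>r. \<forall>q\<in>r. (fst p = fst q \<longleftrightarrow> snd p = snd q) \<and> ((fst p, fst q) \<in> S \<longleftrightarrow> (snd p, snd q) \<in> S))"

lemma piso_converse: "piso S V r \<Longrightarrow> piso S V (r\<inverse>)"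
proof -
  assume r: "piso S V r"
  have "r\<inverse> = (\<lambda>p. (snd p, fst p)) ` r" by force
  then have "\<forall>p\<in>r\<inverse>. \<forall>q\<in>r\<inverse>. (fst p = fst q \<longleftrightarrow> snd p = snd q) \<and> ((fst p, fst q) \<in> S \<longleftrightarrow> (snd p, snd q) \<in> S)"
    using r unfolding piso_def by simp
  moreover have "finite (r\<inverse>)" "r\<inverse> \<subseteq> V \<times> V" using r unfolding piso_def by auto
  ultimately show ?thesis unfolding piso_def by blast
qed

text \<open>Extension on one side suffices: the converse of a finite partial isomorphism is again
  one, so the backward step is the forward step for the converse.\<close>

lemma homogeneousI:
  assumes "countable V" and ext: "\<And>r x. piso S V r \<Longrightarrow> x \<in> V \<Longrightarrow> \<exists>y\<in>V. piso S V (insert (x, y) r)"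
  shows "homogeneous \<lparr>verts = V, arcs = S\<rparr>"
  unfolding homogeneous_def
proof (intro allI impI)
  fix A B h
  let ?G = "\<lparr>verts = V, arcs = S\<rparr>"
  assume "A \<subseteq> verts ?G \<and> finite A \<and> B \<subseteq> verts ?G \<and> finite B \<and> is_iso h (induced ?G A) (induced ?G B)"
  then have A: "A \<subseteq> V" "finite A" "B \<subseteq> V" "finite B" and bij: "bij_betw h A B"
    and h: "\<And>x y. x \<in> A \<Longrightarrow> y \<in> A \<Longrightarrow> (x, y) \<in> S \<longleftrightarrow> (h x, h y) \<in> S \<inter> B \<times> B"
    unfolding is_iso_def induced_def by auto
  have hB: "h x \<in> B" if "x \<in> A" for x using bij that unfolding bij_betw_def by blast
  have inj: "h x = h y \<longleftrightarrow> x = y" if "x \<in> A" "y \<in> A" for x y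
    using bij that unfolding bij_betw_def inj_on_def by blast
  let ?r0 = "(\<lambda>x. (x, h x)) ` A"
  have r0: "piso S V ?r0" unfolding piso_def
  proof (intro conjI)
    show "?r0 \<subseteq> V \<times> V" using A hB by blast
    show "\<forall>p\<in>?r0. \<forall>q\<in>?r0. (fst p = fst q \<longleftrightarrow> snd p = snd q) \<and> ((fst p, fst q) \<in> S \<longleftrightarrow> (snd p, snd q) \<in> S)"
      using inj h hB by simp
  qed (use A in simp)
  have bwd: "\<exists>x\<in>V. piso S V (insert (x, y) r)" if r: "piso S V r" and y: "y \<in> V" for r y
  proof -
    obtain x where x: "x \<in> V" "piso S V (insert (y, x) (r\<inverse>))" using ext[OF piso_converse[OF r] y] by blast
    have "(insert (y, x) (r\<inverse>))\<inverse> = insert (x, y) r" by auto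
    then show ?thesis using piso_converse[OF x(2)] x(1) by auto
  qed
  have "\<exists>r. ?r0 \<subseteq> r \<and> (\<forall>x\<in>V. \<exists>y\<in>V. (x, y) \<in> r) \<and> (\<forall>y\<in>V. \<exists>x\<in>V. (x, y) \<in> r) \<and>
    (\<forall>p\<in>r. \<forall>q\<in>r. \<exists>s. piso S V s \<and> p \<in> s \<and> q \<in> s)"
    by (rule back_and_forth[where \<Phi> = "piso S V", OF assms(1) assms(1) r0]) (use ext bwd in blast)+
  then obtain r where r: "?r0 \<subseteq> r" "\<forall>x\<in>V. \<exists>y\<in>V. (x, y) \<in> r" "\<forall>y\<in>V. \<exists>x\<in>V. (x, y) \<in> r"
    "\<forall>p\<in>r. \<forall>q\<in>r. \<exists>s. piso S V s \<and> p \<in> s \<and> q \<in> s"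
    by (elim exE conjE)
  have rr: "(x = x' \<longleftrightarrow> y = y') \<and> ((x, x') \<in> S \<longleftrightarrow> (y, y') \<in> S) \<and> y \<in> V"
    if xy: "(x, y) \<in> r" "(x', y') \<in> r" for x y x' y'
  proof -
    obtain s where s: "piso S V s" "(x, y) \<in> s" "(x', y') \<in> s" using r(4) xy by blast
    have "\<forall>p\<in>s. \<forall>q\<in>s. (fst p = fst q \<longleftrightarrow> snd p = snd q) \<and> ((fst p, fst q) \<in> S \<longleftrightarrow> (snd p, snd q) \<in> S)"
      "s \<subseteq> V \<times> V" using s(1) unfolding piso_def by blast+
    from this(1)[rule_format, OF s(2,3)] this(2) s(2) show ?thesis by auto
  qed
  define g where "g x = (SOME y. (x, y) \<in> r)" for x
  have g: "(x, g x) \<in> r" if "x \<in> V" for x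
  proof -
    have "\<exists>y. (x, y) \<in> r" using r(2) that by blast
    then show ?thesis unfolding g_def by (rule someI_ex)
  qed
  have gV: "g x \<in> V" if "x \<in> V" for x using rr[OF g[OF that] g[OF that]] by blast
  have "inj_on g V"
  proof (rule inj_onI)
    fix x y assume "x \<in> V" "y \<in> V" "g x = g y"
    then show "x = y" using rr[OF g[of x] g[of y]] by simp
  qed
  moreover have "y \<in> g ` V" if yV: "y \<in> V" for y
  proof -
    obtain x where x: "x \<in> V" "(x, y) \<in> r" using r(3) yV by blast
    then have "g x = y" using rr[OF g[OF x(1)] x(2)] by simp
    then show ?thesis using x(1) by blast
  qed
  ultimately have "bij_betw g V V" unfolding bij_betw_def using gV by blast
  moreover have "(x, y) \<in> S \<longleftrightarrow> (g x, g y) \<in> S" if "x \<in> V" "y \<in> V" for x y using rr[OF g[OF that(1)] g[OF that(2)]] by blast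
  ultimately have "is_iso g ?G ?G" unfolding is_iso_def by simp
  moreover have "g x = h x" if "x \<in> A" for x
  proof -
    have "x \<in> V" "(x, h x) \<in> r" using that A r(1) by auto
    then show ?thesis using rr[OF g[of x]] by blast
  qed
  ultimately show "\<exists>g. is_iso g ?G ?G \<and> (\<forall>x\<in>A. g x = h x)" by blast
qed

lemma hh_set:
  assumes "hh E V" "phom E V r" "v \<in> V"
  shows "\<exists>w\<in>V. \<forall>x x'. (x, x') \<in> r \<longrightarrow> (E x v \<longrightarrow> E x' w) \<and> (E v x \<longrightarrow> E w x')"
proof -
  obtain w where w: "w \<in> V" "phom E V (insert (v, w) r)" using assms unfolding hh_def by blast
  then show ?thesis using phomD(2)[OF w(2)] by (intro bexI[of _ w]) blast+
qed

lemma hh_graph: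
  assumes "oriented_graph G" "hom_homogeneous G"
  shows "hh (\<lambda>x y. (x, y) \<in> arcs G) (verts G)"
  unfolding hh_def
proof (intro allI impI)
  let ?E = "\<lambda>x y. (x, y) \<in> arcs G" and ?V = "verts G"
  fix r v assume r: "phom ?E ?V r" and v: "v \<in> ?V"
  define h where "h x = (SOME x'. (x, x') \<in> r)" for x
  have h: "h x = x'" if "(x, x') \<in> r" for x x'
  proof -
    have "(x, h x) \<in> r" unfolding h_def by (rule someI[of "\<lambda>x'. (x, x') \<in> r", OF that])
    then show ?thesis using phomD(1)[OF r _ that] by blast
  qed
  have fr: "finite r" "r \<subseteq> ?V \<times> ?V" using r unfolding phom_def by blast+
  have "is_hom h (induced G (fst ` r)) (induced G (snd ` r))"
    unfolding is_hom_def induced_def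
  proof (intro conjI)
    show "h \<in> verts \<lparr>verts = fst ` r, arcs = arcs G \<inter> fst ` r \<times> fst ` r\<rparr> \<rightarrow> verts \<lparr>verts = snd ` r, arcs = arcs G \<inter> snd ` r \<times> snd ` r\<rparr>"
      using h by force
    have "(h x, h y) \<in> arcs G \<inter> snd ` r \<times> snd ` r" if xy: "(x, x') \<in> r" "(y, y') \<in> r" "(x, y) \<in> arcs G" for x y x' y'
    proof -
      have "x' \<in> snd ` r" "y' \<in> snd ` r" using xy by force+
      then show ?thesis using phomD(2)[OF r xy(1,2)] xy h by auto
    qed
    then show "\<forall>(x, y)\<in>arcs \<lparr>verts = fst ` r, arcs = arcs G \<inter> fst ` r \<times> fst ` r\<rparr>.
       (h x, h y) \<in> arcs \<lparr>verts = snd ` r, arcs = arcs G \<inter> snd ` r \<times> snd ` r\<rparr>" by auto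
  qed
  moreover have "fst ` r \<subseteq> ?V" "finite (fst ` r)" "snd ` r \<subseteq> ?V" "finite (snd ` r)" using fr by auto
  ultimately obtain g where g: "is_hom g G G" "\<forall>x\<in>fst ` r. g x = h x"
    using assms(2)[unfolded hom_homogeneous_def, rule_format, of "fst ` r" "snd ` r" h] by blast
  have gr: "g x = x'" if "(x, x') \<in> r" for x x' using g(2) h[OF that] that by force
  have gV: "g x \<in> ?V" if "x \<in> ?V" for x using g(1) that unfolding is_hom_def by blast
  have gE: "(g x, g y) \<in> arcs G" if "(x, y) \<in> arcs G" for x y using g(1) that unfolding is_hom_def by blast
  have "phom ?E ?V (insert (v, g v) r)"
  proof (rule phomI)
    show "finite (insert (v, g v) r)" using fr by simp
    fix x x' assume x: "(x, x') \<in> insert (v, g v) r"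
    show "x \<in> ?V \<and> x' \<in> ?V" using x fr v gV by blast
    fix y y' assume y: "(y, y') \<in> insert (v, g v) r"
    have "x' = g x" "y' = g y" using x y gr by blast+
    then show "x = y \<Longrightarrow> x' = y'" "(x, y) \<in> arcs G \<Longrightarrow> (x', y') \<in> arcs G" using gE by simp_all
  qed
  then show "\<exists>w\<in>?V. phom ?E ?V (insert (v, w) r)" using gV[OF v] by blast
qed

section \<open>Bounds in homomorphism homogeneous posets\<close>

locale hh_poset =
  fixes V :: "'a set" and E :: "'a \<Rightarrow> 'a \<Rightarrow> bool" and u0 u1 :: 'a
  assumes hh: "hh E V" and asyE: "asy E" and EV: "\<And>x y. E x y \<Longrightarrow> x \<in> V \<and> y \<in> V"
    and tr: "\<And>x y z. E x y \<Longrightarrow> E y z \<Longrightarrow> E x z" and arc: "E u0 u1" and cnt: "countable V"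
begin

lemma A: "E x y \<Longrightarrow> \<not> E y x" and I: "\<not> E x x"
  using asyD[OF asyE] asy_irrefl[OF asyE] by blast+

lemma up_down:
  assumes x: "x \<in> V" shows "\<exists>y\<in>V. E x y" "\<exists>y\<in>V. E y x"
proof -
  have u: "u0 \<in> V" "u1 \<in> V" using EV arc by blast+
  have "phom E V {(u0, x)}" "phom E V {(u1, x)}" by (rule phomI; use u x I in auto)+
  from hh_set[OF hh this(1) u(2)] hh_set[OF hh this(2) u(1)] show "\<exists>y\<in>V. E x y" "\<exists>y\<in>V. E y x" using arc by blast+
qed

text \<open>For \<open>u < z\<close>, fixing \<open>S\<close> and mapping \<open>u\<close> to
  \<open>z\<close> is a homomorphism, as both lie below \<open>S\<close>. An image of
  \<open>z\<close> lies strictly between \<open>z\<close> and \<open>S\<close>.\<close>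

lemma lower_bound_not_maximal:
  assumes S: "finite S" "S \<subseteq> V" and z: "z \<in> V" "\<And>a. a \<in> S \<Longrightarrow> E z a"
  shows "\<exists>w\<in>V. E z w \<and> (\<forall>a\<in>S. E w a)"
proof -
  obtain u where u: "u \<in> V" "E u z" using up_down[OF z(1)] by blast
  have ua: "E u a" "u \<noteq> a" if "a \<in> S" for a using tr[OF u(2) z(2)[OF that]] I by blast+
  have "phom E V (insert (u, z) ((\<lambda>x. (x, x)) ` S))"
    by (rule phom_one[OF asyE S u(1) z(1)]) (use ua z I A in blast)+
  from hh_set[OF hh this z(1)] obtain w where w: "w \<in> V"
    "\<forall>x x'. (x, x') \<in> insert (u, z) ((\<lambda>x. (x, x)) ` S) \<longrightarrow> (E x z \<longrightarrow> E x' w) \<and> (E z x \<longrightarrow> E w x')" by blast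
  then have "E z w" "\<forall>a\<in>S. E w a" using u z by blast+
  then show ?thesis using w by blast
qed

lemma upper_bound_not_minimal:
  assumes S: "finite S" "S \<subseteq> V" and z: "z \<in> V" "\<And>a. a \<in> S \<Longrightarrow> E a z"
  shows "\<exists>w\<in>V. E w z \<and> (\<forall>a\<in>S. E a w)"
proof -
  obtain u where u: "u \<in> V" "E z u" using up_down[OF z(1)] by blast
  have ua: "E a u" "u \<noteq> a" if "a \<in> S" for a using tr[OF z(2)[OF that] u(2)] I by blast+
  have "phom E V (insert (u, z) ((\<lambda>x. (x, x)) ` S))"
    by (rule phom_one[OF asyE S u(1) z(1)]) (use ua z I A in blast)+
  from hh_set[OF hh this z(1)] obtain w where w: "w \<in> V"
    "\<forall>x x'. (x, x') \<in> insert (u, z) ((\<lambda>x. (x, x)) ` S) \<longrightarrow> (E x z \<longrightarrow> E x' w) \<and> (E z x \<longrightarrow> E w x')" by blast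
  then have "E w z" "\<forall>a\<in>S. E a w" using u z by blast+
  then show ?thesis using w by blast
qed

lemma pair_phom:
  assumes "x \<in> V" "y \<in> V" "x \<noteq> y" "\<not> E x y" "\<not> E y x" "p \<in> V" "q \<in> V"
  shows "phom E V {(x, p), (y, q)}"
  by (rule phomI) (use assms I in auto)

text \<open>An incomparable pair may be mapped to any two vertices, and its upper bound is carried
  along; so any two vertices, and by induction any finite set, have an upper bound.\<close>

lemma directed_up:
  assumes inc: "x \<in> V" "y \<in> V" "x \<noteq> y" "\<not> E x y" "\<not> E y x" and ub: "E x u" "E y u" and S: "finite S" "S \<subseteq> V"
  shows "\<exists>w\<in>V. \<forall>a\<in>S. E a w"
  using S
proof (induction S rule: finite_induct)
  case empty then show ?case using inc by blast
next
  case (insert a S)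
  then obtain w where w: "w \<in> V" "\<forall>a\<in>S. E a w" by blast
  have "u \<in> V" using EV ub by blast
  from hh_set[OF hh pair_phom[OF inc w(1), of a] this] insert.prems ub obtain w' where "w' \<in> V" "E w w'" "E a w'" by auto
  then show ?case using w tr by blast
qed

lemma directed_down:
  assumes inc: "x \<in> V" "y \<in> V" "x \<noteq> y" "\<not> E x y" "\<not> E y x" and ub: "E u x" "E u y" and S: "finite S" "S \<subseteq> V"
  shows "\<exists>w\<in>V. \<forall>a\<in>S. E w a"
  using S
proof (induction S rule: finite_induct)
  case empty then show ?case using inc by blast
next
  case (insert a S)
  then obtain w where w: "w \<in> V" "\<forall>a\<in>S. E w a" by blast
  have "u \<in> V" using EV ub by blast
  from hh_set[OF hh pair_phom[OF inc w(1), of a] this] insert.prems ub obtain w' where "w' \<in> V" "E w' w" "E w' a" by auto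
  then show ?case using w tr by blast
qed

end

section \<open>Interpolation and the generic suborder\<close>

locale hh_poset_mid = hh_poset +
  fixes a1 a2 b1 b2 m :: 'a
  assumes X: "E a1 b1" "E a1 b2" "E a2 b1" "E a2 b2" "a1 \<noteq> a2" "\<not> E a1 a2" "\<not> E a2 a1" "b1 \<noteq> b2" "\<not> E b1 b2" "\<not> E b2 b1"
    and mid: "E a1 m" "E a2 m" "E m b1" "E m b2"
begin

text \<open>As both pairs of the \<open>X\<^sub>4\<close>-set are antichains, mapping them to
  \<open>p1, p2\<close> below \<open>q1, q2\<close> is a homomorphism even if the targets coincide
  or are comparable. The image of \<open>m\<close> interpolates, so a single midpoint serves all
  cases.\<close>

lemma mid2:
  assumes "E p1 q1" "E p1 q2" "E p2 q1" "E p2 q2"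
  shows "\<exists>w\<in>V. E p1 w \<and> E p2 w \<and> E w q1 \<and> E w q2"
proof -
  have V: "a1 \<in> V" "a2 \<in> V" "b1 \<in> V" "b2 \<in> V" "m \<in> V" "p1 \<in> V" "p2 \<in> V" "q1 \<in> V" "q2 \<in> V"
    using EV X mid assms by blast+
  have n: "\<not> E b1 a1" "\<not> E b1 a2" "\<not> E b2 a1" "\<not> E b2 a2" "a1 \<noteq> b1" "a1 \<noteq> b2" "a2 \<noteq> b1" "a2 \<noteq> b2" using X A I by metis+
  have "phom E V {(a1, p1), (a2, p2), (b1, q1), (b2, q2)}"
  proof (rule phomI)
    let ?r = "{(a1, p1), (a2, p2), (b1, q1), (b2, q2)}"
    fix x x' assume x: "(x, x') \<in> ?r"
    show "x \<in> V \<and> x' \<in> V" using x V by blast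
    fix y y' assume y: "(y, y') \<in> ?r"
    have x: "x = a1 \<and> x' = p1 \<or> x = a2 \<and> x' = p2 \<or> x = b1 \<and> x' = q1 \<or> x = b2 \<and> x' = q2"
     and y: "y = a1 \<and> y' = p1 \<or> y = a2 \<and> y' = p2 \<or> y = b1 \<and> y' = q1 \<or> y = b2 \<and> y' = q2" using x y by blast+
    from x y show "x = y \<Longrightarrow> x' = y'" by (elim disjE conjE) (use n X(5,8) in simp_all)
    from x y show "E x y \<Longrightarrow> E x' y'" by (elim disjE conjE) (use n X(6,7,9,10) I assms in simp_all)
  qed simp
  from hh_set[OF hh this V(5)] obtain w where w: "w \<in> V"
    "\<forall>x x'. (x, x') \<in> {(a1, p1), (a2, p2), (b1, q1), (b2, q2)} \<longrightarrow> (E x m \<longrightarrow> E x' w) \<and> (E m x \<longrightarrow> E w x')" by blast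
  then show ?thesis using mid by (intro bexI[of _ w]) auto
qed

lemma mid_pair:
  assumes "finite S" "S \<noteq> {}" "\<forall>b\<in>S. E p1 b \<and> E p2 b"
  shows "\<exists>w\<in>V. E p1 w \<and> E p2 w \<and> (\<forall>b\<in>S. E w b)"
  using assms
proof (induction S rule: finite_ne_induct)
  case (singleton b)
  then show ?case using mid2[of p1 b b p2] by auto
next
  case (insert b S)
  then obtain w where w: "w \<in> V" "E p1 w" "E p2 w" "\<forall>b\<in>S. E w b" by blast
  obtain w' where "w' \<in> V" "E p1 w'" "E p2 w'" "E w' w" "E w' b" using mid2[of p1 w b p2] w insert.prems by auto
  then show ?case using w tr by blast
qed

lemma interpolation0:
  assumes S: "finite S" "S \<subseteq> V" and T: "finite T" "T \<subseteq> V" and ST: "\<And>a b. a \<in> S \<Longrightarrow> b \<in> T \<Longrightarrow> E a b"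
  shows "\<exists>w\<in>V. (\<forall>a\<in>S. E a w) \<and> (\<forall>b\<in>T. E w b)"
proof (cases "S = {}")
  case True
  then show ?thesis using directed_down[OF _ _ X(8-10) X(1,2) T] EV X by blast
next
  case S0: False
  show ?thesis
  proof (cases "T = {}")
    case True
    then show ?thesis using directed_up[OF _ _ X(5-7) X(1,3) S] EV X by blast
  next
    case False
    show ?thesis using S(1) S0 ST
    proof (induction S rule: finite_ne_induct)
      case (singleton a)
      then show ?case using mid_pair[OF T(1) False, of a a] by auto
    next
      case (insert a S)
      then obtain w where w: "w \<in> V" "\<forall>a\<in>S. E a w" "\<forall>b\<in>T. E w b" by blast
      obtain w' where "w' \<in> V" "E a w'" "E w w'" "\<forall>b\<in>T. E w' b" using mid_pair[OF T(1) False, of a w] w insert.prems by auto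
      then show ?case using w tr by blast
    qed
  qed
qed

text \<open>An interpolant that hits \<open>f\<close> is added to \<open>S\<close>; the next
  interpolant lies strictly above it and so avoids \<open>f\<close>.\<close>

lemma interpolation:
  assumes "finite F" and "finite S" "S \<subseteq> V" and T: "finite T" "T \<subseteq> V" and "\<And>a b. a \<in> S \<Longrightarrow> b \<in> T \<Longrightarrow> E a b"
  shows "\<exists>w\<in>V - F. (\<forall>a\<in>S. E a w) \<and> (\<forall>b\<in>T. E w b)"
  using assms(1,2,3,6)
proof (induction F arbitrary: S rule: finite_induct)
  case empty
  then show ?case using interpolation0[OF _ _ T] by auto
next
  case (insert f F)
  obtain w where w: "w \<in> V - F" "\<forall>a\<in>S. E a w" "\<forall>b\<in>T. E w b" using insert.IH[OF insert.prems] by blast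
  show ?case
  proof (cases "w = f")
    case False
    then show ?thesis using w by blast
  next
    case True
    have "finite (insert w S)" "insert w S \<subseteq> V" using w insert.prems by auto
    moreover have "E a b" if "a \<in> insert w S" "b \<in> T" for a b using that w insert.prems by blast
    ultimately obtain w' where w': "w' \<in> V - F" "\<forall>a\<in>insert w S. E a w'" "\<forall>b\<in>T. E w' b" using insert.IH by blast
    have "w' \<noteq> f" using w'(2) True I by blast
    then show ?thesis using w' by blast
  qed
qed

text \<open>The pairs \<open>(s, t)\<close> of predecessors and successors in \<open>A\<close> of a further element of a strict poset.\<close>

definition adm :: "'a rel \<Rightarrow> 'a set \<Rightarrow> 'a set \<Rightarrow> 'a set \<Rightarrow> bool" where
  "adm R A s t \<longleftrightarrow> s \<subseteq> A \<and> t \<subseteq> A \<and> s \<times> t \<subseteq> R \<and> (\<forall>a\<in>A. \<forall>b\<in>s. (a, b) \<in> R \<longrightarrow> a \<in> s) \<and> (\<forall>a\<in>A. \<forall>b\<in>t. (b, a) \<in> R \<longrightarrow> a \<in> t)"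

definition realised :: "'a rel \<Rightarrow> 'a set \<Rightarrow> 'a set \<Rightarrow> 'a set \<Rightarrow> 'a set \<Rightarrow> bool" where
  "realised R F A s t \<longleftrightarrow> (\<exists>w\<in>F - A. \<forall>a\<in>A. ((a, w) \<in> R \<longleftrightarrow> a \<in> s) \<and> ((w, a) \<in> R \<longleftrightarrow> a \<in> t))"

lemma generic_suborder:
  "\<exists>S. S \<subseteq> {(x, y). E x y} \<and> trans S \<and> (\<forall>A s t. finite A \<longrightarrow> A \<subseteq> V \<longrightarrow> adm S A s t \<longrightarrow> realised S V A s t)"
proof -
  define P where "P c \<longleftrightarrow> finite (fst c) \<and> fst c \<subseteq> V \<and> snd c \<subseteq> {(x, y). E x y} \<inter> fst c \<times> fst c \<and> trans (snd c)"
    for c :: "'a set \<times> 'a rel"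
  \<comment> \<open>Extensions keep the order on old vertices, including incomparability, so the
    order of the union can be read off at any stage.\<close>
  define le where "le c d \<longleftrightarrow> fst c \<subseteq> fst d \<and> snd c \<inter> fst c \<times> fst c = snd d \<inter> fst c \<times> fst c" for c d :: "'a set \<times> 'a rel"
  define D where "D i c \<longleftrightarrow> fst i \<subseteq> fst c \<and> (adm (snd c) (fst i) (fst (snd i)) (snd (snd i)) \<longrightarrow>
     realised (snd c) (fst c) (fst i) (fst (snd i)) (snd (snd i)))" for i :: "'a set \<times> 'a set \<times> 'a set" and c :: "'a set \<times> 'a rel"
  define Fin where "Fin = {A. finite A \<and> A \<subseteq> V}"
  have cF: "countable Fin" unfolding Fin_def using countable_Collect_finite_subset[OF cnt] by simp
  have "\<exists>f :: nat \<Rightarrow> 'a set \<times> 'a rel. f 0 = ({}, {}) \<and> (\<forall>n. P (f n)) \<and> (\<forall>m n. m \<le> n \<longrightarrow> le (f m) (f n)) \<and>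
     (\<forall>i\<in>Fin \<times> Fin \<times> Fin. \<exists>n. D i (f n))"
  proof (rule rasiowa_sikorski)
    show "P ({}, {})" unfolding P_def by simp
    show "countable (Fin \<times> Fin \<times> Fin)" using cF by simp
    show "le p r" if "le p q" "le q r" for p q r using that unfolding le_def by blast
    fix i c assume i: "i \<in> Fin \<times> Fin \<times> Fin" and c: "P c"
    obtain A s t where ieq: "i = (A, s, t)" by (metis prod.collapse)
    obtain F0 R where ceq: "c = (F0, R)" by (metis prod.collapse)
    \<comment> \<open>Vertices of \<open>V\<close> may join a condition without new relations, so
      \<open>A\<close> is put into it at once.\<close>
    define F where "F = F0 \<union> A"
    have F: "finite F" "F \<subseteq> V" "A \<subseteq> F" and R: "R \<subseteq> {(x, y). E x y}" "R \<subseteq> F0 \<times> F0" "R \<subseteq> F \<times> F" "trans R"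
      using c i unfolding P_def ceq F_def ieq Fin_def by auto
    show "\<exists>q. P q \<and> le c q \<and> D i q"
    proof (cases "adm R A s t")
      case False
      have "P (F, R)" "le c (F, R)" unfolding P_def le_def ceq F_def using F R unfolding F_def by auto
      moreover have "D i (F, R)" unfolding D_def ieq using F False by simp
      ultimately show ?thesis by blast
    next
      case True
      \<comment> \<open>\<open>S\<close> and \<open>T\<close> are the closures that transitivity
        forces. Admissibility gives \<open>S\<close> below \<open>T\<close> in \<open>R\<close>,
        hence in \<open>E\<close>, and keeps further elements of \<open>A\<close> out of them. The
        interpolant \<open>z\<close> is related to \<open>S\<close> and \<open>T\<close> only,
        whatever else \<open>E\<close> says about it.\<close>
      define S where "S = s \<union> {f \<in> F. \<exists>a\<in>s. (f, a) \<in> R}"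
      define T where "T = t \<union> {f \<in> F. \<exists>a\<in>t. (a, f) \<in> R}"
      have st: "s \<subseteq> A" "t \<subseteq> A" "\<And>a b. a \<in> s \<Longrightarrow> b \<in> t \<Longrightarrow> (a, b) \<in> R" using True unfolding adm_def by auto
      have ST: "(a, b) \<in> R" if "a \<in> S" "b \<in> T" for a b
      proof -
        obtain a' where a': "a' \<in> s" "a = a' \<or> (a, a') \<in> R" using \<open>a \<in> S\<close> unfolding S_def by blast
        obtain b' where b': "b' \<in> t" "b = b' \<or> (b', b) \<in> R" using \<open>b \<in> T\<close> unfolding T_def by blast
        show ?thesis using st(3)[OF a'(1) b'(1)] a'(2) b'(2) transD[OF R(4)] by metis
      qed
      have sub: "S \<subseteq> F" "T \<subseteq> F" unfolding S_def T_def using st F by auto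
      then have fin: "finite S" "finite T" "S \<subseteq> V" "T \<subseteq> V" using F finite_subset by blast+
      have EST: "E a b" if "a \<in> S" "b \<in> T" for a b using ST[OF that] R(1) by blast
      from interpolation[OF F(1) fin(1,3,2,4) EST] obtain z where
        z: "z \<in> V - F" "\<forall>a\<in>S. E a z" "\<forall>b\<in>T. E z b" by blast
      define R' where "R' = R \<union> S \<times> {z} \<union> {z} \<times> T"
      have Sd: "f \<in> S" if "(f, a) \<in> R" "a \<in> S" for f a
        using that R(3) transD[OF R(4)] unfolding S_def by blast
      have Tu: "f \<in> T" if "(a, f) \<in> R" "a \<in> T" for f a
        using that R(3) transD[OF R(4)] unfolding T_def by blast
      have zR: "(z, x) \<notin> R" "(x, z) \<notin> R" "z \<notin> S" "z \<notin> T" for x using z(1) R(3) sub by blast+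
      have dis: "x \<notin> T" if "x \<in> S" for x using EST[OF that, of x] I by blast
      have "trans R'"
      proof (rule transI)
        fix x y w assume xy: "(x, y) \<in> R'" and yw: "(y, w) \<in> R'"
        have mem: "(p, q) \<in> R' \<longleftrightarrow> (p, q) \<in> R \<or> p \<in> S \<and> q = z \<or> p = z \<and> q \<in> T" for p q
          unfolding R'_def by auto
        from xy[unfolded mem] yw[unfolded mem]
        consider "(x, y) \<in> R" "(y, w) \<in> R" | "(x, y) \<in> R" "y \<in> S" "w = z" | "x \<in> S" "y = z" "w \<in> T"
          | "x = z" "y \<in> T" "(y, w) \<in> R" using zR dis by metis
        then show "(x, w) \<in> R'"
          unfolding mem by cases (use transD[OF R(4)] Sd Tu ST in metis)+
      qed
      then have "P (insert z F, R')" unfolding P_def R'_def using F R z sub by auto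
      moreover have "le c (insert z F, R')" unfolding le_def ceq R'_def using R(2) z F_def by auto
      moreover have "realised R' (insert z F) A s t" unfolding realised_def
      proof (intro bexI[of _ z] ballI)
        fix a assume a: "a \<in> A"
        have "a \<in> S \<longleftrightarrow> a \<in> s" using True a unfolding S_def adm_def by blast
        moreover have "a \<in> T \<longleftrightarrow> a \<in> t" using True a unfolding T_def adm_def by blast
        ultimately show "((a, z) \<in> R' \<longleftrightarrow> a \<in> s) \<and> ((z, a) \<in> R' \<longleftrightarrow> a \<in> t)" unfolding R'_def using zR by blast
      qed (use z F in auto)
      ultimately show ?thesis unfolding D_def ieq using F by (intro exI[of _ "(insert z F, R')"]) auto
    qed
  qed (auto simp: le_def)
  then obtain f :: "nat \<Rightarrow> 'a set \<times> 'a rel" where f: "\<forall>n. P (f n)" "\<forall>m n. m \<le> n \<longrightarrow> le (f m) (f n)"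
    "\<forall>i\<in>Fin \<times> Fin \<times> Fin. \<exists>n. D i (f n)" by blast
  define F where "F n = fst (f n)" for n
  define R where "R n = snd (f n)" for n
  define S where "S = (\<Union>n. R n)"
  have FR: "F n \<subseteq> V" "R n \<subseteq> {(x, y). E x y}" "R n \<subseteq> F n \<times> F n" "trans (R n)" for n
    using f(1) unfolding P_def F_def R_def by blast+
  have mono: "F m \<subseteq> F n" "R m = R n \<inter> F m \<times> F m" if "m \<le> n" for m n
    using f(2) that FR(3)[of m] unfolding le_def F_def R_def by blast+
  have SR: "(x, y) \<in> S \<longleftrightarrow> (x, y) \<in> R n" if xy: "x \<in> F n" "y \<in> F n" for x y n
  proof
    assume "(x, y) \<in> S"
    then obtain k where k: "(x, y) \<in> R k" unfolding S_def by blast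
    then have "(x, y) \<in> R (max k n)" using mono(2)[of k "max k n"] by auto
    then show "(x, y) \<in> R n" using mono(2)[of n "max k n"] xy by auto
  qed (auto simp: S_def)
  have "S \<subseteq> {(x, y). E x y}" unfolding S_def using FR(2) by blast
  moreover have "trans S"
  proof (rule transI)
    fix x y z assume "(x, y) \<in> S" "(y, z) \<in> S"
    then obtain k n where "(x, y) \<in> R k" "(y, z) \<in> R n" unfolding S_def by blast
    then have "(x, y) \<in> R (max k n)" "(y, z) \<in> R (max k n)" using mono(2)[of k "max k n"] mono(2)[of n "max k n"] by auto
    then have "(x, z) \<in> R (max k n)" using transD[OF FR(4)] by blast
    then show "(x, z) \<in> S" unfolding S_def by blast
  qed
  moreover have "realised S V A s t" if A: "finite A" "A \<subseteq> V" and ad: "adm S A s t" for A s t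
  proof -
    have "(A, s, t) \<in> Fin \<times> Fin \<times> Fin" using A ad finite_subset unfolding Fin_def adm_def by auto
    then obtain n where n: "D (A, s, t) (f n)" using f(3) by blast
    then have AF: "A \<subseteq> F n" unfolding D_def F_def by simp
    have eq: "(a, b) \<in> R n \<longleftrightarrow> (a, b) \<in> S" if "a \<in> A" "b \<in> A" for a b using SR[of a n b] that AF by blast
    have st: "s \<subseteq> A" "t \<subseteq> A" "s \<times> t \<subseteq> S" "\<forall>a\<in>A. \<forall>b\<in>s. (a, b) \<in> S \<longrightarrow> a \<in> s" "\<forall>a\<in>A. \<forall>b\<in>t. (b, a) \<in> S \<longrightarrow> a \<in> t"
      using ad unfolding adm_def by blast+
    have "s \<times> t \<subseteq> R n" using st(1-3) eq by blast
    moreover have "\<forall>a\<in>A. \<forall>b\<in>s. (a, b) \<in> R n \<longrightarrow> a \<in> s" using st(1,4) eq by blast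
    moreover have "\<forall>a\<in>A. \<forall>b\<in>t. (b, a) \<in> R n \<longrightarrow> a \<in> t" using st(2,5) eq by blast
    ultimately have "adm (R n) A s t" using st(1,2) unfolding adm_def by blast
    then have "realised (R n) (F n) A s t" using n unfolding D_def F_def R_def by simp
    then obtain w where w: "w \<in> F n - A" "\<forall>a\<in>A. ((a, w) \<in> R n \<longleftrightarrow> a \<in> s) \<and> ((w, a) \<in> R n \<longleftrightarrow> a \<in> t)" unfolding realised_def by blast
    have "((a, w) \<in> S \<longleftrightarrow> a \<in> s) \<and> ((w, a) \<in> S \<longleftrightarrow> a \<in> t)" if "a \<in> A" for a
      using w that SR[of a n w] SR[of w n a] AF by auto
    then show ?thesis unfolding realised_def using w FR(1) by blast
  qed
  ultimately show ?thesis by blast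
qed

text \<open>Realising all admissible pairs gives both parts of the Fraisse limit: transported
  predecessor and successor sets extend partial isomorphisms, and finite posets are embedded vertex
  by vertex.\<close>

lemma extends_generic: "\<exists>P. generic_poset P \<and> strict_poset P \<and> verts P = V \<and> arcs P \<subseteq> {(x, y). E x y}"
proof -
  obtain S where S: "S \<subseteq> {(x, y). E x y}" "trans S"
    "\<And>A s t. finite A \<Longrightarrow> A \<subseteq> V \<Longrightarrow> adm S A s t \<Longrightarrow> realised S V A s t"
    using generic_suborder by blast
  let ?P = "\<lparr>verts = V, arcs = S\<rparr>"
  have SV: "S \<subseteq> V \<times> V" and as: "\<And>x y. (x, y) \<in> S \<Longrightarrow> (y, x) \<notin> S" and ir: "\<And>x. (x, x) \<notin> S"
    using S(1) EV A by blast+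
  have V0: "V \<noteq> {}" using EV arc by blast
  have og: "oriented_graph ?P" unfolding oriented_graph_def using V0 SV as by (auto intro: asymI)
  have "homogeneous ?P"
  proof (rule homogeneousI[OF cnt])
    fix r x assume r: "piso S V r" and x: "x \<in> V"
    have fr: "finite r" "r \<subseteq> V \<times> V" using r unfolding piso_def by blast+
    have rr: "(a = b \<longleftrightarrow> a' = b') \<and> ((a, b) \<in> S \<longleftrightarrow> (a', b') \<in> S)" if ab: "(a, a') \<in> r" "(b, b') \<in> r" for a a' b b'
    proof -
      have "\<forall>p\<in>r. \<forall>q\<in>r. (fst p = fst q \<longleftrightarrow> snd p = snd q) \<and> ((fst p, fst q) \<in> S \<longleftrightarrow> (snd p, snd q) \<in> S)"
        using r unfolding piso_def by blast
      from this[rule_format, OF ab] show ?thesis by simp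
    qed
    show "\<exists>y\<in>V. piso S V (insert (x, y) r)"
    proof (cases "x \<in> fst ` r")
      case True
      then obtain y where y: "(x, y) \<in> r" by force
      then have "piso S V (insert (x, y) r)" using r by (simp add: insert_absorb)
      then show ?thesis using y fr by blast
    next
      case False
      define s where "s = {b. \<exists>a. (a, b) \<in> r \<and> (a, x) \<in> S}"
      define t where "t = {b. \<exists>a. (a, b) \<in> r \<and> (x, a) \<in> S}"
      have ms: "b \<in> s \<longleftrightarrow> (a, x) \<in> S" "b \<in> t \<longleftrightarrow> (x, a) \<in> S" if "(a, b) \<in> r" for a b
        using that rr unfolding s_def t_def by blast+
      have sub: "s \<subseteq> snd ` r" "t \<subseteq> snd ` r" unfolding s_def t_def by force+
      have "adm S (snd ` r) s t" unfolding adm_def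
      proof (intro conjI sub ballI impI subsetI)
        fix p assume "p \<in> s \<times> t"
        then obtain b b' a a' where "p = (b, b')" "(a, b) \<in> r" "(a, x) \<in> S" "(a', b') \<in> r" "(x, a') \<in> S" unfolding s_def t_def by blast
        then show "p \<in> S" using rr transD[OF S(2)] by blast
      next
        fix b b' assume b: "b \<in> snd ` r" "b' \<in> s" "(b, b') \<in> S"
        obtain a where a: "(a, b) \<in> r" using b(1) by force
        obtain a' where a': "(a', b') \<in> r" "(a', x) \<in> S" using b(2) unfolding s_def by blast
        have "(a, x) \<in> S" using rr[OF a a'(1)] b(3) a'(2) transD[OF S(2)] by blast
        then show "b \<in> s" using a unfolding s_def by blast
      next
        fix b b' assume b: "b \<in> snd ` r" "b' \<in> t" "(b', b) \<in> S"
        obtain a where a: "(a, b) \<in> r" using b(1) by force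
        obtain a' where a': "(a', b') \<in> r" "(x, a') \<in> S" using b(2) unfolding t_def by blast
        have "(x, a) \<in> S" using rr[OF a'(1) a] b(3) a'(2) transD[OF S(2)] by blast
        then show "b \<in> t" using a unfolding t_def by blast
      qed
      moreover have "finite (snd ` r)" "snd ` r \<subseteq> V" using fr by auto
      ultimately have "realised S V (snd ` r) s t" using S(3) by blast
      then obtain w where w: "w \<in> V" "w \<notin> snd ` r" "\<And>b. b \<in> snd ` r \<Longrightarrow> ((b, w) \<in> S \<longleftrightarrow> b \<in> s) \<and> ((w, b) \<in> S \<longleftrightarrow> b \<in> t)"
        unfolding realised_def by blast
      have new: "a \<noteq> x" "b \<noteq> w" "(b, w) \<in> S \<longleftrightarrow> (a, x) \<in> S" "(w, b) \<in> S \<longleftrightarrow> (x, a) \<in> S" if "(a, b) \<in> r" for a b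
      proof -
        have "b \<in> snd ` r" "a \<in> fst ` r" using that by force+
        then show "a \<noteq> x" "b \<noteq> w" "(b, w) \<in> S \<longleftrightarrow> (a, x) \<in> S" "(w, b) \<in> S \<longleftrightarrow> (x, a) \<in> S"
          using w ms[OF that] False by blast+
      qed
      have "piso S V (insert (x, w) r)" unfolding piso_def ball_insert_pairs
      proof (intro conjI ballI)
        show "finite (insert (x, w) r)" "insert (x, w) r \<subseteq> V \<times> V" using fr x w by auto
        fix p assume p: "p \<in> r"
        then have pe: "(fst p, snd p) \<in> r" by simp
        show "(fst (x, w) = fst p) = (snd (x, w) = snd p)" "(fst p = fst (x, w)) = (snd p = snd (x, w))"
          "((fst (x, w), fst p) \<in> S) = ((snd (x, w), snd p) \<in> S)" "((fst p, fst (x, w)) \<in> S) = ((snd p, snd (x, w)) \<in> S)"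
          using new[OF pe] by auto
        fix q assume "q \<in> r"
        then have qe: "(fst q, snd q) \<in> r" by simp
        show "(fst p = fst q) = (snd p = snd q)" "((fst p, fst q) \<in> S) = ((snd p, snd q) \<in> S)" using rr[OF pe qe] by blast+
      qed (use ir in simp_all)
      then show ?thesis using w(1) by blast
    qed
  qed
  moreover have "age ?P = {H. finite (verts H) \<and> strict_poset H}"
  proof (intro equalityI subsetI)
    fix H :: "nat graph" assume "H \<in> age ?P"
    then obtain B h where H: "oriented_graph H" "finite (verts H)" "is_iso h H (induced ?P B)"
      unfolding age_def isomorphic_def by blast
    have hS: "(x, y) \<in> arcs H \<longleftrightarrow> (h x, h y) \<in> S" if "x \<in> verts H" "y \<in> verts H" for x y
      using H(3) that unfolding is_iso_def induced_def bij_betw_def by auto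
    have HV: "arcs H \<subseteq> verts H \<times> verts H" using H(1) unfolding oriented_graph_def by blast
    have "trans (arcs H)"
    proof (rule transI)
      fix x y z assume xyz: "(x, y) \<in> arcs H" "(y, z) \<in> arcs H"
      then have "x \<in> verts H" "y \<in> verts H" "z \<in> verts H" using HV by blast+
      then show "(x, z) \<in> arcs H" using xyz hS transD[OF S(2)] by blast
    qed
    then show "H \<in> {H. finite (verts H) \<and> strict_poset H}" using H unfolding strict_poset_def by simp
  next
    fix H :: "nat graph" assume "H \<in> {H. finite (verts H) \<and> strict_poset H}"
    then have H: "oriented_graph H" "finite (verts H)" "trans (arcs H)" unfolding strict_poset_def by auto
    have Hir: "(x, y) \<in> arcs H \<Longrightarrow> (y, x) \<notin> arcs H" for x y using H(1) unfolding oriented_graph_def by (meson asymD)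
    have "\<exists>g. inj_on g B \<and> g ` B \<subseteq> V \<and> (\<forall>x\<in>B. \<forall>y\<in>B. (x, y) \<in> arcs H \<longleftrightarrow> (g x, g y) \<in> S)" if "finite B" for B
      using that
    proof (induction B rule: finite_induct)
      case (insert x B)
      then obtain g where g: "inj_on g B" "g ` B \<subseteq> V" "\<forall>x\<in>B. \<forall>y\<in>B. (x, y) \<in> arcs H \<longleftrightarrow> (g x, g y) \<in> S" by blast
      let ?s = "g ` {b \<in> B. (b, x) \<in> arcs H}" and ?t = "g ` {b \<in> B. (x, b) \<in> arcs H}"
      have "adm S (g ` B) ?s ?t" unfolding adm_def
      proof (intro conjI ballI impI)
        show "?s \<times> ?t \<subseteq> S" using g(3) transD[OF H(3)] by blast
        fix a b assume "a \<in> g ` B" "b \<in> ?s" "(a, b) \<in> S"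
        then show "a \<in> ?s" using g(3) transD[OF H(3)] by blast
      next
        fix a b assume "a \<in> g ` B" "b \<in> ?t" "(b, a) \<in> S"
        then show "a \<in> ?t" using g(3) transD[OF H(3)] by blast
      qed auto
      then have "realised S V (g ` B) ?s ?t" using S(3) insert.hyps g(2) by blast
      then obtain w where w: "w \<in> V" "w \<notin> g ` B" "\<And>b. b \<in> B \<Longrightarrow> ((g b, w) \<in> S \<longleftrightarrow> g b \<in> ?s) \<and> ((w, g b) \<in> S \<longleftrightarrow> g b \<in> ?t)"
        unfolding realised_def by blast
      have w2: "((g b, w) \<in> S \<longleftrightarrow> (b, x) \<in> arcs H) \<and> ((w, g b) \<in> S \<longleftrightarrow> (x, b) \<in> arcs H)" if "b \<in> B" for b
        using w(3)[OF that] g(1) that unfolding inj_on_def by blast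
      let ?g = "g(x := w)"
      have gB: "?g b = g b" if "b \<in> B" for b using that insert.hyps by auto
      have "inj_on ?g (insert x B)" using g(1) w(2) insert.hyps gB unfolding inj_on_def by auto
      moreover have "?g ` insert x B \<subseteq> V" using g(2) w(1) gB by auto
      moreover have "\<forall>y\<in>insert x B. \<forall>z\<in>insert x B. (y, z) \<in> arcs H \<longleftrightarrow> (?g y, ?g z) \<in> S"
      proof (intro ballI)
        fix y z assume "y \<in> insert x B" "z \<in> insert x B"
        then consider "y = x" "z = x" | "y = x" "z \<in> B" | "y \<in> B" "z = x" | "y \<in> B" "z \<in> B" by blast
        then show "(y, z) \<in> arcs H \<longleftrightarrow> (?g y, ?g z) \<in> S"
        proof cases
          case 1 then show ?thesis using ir[of w] Hir[of x x] by auto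
        next
          case 2 then show ?thesis using w2[OF 2(2)] gB[OF 2(2)] by simp
        next
          case 3 then show ?thesis using w2[OF 3(1)] gB[OF 3(1)] by simp
        next
          case 4 then show ?thesis using g(3) gB[OF 4(1)] gB[OF 4(2)] by simp
        qed
      qed
      ultimately show ?case by blast
    qed auto
    from this[OF H(2)] obtain g where g: "inj_on g (verts H)" "g ` verts H \<subseteq> V"
      "\<forall>x\<in>verts H. \<forall>y\<in>verts H. (x, y) \<in> arcs H \<longleftrightarrow> (g x, g y) \<in> S" by (elim exE conjE)
    have "bij_betw g (verts H) (verts (induced ?P (g ` verts H)))" using g(1) unfolding induced_def bij_betw_def by simp
    moreover have "\<forall>x\<in>verts H. \<forall>y\<in>verts H. (x, y) \<in> arcs H \<longleftrightarrow> (g x, g y) \<in> arcs (induced ?P (g ` verts H))"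
      using g(3) unfolding induced_def by simp
    ultimately have "is_iso g H (induced ?P (g ` verts H))" unfolding is_iso_def by blast
    then show "H \<in> age ?P" unfolding age_def isomorphic_def using H g(2) by auto
  qed
  ultimately have "generic_poset ?P" unfolding generic_poset_def fraisse_limit_def using og cnt by simp
  moreover have "strict_poset ?P" unfolding strict_poset_def using og S(2) by simp
  ultimately show ?thesis using S(1) by (intro exI[of _ ?P]) simp
qed

end

section \<open>Blowups of homogeneous tournaments\<close>

lemma phom_field: "phom E V r \<Longrightarrow> p \<in> r \<Longrightarrow> fst p \<in> V \<and> snd p \<in> V"
  unfolding phom_def by (metis mem_Times_iff subsetD)

lemma phom_map:
  assumes r: "phom R N r" and i: "\<And>x. x \<in> N \<Longrightarrow> i x \<in> V" "inj_on i N"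
    and E: "\<And>x y. x \<in> N \<Longrightarrow> y \<in> N \<Longrightarrow> R x y \<longleftrightarrow> E (i x) (i y)"
  shows "phom E V ((\<lambda>p. (i (fst p), i (snd p))) ` r)"
proof (rule phomI)
  have rN: "\<And>p. p \<in> r \<Longrightarrow> fst p \<in> N \<and> snd p \<in> N" using phom_field[OF r] .
  have fr: "finite r" using r unfolding phom_def by blast
  show "finite ((\<lambda>p. (i (fst p), i (snd p))) ` r)" using fr by simp
  fix x x' assume "(x, x') \<in> (\<lambda>p. (i (fst p), i (snd p))) ` r"
  then obtain p where p: "p \<in> r" "x = i (fst p)" "x' = i (snd p)" by auto
  show "x \<in> V \<and> x' \<in> V" using p rN i(1) by blast
  fix y y' assume "(y, y') \<in> (\<lambda>p. (i (fst p), i (snd p))) ` r"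
  then obtain q where q: "q \<in> r" "y = i (fst q)" "y' = i (snd q)" by auto
  have pq: "(fst p, snd p) \<in> r" "(fst q, snd q) \<in> r" using p q by simp_all
  show "x' = y'" if "x = y"
  proof -
    have "fst p = fst q" using that p q rN i(2) unfolding inj_on_def by blast
    then show ?thesis using phomD(1)[OF r pq] p q by simp
  qed
  show "E x' y'" if "E x y" using that p q rN phomD(2)[OF r pq] E by auto
qed

lemma htour_iso:
  assumes T: "htour E V" and i: "bij_betw i N V" and as: "asy R"
    and E: "\<And>x y. x \<in> N \<Longrightarrow> y \<in> N \<Longrightarrow> R x y \<longleftrightarrow> E (i x) (i y)"
  shows "htour R N"
proof -
  have iV: "i x \<in> V" if "x \<in> N" for x using i that unfolding bij_betw_def by blast
  have inj: "inj_on i N" using i unfolding bij_betw_def by blast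
  define j where "j = inv_into N i"
  have j: "bij_betw j V N" unfolding j_def by (rule bij_betw_inv_into[OF i])
  have jN: "j x \<in> N" "i (j x) = x" if "x \<in> V" for x
    using that j i unfolding j_def bij_betw_def by (auto simp: f_inv_into_f inv_into_into)
  have ji: "j (i x) = x" if "x \<in> N" for x unfolding j_def by (rule inv_into_f_f[OF inj that])
  have injj: "inj_on j V" using j unfolding bij_betw_def by blast
  have tR: "tour R N" unfolding tour_def
  proof (intro conjI as ballI impI)
    fix x y assume "x \<in> N" "y \<in> N" "x \<noteq> y"
    then show "R x y \<or> R y x" using E htourD[OF T iV iV] inj unfolding inj_on_def by blast
  qed
  have "hh R N" unfolding hh_def
  proof (intro allI impI)
    fix r v assume r: "phom R N r" and v: "v \<in> N"
    let ?m = "\<lambda>p. (i (fst p), i (snd p))"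
    have "phom E V (?m ` r)" by (rule phom_map[OF r iV inj E])
    then obtain w where w: "w \<in> V" "phom E V (insert (i v, w) (?m ` r))" using htour_hh[OF T] iV[OF v] by blast
    let ?k = "\<lambda>p. (j (fst p), j (snd p))"
    have k: "phom R N (?k ` insert (i v, w) (?m ` r))"
      by (rule phom_map[OF w(2) jN(1) injj]) (use E jN in auto)
    have "?k (?m p) = p" if "p \<in> r" for p
    proof -
      have "fst p \<in> N" "snd p \<in> N" using phom_field[OF r that] by blast+
      then show ?thesis using ji by simp
    qed
    then have "?k ` (?m ` r) = r" unfolding image_image by simp
    then have "?k ` insert (i v, w) (?m ` r) = insert (v, j w) r" using ji[OF v] by simp
    then show "\<exists>w\<in>N. phom R N (insert (v, w) r)" using k jN(1)[OF w(1)] by auto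
  qed
  then show ?thesis using tR unfolding htour_def by blast
qed

lemma generic_tournamentI:
  fixes E :: "nat \<Rightarrow> nat \<Rightarrow> bool"
  assumes G: "good E V"
  shows "generic_tournament \<lparr>verts = V, arcs = {(x, y). x \<in> V \<and> y \<in> V \<and> E x y}\<rparr>"
proof -
  let ?S = "{(x, y). x \<in> V \<and> y \<in> V \<and> E x y}"
  let ?G = "\<lparr>verts = V, arcs = ?S\<rparr>"
  have T: "htour E V" using G by (rule good_htour)
  note A = asyD[OF htour_asy[OF T]] and I = asy_irrefl[OF htour_asy[OF T]]
  have tr: "tour E V" using T unfolding htour_def by blast
  have V0: "V \<noteq> {}" using G by (rule goodE) blast
  have "asym ?S" using A by (intro asymI) blast
  then have og: "oriented_graph ?G" unfolding oriented_graph_def using V0 by auto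
  have cnt: "countable V" by simp
  have "homogeneous ?G"
  proof (rule homogeneousI[OF cnt])
    fix r x assume r: "piso ?S V r" and x: "x \<in> V"
    have rr: "(a = b \<longleftrightarrow> a' = b') \<and> ((a, b) \<in> ?S \<longleftrightarrow> (a', b') \<in> ?S)" if ab: "(a, a') \<in> r" "(b, b') \<in> r" for a a' b b'
    proof -
      have "\<forall>p\<in>r. \<forall>q\<in>r. (fst p = fst q \<longleftrightarrow> snd p = snd q) \<and> ((fst p, fst q) \<in> ?S \<longleftrightarrow> (snd p, snd q) \<in> ?S)"
        using r unfolding piso_def by blast
      from this[rule_format, OF ab] show ?thesis by simp
    qed
    have fr: "finite r" "r \<subseteq> V \<times> V" using r unfolding piso_def by blast+
    have "phom E V r"
    proof (rule phomI[OF fr(1)])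
      fix a a' assume a: "(a, a') \<in> r"
      show "a \<in> V \<and> a' \<in> V" using a fr by blast
      fix b b' assume b: "(b, b') \<in> r"
      show "a = b \<Longrightarrow> a' = b'" "E a b \<Longrightarrow> E a' b'" using rr[OF a b] a b fr by blast+
    qed
    then obtain w where w: "w \<in> V" "phom E V (insert (x, w) r)" using htour_hh[OF T] x by blast
    have "piso ?S V (insert (x, w) r)" unfolding piso_def
    proof (intro conjI)
      show sub: "insert (x, w) r \<subseteq> V \<times> V" using fr w x by auto
      show "\<forall>p\<in>insert (x, w) r. \<forall>q\<in>insert (x, w) r. (fst p = fst q \<longleftrightarrow> snd p = snd q) \<and> ((fst p, fst q) \<in> ?S \<longleftrightarrow> (snd p, snd q) \<in> ?S)"
      proof (intro ballI)
        fix p q assume p: "p \<in> insert (x, w) r" and q: "q \<in> insert (x, w) r"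
        have "(fst p, snd p) \<in> insert (x, w) r" "(fst q, snd q) \<in> insert (x, w) r" using p q by simp_all
        from phom_iff[OF tr w(2) this] show "(fst p = fst q \<longleftrightarrow> snd p = snd q) \<and> ((fst p, fst q) \<in> ?S \<longleftrightarrow> (snd p, snd q) \<in> ?S)"
          using sub p q by auto
      qed
    qed (use fr in simp)
    then show "\<exists>y\<in>V. piso ?S V (insert (x, y) r)" using w(1) by blast
  qed
  moreover have "age ?G = {H. finite (verts H) \<and> tournament H}"
  proof (intro equalityI subsetI)
    fix H :: "nat graph" assume "H \<in> age ?G"
    then obtain B h where H: "oriented_graph H" "finite (verts H)" "B \<subseteq> V" "is_iso h H (induced ?G B)"
      unfolding age_def isomorphic_def by auto
    have "(x, y) \<in> arcs H \<or> (y, x) \<in> arcs H" if xy: "x \<in> verts H" "y \<in> verts H" "x \<noteq> y" for x y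
    proof -
      have hB: "h x \<in> B" "h y \<in> B" "h x \<noteq> h y" using H(4) xy unfolding is_iso_def induced_def bij_betw_def inj_on_def by auto
      have "E (h x) (h y) \<or> E (h y) (h x)" using tourD[OF tr] hB H(3) by blast
      then show ?thesis using H(3,4) xy hB unfolding is_iso_def induced_def by auto
    qed
    then have "total_on (verts H) (arcs H)" unfolding total_on_def by blast
    then show "H \<in> {H. finite (verts H) \<and> tournament H}" using H unfolding tournament_def by simp
  next
    fix H :: "nat graph" assume "H \<in> {H. finite (verts H) \<and> tournament H}"
    then have H: "oriented_graph H" "finite (verts H)" "total_on (verts H) (arcs H)" unfolding tournament_def by auto
    let ?R = "\<lambda>x y. (x, y) \<in> arcs H"
    have aH: "asy ?R" using H(1) unfolding oriented_graph_def asy_def by (meson asymD)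
    then have tH: "tour ?R (verts H)" using H(3) unfolding tour_def total_on_def by blast
    obtain g where g: "\<forall>x\<in>verts H. g x \<in> V \<and> (\<forall>y\<in>verts H. ?R x y \<longleftrightarrow> E (g x) (g y))"
      using good_embeds_nat[OF G H(2) refl tH] by blast
    have "inj_on g (verts H)" by (rule inj_onI) (use g tourD[OF tH] I in metis)
    then have "is_iso g H (induced ?G (g ` verts H))" unfolding is_iso_def induced_def bij_betw_def using g by auto
    moreover have "g ` verts H \<subseteq> verts ?G" using g by auto
    ultimately show "H \<in> age ?G" unfolding age_def isomorphic_def using H by blast
  qed
  ultimately show ?thesis unfolding generic_tournament_def fraisse_limit_def using og cnt by simp
qed

section \<open>Non-adjacency and the quotient tournament\<close>

locale hh_nontransitive =
  fixes V :: "'a set" and E :: "'a \<Rightarrow> 'a \<Rightarrow> bool" and a0 b0 c0 :: 'a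
  assumes hh: "hh E V" and asyE: "asy E" and EV: "\<And>x y. E x y \<Longrightarrow> x \<in> V \<and> y \<in> V" and cnt: "countable V"
    and conn: "\<And>x y. x \<in> V \<Longrightarrow> y \<in> V \<Longrightarrow> (x, y) \<in> ({(x, y). E x y} \<union> {(x, y). E x y}\<inverse>)\<^sup>*"
    and nontrans: "E a0 b0" "E b0 c0" "\<not> E a0 c0"
begin

definition adj where "adj x y \<longleftrightarrow> E x y \<or> E y x"

lemma A: "E x y \<Longrightarrow> \<not> E y x" and I: "\<not> E x x"
  using asyD[OF asyE] asy_irrefl[OF asyE] by blast+

lemma adj_sym: "adj x y \<longleftrightarrow> adj y x" unfolding adj_def by blast

lemma hh2:
  assumes "x \<in> V" "y \<in> V" "p \<in> V" "q \<in> V" "v \<in> V" "x \<noteq> y" "E x y \<Longrightarrow> E p q" "E y x \<Longrightarrow> E q p"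
  shows "\<exists>w\<in>V. (E x v \<longrightarrow> E p w) \<and> (E v x \<longrightarrow> E w p) \<and> (E y v \<longrightarrow> E q w) \<and> (E v y \<longrightarrow> E w q)"
proof -
  have "phom E V {(x, p), (y, q)}" by (rule phomI) (use assms I in auto)
  from hh_set[OF hh this assms(5)] obtain w where w: "w \<in> V"
    "\<forall>a a'. (a, a') \<in> {(x, p), (y, q)} \<longrightarrow> (E a v \<longrightarrow> E a' w) \<and> (E v a \<longrightarrow> E w a')" by blast
  then show ?thesis by (intro bexI[of _ w]) auto
qed

lemma path_adj:
  assumes "E a b" "E b c" shows "adj a c"
proof (rule ccontr)
  assume n: "\<not> adj a c"
  have V: "a \<in> V" "b \<in> V" "c \<in> V" using EV assms by blast+
  have "a \<noteq> c" using assms A by blast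
  from hh2[OF V(1,3) V(1) V(1) V(2) this] n obtain w where "E a w" "E w a" using assms unfolding adj_def by blast
  then show False using A by blast
qed

lemma c0a0: "E c0 a0" using path_adj[OF nontrans(1,2)] nontrans(3) unfolding adj_def by blast

lemma arc_in_c3:
  assumes "E x y" shows "\<exists>z\<in>V. E y z \<and> E z x"
proof -
  have V: "a0 \<in> V" "b0 \<in> V" "c0 \<in> V" "x \<in> V" "y \<in> V" using EV assms nontrans by blast+
  have "a0 \<noteq> b0" using nontrans(1) I by blast
  from hh2[OF V(1,2,4,5,3) this] obtain z where "z \<in> V" "E z x" "E y z" using assms nontrans c0a0 A by blast
  then show ?thesis by blast
qed

text \<open>Some non-adjacent \<open>u\<close>, \<open>v\<close> have a common neighbour
  \<open>w\<close>; otherwise everything connected to \<open>z\<close> would be \<open>z\<close> or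
  adjacent to it. By \<open>path_adj\<close>, \<open>w\<close> is a common in-neighbour or a common
  out-neighbour, and a 3-cycle through it supplies the other kind. A non-adjacent pair maps to any
  two vertices, so \<open>p\<close> and \<open>q\<close> inherit both kinds.\<close>

lemma common_neighbours:
  assumes xz: "x \<in> V" "z \<in> V" "x \<noteq> z" "\<not> adj x z" and pq: "p \<in> V" "q \<in> V"
  shows "\<exists>w\<in>V. E p w \<and> E q w" "\<exists>w\<in>V. E w p \<and> E w q"
proof -
  have "\<exists>u v w. u \<noteq> v \<and> \<not> adj u v \<and> adj u w \<and> adj v w"
  proof (rule ccontr)
    assume n: "\<not> ?thesis"
    have "y = z \<or> adj z y" if "(z, y) \<in> ({(x, y). E x y} \<union> {(x, y). E x y}\<inverse>)\<^sup>*" for y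
      using that
    proof (induction rule: rtrancl_induct)
      case (step y y')
      have yy: "adj y y'" using step(2) unfolding adj_def by blast
      show ?case
      proof (cases "y = z")
        case True then show ?thesis using yy by blast
      next
        case False
        then have "adj z y" using step.IH by blast
        then show ?thesis using n yy adj_sym[of y y'] by (metis)
      qed
    qed simp
    from this[OF conn[OF xz(2,1)]] show False using xz adj_sym[of x z] by blast
  qed
  then obtain u v w where u: "u \<noteq> v" "\<not> adj u v" "adj u w" "adj v w" by blast
  have uv: "\<not> E u v" "\<not> E v u" using u unfolding adj_def by blast+
  have V: "u \<in> V" "v \<in> V" "w \<in> V" using u EV unfolding adj_def by blast+
  have both: "(\<exists>s\<in>V. E s u \<and> E s v) \<and> (\<exists>t\<in>V. E u t \<and> E v t)"
  proof -
    have "(E w u \<and> E w v) \<or> (E u w \<and> E v w)"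
      using u path_adj[of u w v] path_adj[of v w u] adj_sym unfolding adj_def by blast
    then show ?thesis
    proof
      assume w: "E w u \<and> E w v"
      obtain c where c: "c \<in> V" "E u c" "E c w" using arc_in_c3 w by blast
      have "adj c v" using path_adj[of c w v] c w by blast
      then have "E v c" using path_adj[of u c v] c u unfolding adj_def by blast
      then show ?thesis using c w V by blast
    next
      assume w: "E u w \<and> E v w"
      obtain c where c: "c \<in> V" "E w c" "E c u" using arc_in_c3 w by blast
      have "adj v c" using path_adj[of v w c] c w by blast
      then have "E c v" using path_adj[of v c u] c u adj_sym unfolding adj_def by blast
      then show ?thesis using c w V by blast
    qed
  qed
  then obtain s t where st: "s \<in> V" "E s u" "E s v" "t \<in> V" "E u t" "E v t" by blast
  show "\<exists>w\<in>V. E p w \<and> E q w" using hh2[OF V(1,2) pq st(4) u(1)] uv st by blast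
  show "\<exists>w\<in>V. E w p \<and> E w q" using hh2[OF V(1,2) pq st(1) u(1)] uv st by blast
qed

text \<open>Let \<open>t\<close> close a 3-cycle over \<open>x -> y\<close>, and let
  \<open>w\<close> and \<open>s\<close> be a common out- and in-neighbour of \<open>x\<close> and
  \<open>z\<close>. By \<open>path_adj\<close> all of \<open>x\<close>, \<open>y\<close>,
  \<open>t\<close> dominate \<open>w\<close> and are dominated by \<open>s\<close>, so
  \<open>s, t, x\<close> maps to \<open>x, y, w\<close>. The image \<open>v\<close> of
  \<open>y\<close> satisfies \<open>x -> v -> y\<close> and \<open>w -> v\<close>. Then
  \<open>z -> w -> v\<close> makes \<open>z\<close> adjacent to \<open>v\<close>, and either arc
  makes it adjacent to \<open>x\<close> or \<open>y\<close>.\<close>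

lemma no_isolated_arc:
  assumes xy: "E x y" and z: "z \<in> V" "\<not> adj x z" "\<not> adj y z"
  shows "z = x \<or> z = y"
proof (rule ccontr)
  assume "\<not> ?thesis"
  then have ne: "x \<noteq> z" "y \<noteq> z" by auto
  have V: "x \<in> V" "y \<in> V" using EV xy by blast+
  note zz = z(2,3)[unfolded adj_def]
  have pa: "E a b \<Longrightarrow> E b c \<Longrightarrow> E a c \<or> E c a" for a b c using path_adj unfolding adj_def by blast
  obtain t where t: "t \<in> V" "E y t" "E t x" using arc_in_c3[OF xy] by blast
  have tz: "\<not> E z t" "\<not> E t z" using pa[of z t x] pa[of y t z] t zz by blast+
  obtain w where w: "w \<in> V" "E x w" "E z w" using common_neighbours(1)[OF V(1) z(1) ne(1) z(2) V(1) z(1)] by blast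
  have tw: "E t w" using pa[of t x w] pa[of z w t] t w tz by blast
  have yw: "E y w" using pa[of y t w] pa[of z w y] t tw w zz by blast
  obtain s where s: "s \<in> V" "E s x" "E s z" using common_neighbours(2)[OF V(1) z(1) ne(1) z(2) V(1) z(1)] by blast
  have sy: "E s y" using pa[of s x y] pa[of y s z] s xy zz by blast
  have st: "E s t" using pa[of s y t] pa[of t s z] s sy t tz by blast
  have "phom E V {(s, x), (t, y), (x, w)}"
    by (rule phomI) (use s t w V st xy yw A I in auto)
  from hh_set[OF hh this V(2)] obtain v where v: "v \<in> V"
    "\<forall>a a'. (a, a') \<in> {(s, x), (t, y), (x, w)} \<longrightarrow> (E a y \<longrightarrow> E a' v) \<and> (E y a \<longrightarrow> E v a')" by blast
  have v': "E x v" "E v y" "E w v" using v(2) sy t xy by blast+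
  have "E z v \<or> E v z" using pa[of z w v] w v' by blast
  then show False using pa[of x v z] pa[of z v y] v' zz by blast
qed

definition sim where "sim x y \<longleftrightarrow> x = y \<or> \<not> adj x y"

lemma sim_sym: "sim x y \<longleftrightarrow> sim y x" unfolding sim_def using adj_sym by blast

lemma sim_trans:
  assumes V: "x \<in> V" "y \<in> V" "z \<in> V" and "sim x y" "sim y z"
  shows "sim x z"
proof (rule ccontr)
  assume n: "\<not> sim x z"
  then have xz: "x \<noteq> z" "adj x z" unfolding sim_def by blast+
  then have "x \<noteq> y" "y \<noteq> z" using assms n by (auto simp: sim_def)
  then have "\<not> adj x y" "\<not> adj z y" using assms adj_sym unfolding sim_def by blast+
  then show False using no_isolated_arc[of x z y] no_isolated_arc[of z x y] xz V \<open>x \<noteq> y\<close> \<open>y \<noteq> z\<close> unfolding adj_def by blast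
qed

lemma sim_out:
  assumes p: "sim p q" and px: "E p x" and q: "q \<in> V" shows "E q x"
proof (cases "p = q")
  case False
  then have n: "\<not> adj p q" using p unfolding sim_def by blast
  have "q \<noteq> x" using n px unfolding adj_def by blast
  have "adj x q"
  proof (rule ccontr)
    assume "\<not> adj x q"
    then show False using no_isolated_arc[OF px q n] False \<open>q \<noteq> x\<close> by blast
  qed
  then show ?thesis using path_adj[OF px, of q] n unfolding adj_def by blast
qed (use px in simp)

lemma sim_in:
  assumes p: "sim p q" and px: "E x p" and q: "q \<in> V" shows "E x q"
proof (cases "p = q")
  case False
  then have n: "\<not> adj p q" using p unfolding sim_def by blast
  have "q \<noteq> x" using n px unfolding adj_def by blast
  have "adj x q"
  proof (rule ccontr)
    assume "\<not> adj x q"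
    then show False using no_isolated_arc[OF px q] n False \<open>q \<noteq> x\<close> by blast
  qed
  then show ?thesis using path_adj[of q x p] px n adj_sym unfolding adj_def by blast
qed (use px in simp)

text \<open>The choice depends only on the class, because equivalent vertices have the same
  candidates, see \<open>rep_eq\<close>. Representatives are vertices, so the quotient is a subset
  of \<open>V\<close> with the same \<open>E\<close>.\<close>

definition rep where "rep p = (SOME q. q \<in> V \<and> sim p q)"

abbreviation "T \<equiv> rep ` V"

lemma rep: assumes "p \<in> V" shows "rep p \<in> V" "sim p (rep p)"
proof -
  have "p \<in> V \<and> sim p p" using assms unfolding sim_def by blast
  then have "rep p \<in> V \<and> sim p (rep p)" unfolding rep_def by (rule someI)
  then show "rep p \<in> V" "sim p (rep p)" by blast+
qed

lemma rep_eq: assumes "p \<in> V" "q \<in> V" "sim p q" shows "rep p = rep q"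
proof -
  have "(x \<in> V \<and> sim p x) \<longleftrightarrow> (x \<in> V \<and> sim q x)" for x
    using sim_trans[of p q x] sim_trans[of q p x] assms sim_sym by blast
  then show ?thesis unfolding rep_def by simp
qed

lemma rep_E: assumes "p \<in> V" "q \<in> V" shows "E p q \<longleftrightarrow> E (rep p) (rep q)"
proof
  assume "E p q"
  then have "E (rep p) q" using sim_out[OF rep(2)[OF assms(1)]] rep(1)[OF assms(1)] by blast
  then show "E (rep p) (rep q)" using sim_in[OF rep(2)[OF assms(2)]] rep(1)[OF assms(2)] by blast
next
  assume "E (rep p) (rep q)"
  then have "E p (rep q)" using sim_out[of "rep p" p "rep q"] rep(2)[OF assms(1)] sim_sym assms by blast
  then show "E p q" using sim_in[of "rep q" q p] rep(2)[OF assms(2)] sim_sym assms by blast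
qed

lemma rep_rep: "p \<in> V \<Longrightarrow> rep (rep p) = rep p"
  using rep_eq[of p "rep p"] rep[of p] by simp

lemma TV: "T \<subseteq> V" using rep(1) by blast

text \<open>\<open>rep\<close> preserves and reflects arcs, so it brings images found in
  \<open>V\<close> back into \<open>T\<close>.\<close>

lemma htour_T: "htour E T"
  unfolding htour_def
proof
  show "tour E T" unfolding tour_def
  proof (intro conjI asyE ballI impI)
    fix x y assume xy: "x \<in> T" "y \<in> T" "x \<noteq> y"
    then have xv: "x \<in> V" "y \<in> V" "rep x = x" "rep y = y" using TV rep_rep by auto
    have "\<not> sim x y" using rep_eq[OF xv(1,2)] xv(3,4) xy(3) by auto
    then show "E x y \<or> E y x" unfolding sim_def adj_def by blast
  qed
  show "hh E T" unfolding hh_def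
  proof (intro allI impI)
    fix r v assume r: "phom E T r" and v: "v \<in> T"
    have rT: "r \<subseteq> T \<times> T" "finite r" using r unfolding phom_def by blast+
    have "phom E V r" using phom_restrict[OF r] rT TV by blast
    then obtain w where w: "w \<in> V" "phom E V (insert (v, w) r)" using hh v TV unfolding hh_def by blast
    have "phom E T (insert (v, rep w) r)"
    proof (rule phomI)
      show "finite (insert (v, rep w) r)" using rT by simp
      fix x x' assume x: "(x, x') \<in> insert (v, rep w) r"
      show "x \<in> T \<and> x' \<in> T" using x rT v w by blast
      fix y y' assume y: "(y, y') \<in> insert (v, rep w) r"
      have lift: "\<exists>b'. (b, b') \<in> insert (v, w) r \<and> b' \<in> V \<and> rep b' = c" if "(b, c) \<in> insert (v, rep w) r" for b c
      proof (cases "(b, c) \<in> r")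
        case True
        then have "c \<in> T" using rT by blast
        then show ?thesis using True rep_rep TV by auto
      next
        case False
        then show ?thesis using that w by auto
      qed
      obtain x1 where x1: "(x, x1) \<in> insert (v, w) r" "x1 \<in> V" "rep x1 = x'" using lift[OF x] by blast
      obtain y1 where y1: "(y, y1) \<in> insert (v, w) r" "y1 \<in> V" "rep y1 = y'" using lift[OF y] by blast
      show "x' = y'" if "x = y" using phomD(1)[OF w(2) x1(1) y1(1) that] x1 y1 by simp
      show "E x' y'" if "E x y" using phomD(2)[OF w(2) x1(1) y1(1) that] rep_E[OF x1(2) y1(2)] x1(3) y1(3) by simp
    qed
    then show "\<exists>w\<in>T. phom E T (insert (v, w) r)" using w(1) by blast
  qed
qed

lemma T_c3: "rep a0 \<in> T" "rep b0 \<in> T" "rep c0 \<in> T" "c3 E (rep a0) (rep b0) (rep c0)"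
proof -
  have V: "a0 \<in> V" "b0 \<in> V" "c0 \<in> V" using EV nontrans by blast+
  then show "rep a0 \<in> T" "rep b0 \<in> T" "rep c0 \<in> T" by blast+
  show "c3 E (rep a0) (rep b0) (rep c0)" unfolding c3_def using V nontrans c0a0 rep_E by blast
qed

lemma not_sim_rep: "p \<in> V \<Longrightarrow> q \<in> V \<Longrightarrow> rep p = rep q \<Longrightarrow> p \<noteq> q \<Longrightarrow> \<not> E p q \<and> \<not> E q p"
  using rep_E[of p q] rep_E[of q p] I by metis

lemma card_gt_2: "\<not> (finite S \<and> card S \<le> 2) \<Longrightarrow> \<exists>x\<in>S. \<exists>y\<in>S. \<exists>z\<in>S. x \<noteq> y \<and> y \<noteq> z \<and> x \<noteq> z"
proof -
  assume n: "\<not> (finite S \<and> card S \<le> 2)"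
  have "\<exists>B\<subseteq>S. finite B \<and> card B = 3"
  proof (cases "finite S")
    case True
    then have "3 \<le> card S" using n by simp
    then show ?thesis by (metis obtain_subset_with_card_n finite_subset True)
  next
    case False
    then show ?thesis using infinite_arbitrarily_large[of S 3] by blast
  qed
  then show ?thesis using card_3_iff[of "_ :: 'b set"] by (metis insert_subset insertI1)
qed

lemma blowup_eq:
  assumes "bij_betw f T (verts D)" and fE: "\<And>x y. x \<in> T \<Longrightarrow> y \<in> T \<Longrightarrow> E x y \<longleftrightarrow> (f x, f y) \<in> arcs D"
  shows "(f \<circ> rep) ` V = verts D" "\<lparr>verts = V, arcs = {(x, y). E x y}\<rparr> = blowup D V (f \<circ> rep)"
proof -
  show "(f \<circ> rep) ` V = verts D" using assms(1) unfolding bij_betw_def by (metis image_comp)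
  have "E x y \<longleftrightarrow> x \<in> V \<and> y \<in> V \<and> (f (rep x), f (rep y)) \<in> arcs D" for x y
    using EV[of x y] rep_E[of x y] fE[of "rep x" "rep y"] by blast
  then show "\<lparr>verts = V, arcs = {(x, y). E x y}\<rparr> = blowup D V (f \<circ> rep)" unfolding blowup_def by simp
qed

theorem classification:
  "isomorphic \<lparr>verts = V, arcs = {(x, y). E x y}\<rparr> C3 \<or>
     (\<exists>(\<Delta> :: complex graph) (S :: 'a set) f.
       circular_tournament \<Delta> \<and> countable S \<and> f ` S = verts \<Delta> \<and>
       (\<forall>v\<in>verts \<Delta>. finite {s \<in> S. f s = v} \<and> card {s \<in> S. f s = v} \<le> 2) \<and>
       \<lparr>verts = V, arcs = {(x, y). E x y}\<rparr> = blowup \<Delta> S f) \<or>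
     (\<exists>(\<Delta> :: nat graph) (S :: 'a set) f.
       generic_tournament \<Delta> \<and> countable S \<and> f ` S = verts \<Delta> \<and> \<lparr>verts = V, arcs = {(x, y). E x y}\<rparr> = blowup \<Delta> S f)"
proof -
  have cT: "countable T" using cnt by simp
  have V: "a0 \<in> V" "b0 \<in> V" "c0 \<in> V" using EV nontrans by blast+
  define a b c where "a = rep a0" and "b = rep b0" and "c = rep c0"
  have abc: "a \<in> T" "b \<in> T" "c \<in> T" "c3 E a b c" using T_c3 unfolding a_def b_def c_def by blast+
  have e: "E a b" "E b c" "E c a" using abc(4) unfolding c3_def by blast+
  show ?thesis
  proof (cases "good E T")
    case True
    \<comment> \<open>The generic tournament is a graph on natural numbers, so \<open>T\<close> is
      copied there along an enumeration.\<close>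
    define j where "j = from_nat_into T"
    define N where "N = to_nat_on T ` T"
    have bij: "bij_betw (to_nat_on T) T N" unfolding N_def using inj_on_to_nat_on[OF cT] by (rule inj_on_imp_bij_betw)
    have j: "j (to_nat_on T x) = x" if "x \<in> T" for x unfolding j_def using cT that by simp
    have jN: "j n \<in> T" if "n \<in> N" for n using that j unfolding N_def by auto
    have bj: "bij_betw j N T" by (rule bij_betw_byWitness[of _ "to_nat_on T"]) (use j in \<open>auto simp: N_def\<close>)
    define R where "R m n \<longleftrightarrow> E (j m) (j n)" for m n
    have "asy R" using asyE unfolding asy_def R_def by blast
    then have hR: "htour R N" by (rule htour_iso[OF htour_T bj]) (simp add: R_def)
    obtain i' a' b' c' where g: "i' \<in> T" "a' \<in> T" "b' \<in> T" "c' \<in> T" "c3 E a' b' c'" "E i' a'" "E i' b'" "E i' c'"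
      using True by (rule goodE)
    have "good R N"
      by (rule goodI[OF hR, of "to_nat_on T i'" "to_nat_on T a'" "to_nat_on T b'" "to_nat_on T c'"])
        (use g j in \<open>simp_all add: N_def R_def c3_def\<close>)
    from generic_tournamentI[OF this] have gt: "generic_tournament \<lparr>verts = N, arcs = {(x, y). x \<in> N \<and> y \<in> N \<and> R x y}\<rparr>" .
    let ?D = "\<lparr>verts = N, arcs = {(x, y). x \<in> N \<and> y \<in> N \<and> R x y}\<rparr>"
    have fE: "E x y \<longleftrightarrow> (to_nat_on T x, to_nat_on T y) \<in> arcs ?D" if "x \<in> T" "y \<in> T" for x y
      using that j unfolding R_def N_def by auto
    have "bij_betw (to_nat_on T) T (verts ?D)" using bij by simp
    note B = blowup_eq[OF this fE]
    show ?thesis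
      by (rule disjI2, rule disjI2, rule exI[of _ ?D], rule exI[of _ V], rule exI[of _ "to_nat_on T \<circ> rep"],
          intro conjI gt cnt B)
  next
    case False
    have nd: "\<not> E i z" if "i \<in> T" "x \<in> T" "y \<in> T" "z \<in> T" "c3 E x y z" "E i x" "E i y" for i x y z
      using False goodI[OF htour_T that(1-5)] that(6,7) by blast
    have nd2: "\<not> (E a i \<and> E b i \<and> E c i)" if i: "i \<in> T" for i
    proof
      assume ei: "E a i \<and> E b i \<and> E c i"
      show False
        by (rule not_dominating_c3[OF htour_T abc _ i ei[THEN conjunct1] ei[THEN conjunct2, THEN conjunct1] ei[THEN conjunct2, THEN conjunct2]])
          (rule nd)
    qed
    have out: "\<exists>w\<in>V. E x w" if "x \<in> V" for x
    proof -
      have "phom E V {(a0, x)}" by (rule phomI) (use V that I in auto)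
      from hh_set[OF hh this V(2)] show ?thesis using nontrans by blast
    qed
    show ?thesis
    proof (cases "T \<subseteq> {a, b, c}")
      case False
      then obtain d where d: "d \<in> T" "d \<notin> {a, b, c}" by blast
      \<comment> \<open>The cycle vertex \<open>a\<close> also serves as the base point
        \<open>v0\<close>.\<close>
      interpret L: local_tournament E T a a b c d
        by unfold_locales (use htour_T cT abc d nd in auto)
      obtain f \<Delta> where f: "circular_tournament \<Delta>" "bij_betw f T (verts \<Delta>)" "\<forall>x\<in>T. \<forall>y\<in>T. E x y \<longleftrightarrow> (f x, f y) \<in> arcs \<Delta>"
        using L.circular_representation by blast
      note B = blowup_eq[OF f(2) f(3)[rule_format]]
      have fin: "finite {s \<in> V. (f \<circ> rep) s = v} \<and> card {s \<in> V. (f \<circ> rep) s = v} \<le> 2" for v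
      proof (rule ccontr)
        assume "\<not> ?thesis"
        from card_gt_2[OF this] obtain x y z where xyz: "x \<in> V" "y \<in> V" "z \<in> V" "f (rep x) = v" "f (rep y) = v" "f (rep z) = v"
          "x \<noteq> y" "y \<noteq> z" "x \<noteq> z" by auto
        have rx: "rep x = rep y" "rep y = rep z" "rep x = rep z"
        proof -
          have inj: "inj_on f T" using f(2) unfolding bij_betw_def by blast
          have m: "rep x \<in> T" "rep y \<in> T" "rep z \<in> T" using xyz(1-3) by simp_all
          show "rep x = rep y" "rep y = rep z" "rep x = rep z"
            using inj_onD[OF inj _ m(1,2)] inj_onD[OF inj _ m(2,3)] inj_onD[OF inj _ m(1,3)] xyz(4-6) by simp_all
        qed
        have ne: "\<not> E x y" "\<not> E y x" "\<not> E y z" "\<not> E z y" "\<not> E x z" "\<not> E z x"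
          using not_sim_rep xyz rx by blast+
        obtain w where w: "w \<in> V" "E x w" using out xyz by blast
        have w': "E y w" "E z w" using w rep_E[of _ w] xyz rx by metis+
        have abV: "a \<in> V" "b \<in> V" "c \<in> V" using abc TV by blast+
        have "phom E V {(x, a), (y, b), (z, c)}"
          by (rule phomI) (use xyz ne I abV in auto)
        from hh_set[OF hh this w(1)] obtain u where u: "u \<in> V"
          "\<forall>p p'. (p, p') \<in> {(x, a), (y, b), (z, c)} \<longrightarrow> (E p w \<longrightarrow> E p' u) \<and> (E w p \<longrightarrow> E u p')" by blast
        have "E a u" "E b u" "E c u" using u(2) w w' by blast+
        then have "E a (rep u)" "E b (rep u)" "E c (rep u)" using sim_in[OF rep(2)[OF u(1)]] rep(1)[OF u(1)] by blast+
        then show False using nd2[of "rep u"] u(1) by blast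
      qed
      show ?thesis
        by (rule disjI2, rule disjI1, rule exI[of _ \<Delta>], rule exI[of _ V], rule exI[of _ "f \<circ> rep"],
            intro conjI ballI f(1) cnt B fin[THEN conjunct1] fin[THEN conjunct2])
    next
      case True
      then have Teq: "T = {a, b, c}" using abc by blast
      \<comment> \<open>Two vertices of one class have a common out-neighbour and could be mapped to
        \<open>a\<close> and \<open>b\<close>, which have none in a 3-cycle. So every class is a
        single vertex.\<close>
      have one: "p = q" if pq: "p \<in> V" "q \<in> V" "rep p = rep q" for p q
      proof (rule ccontr)
        assume ne: "p \<noteq> q"
        have n: "\<not> E p q" "\<not> E q p" using not_sim_rep[OF pq ne] by blast+
        obtain w where w: "w \<in> V" "E p w" using out pq by blast
        have w': "E q w" using w rep_E[of _ w] pq by metis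
        have abV: "a \<in> V" "b \<in> V" using abc TV by blast+
        obtain u where u: "u \<in> V" "E a u" "E b u" using hh2[OF pq(1,2) abV w(1) ne] n w w' by blast
        then have "E a (rep u)" "E b (rep u)" using sim_in[OF rep(2)[OF u(1)]] rep(1)[OF u(1)] by blast+
        moreover have "rep u \<in> {a, b, c}" using True u(1) by blast
        ultimately show False using e A I by blast
      qed
      have "rep p = p" if "p \<in> V" for p using one[OF rep(1)[OF that] that] rep_rep[OF that] by blast
      then have VT: "V = {a, b, c}" using Teq by auto
      have ne: "a \<noteq> b" "b \<noteq> c" "a \<noteq> c" using e I by blast+
      define h where "h x = (if x = a then 0 else if x = b then 1 else 2 :: nat)" for x
      have nn: "\<not> E b a" "\<not> E c b" "\<not> E a c" using e A by blast+
      have "is_iso h \<lparr>verts = V, arcs = {(x, y). E x y}\<rparr> C3"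
        unfolding is_iso_def C3_def bij_betw_def inj_on_def h_def using VT ne e nn I by auto
      then have "isomorphic \<lparr>verts = V, arcs = {(x, y). E x y}\<rparr> C3" unfolding isomorphic_def by blast
      then show ?thesis by (rule disjI1)
    qed
  qed
qed

end

section \<open>Assembly of the classification\<close>

theorem theorem2p26:
  fixes \<Gamma> :: "'a graph"
  assumes "oriented_graph \<Gamma>"
    and "countable (verts \<Gamma>)"
    and "hom_homogeneous \<Gamma>"
    and "weakly_connected \<Gamma>"
  shows
    "isomorphic \<Gamma> I1 \<or>
     isomorphic \<Gamma> Q_order \<or>
     (tree \<Gamma> \<and> (\<nexists>x. minimal_in \<Gamma> (verts \<Gamma>) x) \<and> no_finite_max_lower_bound \<Gamma>) \<or>
     (dual_tree \<Gamma> \<and> (\<nexists>x. maximal_in \<Gamma> (verts \<Gamma>) x) \<and> no_finite_min_upper_bound \<Gamma>) \<or>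
     (strict_poset \<Gamma> \<and>
       (\<forall>A\<subseteq>verts \<Gamma>. finite A \<longrightarrow> upper_bounds \<Gamma> A \<noteq> {} \<and> lower_bounds \<Gamma> A \<noteq> {}) \<and>
       no_finite_max_lower_bound \<Gamma> \<and> no_finite_min_upper_bound \<Gamma> \<and>
       (\<forall>a1 a2 b1 b2. X4 \<Gamma> a1 a2 b1 b2 \<longrightarrow> (\<nexists>m. X4_midpoint \<Gamma> a1 a2 b1 b2 m))) \<or>
     (\<exists>P :: 'a graph. generic_poset P \<and> poset_extension P \<Gamma>) \<or>
     isomorphic \<Gamma> C3 \<or>
     (\<exists>(\<Delta> :: complex graph) (S :: 'a set) f.
       circular_tournament \<Delta> \<and> countable S \<and> f ` S = verts \<Delta> \<and>
       (\<forall>v\<in>verts \<Delta>. finite {s \<in> S. f s = v} \<and> card {s \<in> S. f s = v} \<le> 2) \<and>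
       \<Gamma> = blowup \<Delta> S f) \<or>
     (\<exists>(\<Delta> :: nat graph) (S :: 'a set) f.
       generic_tournament \<Delta> \<and> countable S \<and> f ` S = verts \<Delta> \<and> \<Gamma> = blowup \<Delta> S f)"
proof -
  define V where "V = verts \<Gamma>"
  define E where "E x y \<longleftrightarrow> (x, y) \<in> arcs \<Gamma>" for x y
  have aE: "{(x, y). E x y} = arcs \<Gamma>" unfolding E_def by simp
  have GE: "\<Gamma> = \<lparr>verts = V, arcs = {(x, y). E x y}\<rparr>" unfolding aE V_def by simp
  have V0: "V \<noteq> {}" and EV: "\<And>x y. E x y \<Longrightarrow> x \<in> V \<and> y \<in> V" and asyE: "asy E"
    using assms(1) unfolding oriented_graph_def V_def E_def asy_def by (auto dest: asymD)
  have A: "E x y \<Longrightarrow> \<not> E y x" and I: "\<not> E x x" for x y using asyD[OF asyE] asy_irrefl[OF asyE] by blast+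
  have hhE: "hh E V" using hh_graph[OF assms(1,3)] unfolding E_def V_def .
  have conn: "(x, y) \<in> ({(x, y). E x y} \<union> {(x, y). E x y}\<inverse>)\<^sup>*" if "x \<in> V" "y \<in> V" for x y
    using assms(4) that unfolding weakly_connected_def aE V_def by blast
  have cnt: "countable V" using assms(2) unfolding V_def .
  consider "\<And>x y. \<not> E x y" | u0 u1 where "E u0 u1" "\<And>x y z. E x y \<Longrightarrow> E y z \<Longrightarrow> E x z"
    | a b c where "E a b" "E b c" "\<not> E a c" by blast
  then show ?thesis
  proof cases
    case 1
    obtain v where v: "v \<in> V" using V0 by blast
    have "x = v" if "x \<in> V" for x
      using conn[OF that v] 1 by simp
    then have V1: "verts \<Gamma> = {v}" using v unfolding V_def by blast
    have E0: "arcs \<Gamma> = {}" using 1 unfolding aE[symmetric] by blast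
    have "is_iso (\<lambda>_. 0 :: nat) \<Gamma> I1" unfolding is_iso_def I1_def V1 E0 bij_betw_def by simp
    then have "isomorphic \<Gamma> I1" unfolding isomorphic_def by blast
    then show ?thesis by (rule disjI1)
  next
    case (3 a b c)
    interpret hh_nontransitive V E a b c
      by unfold_locales (use hhE asyE EV cnt conn 3 in auto)
    from classification[folded GE] show ?thesis
      \<comment> \<open>Six disjuncts precede the three provided by
        \<open>classification\<close>.\<close>
      by (rule disjI2[THEN disjI2, THEN disjI2, THEN disjI2, THEN disjI2, THEN disjI2])
  next
    case (2 u0 u1)
    interpret hh_poset V E u0 u1
      by unfold_locales (use hhE asyE EV cnt 2 in auto)
    have tr: "trans (arcs \<Gamma>)" using 2(2) unfolding E_def by (intro transI) blast
    have sp: "strict_poset \<Gamma>" unfolding strict_poset_def using assms(1) tr by blast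
    have nmax: "no_finite_max_lower_bound \<Gamma>" unfolding no_finite_max_lower_bound_def
    proof (intro allI impI notI)
      fix S assume S: "S \<subseteq> verts \<Gamma>" "finite S" and "\<exists>z. maximal_in \<Gamma> (lower_bounds \<Gamma> S) z"
      then obtain z where z: "z \<in> V" "\<And>a. a \<in> S \<Longrightarrow> E z a" "\<And>y. y \<in> V \<Longrightarrow> (\<forall>a\<in>S. E y a) \<Longrightarrow> \<not> E z y"
        unfolding maximal_in_def lower_bounds_def V_def E_def by blast
      have "S \<subseteq> V" using S(1) unfolding V_def .
      from lower_bound_not_maximal[OF S(2) this z(1,2)] z(3) show False by blast
    qed
    have nmin: "no_finite_min_upper_bound \<Gamma>" unfolding no_finite_min_upper_bound_def
    proof (intro allI impI notI)
      fix S assume S: "S \<subseteq> verts \<Gamma>" "finite S" and "\<exists>z. minimal_in \<Gamma> (upper_bounds \<Gamma> S) z"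
      then obtain z where z: "z \<in> V" "\<And>a. a \<in> S \<Longrightarrow> E a z" "\<And>y. y \<in> V \<Longrightarrow> (\<forall>a\<in>S. E a y) \<Longrightarrow> \<not> E y z"
        unfolding minimal_in_def upper_bounds_def V_def E_def by blast
      have "S \<subseteq> V" using S(1) unfolding V_def .
      from upper_bound_not_minimal[OF S(2) this z(1,2)] z(3) show False by blast
    qed
    have nomin: "\<nexists>x. minimal_in \<Gamma> (verts \<Gamma>) x" "\<nexists>x. maximal_in \<Gamma> (verts \<Gamma>) x"
      unfolding minimal_in_def maximal_in_def using up_down unfolding V_def E_def by blast+
    \<comment> \<open>\<open>?up\<close> and \<open>?dn\<close> say that some incomparable pair has
      a common upper, or lower, bound. A chain satisfies neither, so (Q,<) is treated as a tree
      without minimal elements.\<close>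
    let ?up = "\<exists>x y u. x \<noteq> y \<and> \<not> E x y \<and> \<not> E y x \<and> E x u \<and> E y u"
    let ?dn = "\<exists>x y u. x \<noteq> y \<and> \<not> E x y \<and> \<not> E y x \<and> E u x \<and> E u y"
    show ?thesis
    proof (cases ?up)
      case False
      have "total_on {y \<in> verts \<Gamma>. (y, x) \<in> arcs \<Gamma>} (arcs \<Gamma>)" for x
        unfolding total_on_def using False unfolding E_def by blast
      then have "tree \<Gamma>" unfolding tree_def using sp by blast
      then have "tree \<Gamma> \<and> (\<nexists>x. minimal_in \<Gamma> (verts \<Gamma>) x) \<and> no_finite_max_lower_bound \<Gamma>" using nomin nmax by blast
      then show ?thesis by (rule disjI1[THEN disjI2, THEN disjI2])
    next
      case up: True
      show ?thesis
      proof (cases ?dn)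
        case False
        have "total_on {y \<in> verts \<Gamma>. (x, y) \<in> arcs \<Gamma>} ((arcs \<Gamma>)\<inverse>)" for x
          unfolding total_on_def using False unfolding E_def by blast
        moreover have "strict_poset (dual \<Gamma>)"
        proof -
          have "trans ((arcs \<Gamma>)\<inverse>)" using transD[OF tr] by (intro transI) blast
          moreover have "asym ((arcs \<Gamma>)\<inverse>)" using A unfolding E_def by (intro asymI) blast
          ultimately show ?thesis using assms(1) unfolding strict_poset_def oriented_graph_def dual_def by auto
        qed
        ultimately have "dual_tree \<Gamma>" unfolding dual_tree_def tree_def by (simp add: dual_def)
        then have "dual_tree \<Gamma> \<and> (\<nexists>x. maximal_in \<Gamma> (verts \<Gamma>) x) \<and> no_finite_min_upper_bound \<Gamma>" using nomin nmin by blast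
        then show ?thesis by (rule disjI1[THEN disjI2, THEN disjI2, THEN disjI2])
      next
        case dn: True
        have bd: "upper_bounds \<Gamma> S \<noteq> {} \<and> lower_bounds \<Gamma> S \<noteq> {}" if S: "S \<subseteq> verts \<Gamma>" "finite S" for S
        proof
          obtain x y u where x: "x \<noteq> y" "\<not> E x y" "\<not> E y x" "E x u" "E y u" using up by blast
          have "x \<in> V" "y \<in> V" using EV x by blast+
          then show "upper_bounds \<Gamma> S \<noteq> {}" using directed_up[OF _ _ x S(2)] S(1) unfolding upper_bounds_def V_def E_def by blast
          obtain x y u where x: "x \<noteq> y" "\<not> E x y" "\<not> E y x" "E u x" "E u y" using dn by blast
          have "x \<in> V" "y \<in> V" using EV x by blast+
          then show "lower_bounds \<Gamma> S \<noteq> {}" using directed_down[OF _ _ x S(2)] S(1) unfolding lower_bounds_def V_def E_def by blast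
        qed
        show ?thesis
        proof (cases "\<exists>a1 a2 b1 b2 m. X4 \<Gamma> a1 a2 b1 b2 \<and> X4_midpoint \<Gamma> a1 a2 b1 b2 m")
          case False
          then have "strict_poset \<Gamma> \<and> (\<forall>A\<subseteq>verts \<Gamma>. finite A \<longrightarrow> upper_bounds \<Gamma> A \<noteq> {} \<and> lower_bounds \<Gamma> A \<noteq> {}) \<and>
              no_finite_max_lower_bound \<Gamma> \<and> no_finite_min_upper_bound \<Gamma> \<and>
              (\<forall>a1 a2 b1 b2. X4 \<Gamma> a1 a2 b1 b2 \<longrightarrow> (\<nexists>m. X4_midpoint \<Gamma> a1 a2 b1 b2 m))" using sp bd nmax nmin by blast
          then show ?thesis by (rule disjI1[THEN disjI2, THEN disjI2, THEN disjI2, THEN disjI2])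
        next
          case True
          then obtain a1 a2 b1 b2 m where X: "X4 \<Gamma> a1 a2 b1 b2" "X4_midpoint \<Gamma> a1 a2 b1 b2 m" by blast
          interpret M: hh_poset_mid V E u0 u1 a1 a2 b1 b2 m
            by unfold_locales (use X in \<open>auto simp: X4_def X4_midpoint_def incomparable_def E_def\<close>)
          obtain P where P: "generic_poset P" "strict_poset P" "verts P = V" "arcs P \<subseteq> {(x, y). E x y}"
            using M.extends_generic by blast
          then have "poset_extension P \<Gamma>" unfolding poset_extension_def using sp aE V_def by simp
          then have "\<exists>P :: 'a graph. generic_poset P \<and> poset_extension P \<Gamma>" using P(1) by blast
          then show ?thesis by (rule disjI1[THEN disjI2, THEN disjI2, THEN disjI2, THEN disjI2, THEN disjI2])
        qed
      qed
    qed
  qed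
qed

end
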